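(* Let $k\ge2$ and $R>0$. Suppose that for each $d\in\mathbb N$ there is a proper density estimator $\hat P=\hat P(X_1,\dots,X_n)\in\mathcal P_{k,d}$ such that for every $\Gamma\in\mathcal G_{k,d}$ and $X_1,\dots,X_n$ i.i.d. from $P_\Gamma$, $\mathbb E\,H(\hat P,P_\Gamma)\le c_k\sqrt{d/n}$, for some constant $c_k$. Then there is an estimator $\hat\Gamma$ of $\Gamma$ based on $2n$ i.i.d. observations from $P_\Gamma$, and a constant $C>0$ (depending only on $R$), such that for every $\Gamma\in\mathcal G_{k,d}$, $$\mathbb E\,W_1(\hat\Gamma,\Gamma)\le (Ck)^{k/2}\sqrt{c_k}\Big(\frac dn\Big)^{1/4}+Ck^5c_k^{1/(2k-1)}\Big(\frac1n\Big)^{1/(4k-2)}.$$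
   Context: $\mathcal G_{k,d}$: $k$-atomic distributions on $\mathbb R^d$ with atoms of Euclidean norm at most $R$. $\mathcal P_{k,d}=\{P_\Gamma:\Gamma\in\mathcal G_{k,d}\}$ with $P_\Gamma=\Gamma*N(0,I_d)$; "proper" means the estimator takes values in $\mathcal P_{k,d}$. $H$ is the Hellinger distance $H(P,Q)=(\int(\sqrt p-\sqrt q)^2)^{1/2}$ and $W_1$ the 1-Wasserstein distance with Euclidean cost. *)

theory Defs
  imports "HOL-Probability.Probability"
begin

text \<open>Points of R^d are functions nat => real restricted (extensionally) to {..<d}.\<close>

definition Rd :: "nat \<Rightarrow> (nat \<Rightarrow> real) measure" where
  "Rd d = PiM {..<d} (\<lambda>_. borel)"

definition lebd :: "nat \<Rightarrow> (nat \<Rightarrow> real) measure" where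
  "lebd d = PiM {..<d} (\<lambda>_. lborel)"

definition enorm :: "nat \<Rightarrow> (nat \<Rightarrow> real) \<Rightarrow> real" where
  "enorm d x = sqrt (\<Sum>i<d. (x i)\<^sup>2)"

definition edist :: "nat \<Rightarrow> (nat \<Rightarrow> real) \<Rightarrow> (nat \<Rightarrow> real) \<Rightarrow> real" where
  "edist d x y = enorm d (\<lambda>i. x i - y i)"

text \<open>Parameters (w,a) describe a k-atomic distribution in G_{k,d}: weights w 0..w (k-1),
  atoms a 0..a (k-1) in R^d of Euclidean norm at most R.\<close>
definition valid_params :: "nat \<Rightarrow> nat \<Rightarrow> real \<Rightarrow> (nat \<Rightarrow> real) \<Rightarrow> (nat \<Rightarrow> nat \<Rightarrow> real) \<Rightarrow> bool" where
  "valid_params d k R w a \<longleftrightarrow>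
     (\<forall>j<k. 0 \<le> w j) \<and> (\<Sum>j<k. w j) = 1 \<and>
     (\<forall>j<k. a j \<in> space (Rd d) \<and> enorm d (a j) \<le> R)"

definition mixG :: "nat \<Rightarrow> nat \<Rightarrow> (nat \<Rightarrow> real) \<Rightarrow> (nat \<Rightarrow> nat \<Rightarrow> real) \<Rightarrow> (nat \<Rightarrow> real) measure" where
  "mixG d k w a = measure_of (space (Rd d)) (sets (Rd d))
      (\<lambda>A. \<Sum>j<k. ennreal (w j) * indicator A (a j))"

text \<open>Density of P_Gamma = Gamma * N(0, I_d) w.r.t. Lebesgue measure on R^d.\<close>
definition gmix_density :: "nat \<Rightarrow> nat \<Rightarrow> (nat \<Rightarrow> real) \<Rightarrow> (nat \<Rightarrow> nat \<Rightarrow> real) \<Rightarrow> (nat \<Rightarrow> real) \<Rightarrow> real" where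
  "gmix_density d k w a x = (\<Sum>j<k. w j * (\<Prod>i<d. std_normal_density (x i - a j i)))"

definition PGamma :: "nat \<Rightarrow> nat \<Rightarrow> (nat \<Rightarrow> real) \<Rightarrow> (nat \<Rightarrow> nat \<Rightarrow> real) \<Rightarrow> (nat \<Rightarrow> real) measure" where
  "PGamma d k w a = density (lebd d) (\<lambda>x. ennreal (gmix_density d k w a x))"

definition hellinger :: "nat \<Rightarrow> ((nat \<Rightarrow> real) \<Rightarrow> real) \<Rightarrow> ((nat \<Rightarrow> real) \<Rightarrow> real) \<Rightarrow> real" where
  "hellinger d p q = sqrt (enn2real (\<integral>\<^sup>+ x. ennreal ((sqrt (p x) - sqrt (q x))\<^sup>2) \<partial>lebd d))"

definition samples :: "nat \<Rightarrow> (nat \<Rightarrow> real) measure \<Rightarrow> (nat \<Rightarrow> (nat \<Rightarrow> real)) measure" where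
  "samples m P = PiM {..<m} (\<lambda>_. P)"

definition couplings :: "nat \<Rightarrow> (nat \<Rightarrow> real) measure \<Rightarrow> (nat \<Rightarrow> real) measure
    \<Rightarrow> ((nat \<Rightarrow> real) \<times> (nat \<Rightarrow> real)) measure set" where
  "couplings d M N = {\<pi>. sets \<pi> = sets (Rd d \<Otimes>\<^sub>M Rd d) \<and> prob_space \<pi> \<and>
      distr \<pi> (Rd d) fst = M \<and> distr \<pi> (Rd d) snd = N}"

definition W1 :: "nat \<Rightarrow> (nat \<Rightarrow> real) measure \<Rightarrow> (nat \<Rightarrow> real) measure \<Rightarrow> ennreal" where
  "W1 d M N = (INF \<pi>\<in>couplings d M N. \<integral>\<^sup>+ z. ennreal (edist d (fst z) (snd z)) \<partial>\<pi>)"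

end

theory Submission
  imports Defs "HOL-Computational_Algebra.Polynomial"
begin

text \<open>The proof compares mixing distributions through their moment generating functions
  \<open>\<Sum>\<^sub>j w\<^sub>j exp (s \<bullet> a\<^sub>j)\<close>, \<open>|s| \<le> 1\<close>, which the Hellinger distance of the Gaussian mixtures controls
  up to a factor depending only on \<open>R\<close>. The first \<open>n\<close> observations give a \<open>k\<close>-atomic estimate whose
  atoms span a space of dimension \<open>m \<le> k\<close>; the generating functions in directions orthogonal to it bound
  the mass of \<open>\<Gamma>\<close> outside that space, at the cost \<open>(d/n)\<^bsup>1/4\<^esup>\<close>. The other \<open>n\<close> observations, projected to
  the space, follow an \<open>m\<close>-dimensional Gaussian mixture, and the density estimator of dimension \<open>m\<close>
  applies to them. In dimension \<open>m\<close> the atoms are projected to a line along a direction that keeps all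
  \<open>k\<^sup>2\<close> differences large, and exponentiated, which turns generating functions into moments; matching
  \<open>2k - 1\<close> moments up to \<open>h\<close> gives transport cost of order \<open>h\<^bsup>1/(2k-1)\<^esup>\<close>. Both density estimates are rounded to
  a countable dense set of parameters, which settles all measurability questions.\<close>

text \<open>Comparing k-atomic measures directly in R^d would put the dimension under the slow root:
  the exponent 1/(2k-1) would fall on sqrt(d/n). The two stages keep it out. Leaving the estimated
  span costs only a second moment in orthogonal directions, where first-order terms cancel between s
  and -s; the loss is one square root, and sqrt(d/n) becomes (d/n)^(1/4). Within the span the
  dimension is at most k and d no longer occurs. Fresh observations serve there because data
  projected along a direction that depends on them need not follow a Gaussian mixture. The number
  2k-1 is the degree that interpolates a step function on the at most 2k atoms of two k-atomic
  measures on a line. Generating functions on the unit ball keep the factor between Hellinger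
  distance and discrepancy free of k and d; the power k^5 comes from the choice of a projection
  direction and from counting gaps between atoms.\<close>

section \<open>Transport and moments on the line\<close>

text \<open>The sum of absolute coefficients is submultiplicative, and a monic linear factor
  contributes \<open>1 + \<bar>a\<bar>\<close>. This prices one step of the interpolation recursion
  below.\<close>

lemma sum_abs_coeff_linear_mult:
  fixes p :: "real poly"
  assumes "degree p \<le> n"
  shows "(\<Sum>i\<le>Suc n. \<bar>coeff ([:-a, 1:] * p) i\<bar>) \<le> (1 + \<bar>a\<bar>) * (\<Sum>i\<le>n. \<bar>coeff p i\<bar>)"
proof -
  have top: "coeff p (Suc n) = 0"
    using assms by (simp add: coeff_eq_0)
  have "(\<Sum>i\<le>Suc n. \<bar>coeff ([:-a, 1:] * p) i\<bar>)
      \<le> (\<Sum>i\<le>Suc n. \<bar>a\<bar> * \<bar>coeff p i\<bar> + \<bar>coeff (pCons 0 p) i\<bar>)"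
    by (intro sum_mono) (simp add: abs_mult[symmetric] algebra_simps del: abs_mult)
  also have "\<dots> = \<bar>a\<bar> * (\<Sum>i\<le>Suc n. \<bar>coeff p i\<bar>) + (\<Sum>i\<le>Suc n. \<bar>coeff (pCons 0 p) i\<bar>)"
    by (simp add: sum.distrib sum_distrib_left del: sum.atMost_Suc)
  also have "(\<Sum>i\<le>Suc n. \<bar>coeff (pCons 0 p) i\<bar>) = (\<Sum>i\<le>n. \<bar>coeff p i\<bar>)"
    by (subst sum.atMost_Suc_shift) simp
  also have "(\<Sum>i\<le>Suc n. \<bar>coeff p i\<bar>) = (\<Sum>i\<le>n. \<bar>coeff p i\<bar>)"
    using top by simp
  finally show ?thesis by (simp add: algebra_simps)
qed

text \<open>Neville's recursion, always removing one node from each side of the jump, so that only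
  differences of size at least the gap appear in denominators.\<close>

lemma step_interpolation:
  fixes L U :: "real set"
  assumes "finite L" "finite U" "card L + card U \<le> Suc n"
    and "0 < g" "g \<le> 2 * (1 + M)"
    and "\<And>a b. a \<in> L \<Longrightarrow> b \<in> U \<Longrightarrow> g \<le> b - a"
    and "\<And>a. a \<in> L \<union> U \<Longrightarrow> \<bar>a\<bar> \<le> M"
  shows "\<exists>p. degree p \<le> n \<and> (\<forall>a\<in>L. poly p a = 1) \<and> (\<forall>b\<in>U. poly p b = 0)
    \<and> (\<Sum>i\<le>n. \<bar>coeff p i\<bar>) \<le> (2 * (1 + M) / g) ^ n"
  using assms
proof (induction n arbitrary: L U)
  \<comment> \<open>With at most one node, one side of the jump is empty and a constant polynomial
    interpolates.\<close>
  case 0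
  then have "L = {} \<or> U = {}"
    by (metis One_nat_def add_is_1 card_0_eq le_Suc_eq le_zero_eq add_is_0)
  then show ?case
  proof
    assume "L = {}" then show ?thesis by (intro exI[of _ 0]) auto
  next
    assume "U = {}" then show ?thesis by (intro exI[of _ 1]) auto
  qed
next
  case (Suc n)
  let ?K = "2 * (1 + M) / g"
  \<comment> \<open>The constant polynomial 1 has coefficient sum 1, so covering the case of an
    empty side by \<open>?K ^ Suc n\<close> requires \<open>?K\<close> to be at least 1.\<close>
  have K: "1 \<le> ?K" using Suc.prems(4,5) by simp
  have sum1: "(\<Sum>i\<le>m. \<bar>coeff (1::real poly) i\<bar>) = 1" for m
    by (induction m) (auto simp: coeff_1)
  show ?case
  proof (cases "L = {} \<or> U = {}")
    case True
    then show ?thesis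
    proof
      assume "L = {}" then show ?thesis using zero_le_power[of ?K "Suc n"] K
        by (intro exI[of _ 0]) (auto simp del: power_Suc)
    next
      assume "U = {}" then show ?thesis using K sum1 one_le_power[OF K]
        by (intro exI[of _ 1]) (auto simp del: sum.atMost_Suc power_Suc)
    qed
  next
    case False
    then obtain a b where ab: "a \<in> L" "b \<in> U" by auto
    have gap: "g \<le> b - a" using Suc.prems(6) ab by auto
    then have pos: "0 < b - a" using Suc.prems(4) by linarith
    have "0 < card L" "0 < card U" using ab Suc.prems(1,2) by (auto simp: card_gt_0_iff)
    then have cards: "card (L - {a}) + card U \<le> Suc n" "card L + card (U - {b}) \<le> Suc n"
      using Suc.prems(3) ab by auto
    obtain p where p: "degree p \<le> n" "\<forall>x\<in>L - {a}. poly p x = 1" "\<forall>x\<in>U. poly p x = 0"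
      "(\<Sum>i\<le>n. \<bar>coeff p i\<bar>) \<le> ?K ^ n"
      using Suc.IH[of "L - {a}" U] Suc.prems cards by auto
    obtain q where q: "degree q \<le> n" "\<forall>x\<in>L. poly q x = 1" "\<forall>x\<in>U - {b}. poly q x = 0"
      "(\<Sum>i\<le>n. \<bar>coeff q i\<bar>) \<le> ?K ^ n"
      using Suc.IH[of L "U - {b}"] Suc.prems cards by auto
    \<comment> \<open>\<open>p\<close> lacks the node \<open>a\<close> and \<open>q\<close> lacks
      \<open>b\<close>; the weights \<open>(x - a) / (b - a)\<close> and
      \<open>- (x - b) / (b - a)\<close> sum to 1 and mute each polynomial at the node it lacks.
      Both linear factors have coefficient sum at most \<open>1 + M\<close> and the denominator is
      at least \<open>g\<close>, hence the factor \<open>2 * (1 + M) / g\<close>.\<close>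
    define P where "P = [:-a, 1:] * p"
    define Q where "Q = [:-b, 1:] * q"
    define r where "r = smult (1 / (b - a)) (P - Q)"
    have dP: "degree P \<le> Suc n" "degree Q \<le> Suc n"
      using p(1) q(1) degree_mult_le[of "[:-a,1:]" p] degree_mult_le[of "[:-b,1:]" q]
      by (auto simp: P_def Q_def simp del: mult_pCons_left)
    have r: "poly r x = ((x - a) * poly p x - (x - b) * poly q x) / (b - a)" for x
      by (simp add: r_def P_def Q_def field_simps)
    have "(\<Sum>i\<le>Suc n. \<bar>coeff P i\<bar>) \<le> (1 + \<bar>a\<bar>) * (\<Sum>i\<le>n. \<bar>coeff p i\<bar>)"
      unfolding P_def by (rule sum_abs_coeff_linear_mult[OF p(1)])
    also have "\<dots> \<le> (1 + M) * ?K ^ n"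
      using Suc.prems(7)[of a] ab p(4) by (intro mult_mono) (auto intro: sum_nonneg)
    finally have nP: "(\<Sum>i\<le>Suc n. \<bar>coeff P i\<bar>) \<le> (1 + M) * ?K ^ n" .
    have "(\<Sum>i\<le>Suc n. \<bar>coeff Q i\<bar>) \<le> (1 + \<bar>b\<bar>) * (\<Sum>i\<le>n. \<bar>coeff q i\<bar>)"
      unfolding Q_def by (rule sum_abs_coeff_linear_mult[OF q(1)])
    also have "\<dots> \<le> (1 + M) * ?K ^ n"
      using Suc.prems(7)[of b] ab q(4) by (intro mult_mono) (auto intro: sum_nonneg)
    finally have nQ: "(\<Sum>i\<le>Suc n. \<bar>coeff Q i\<bar>) \<le> (1 + M) * ?K ^ n" .
    have "(\<Sum>i\<le>Suc n. \<bar>coeff r i\<bar>) \<le> (\<Sum>i\<le>Suc n. (1 / (b - a)) * (\<bar>coeff P i\<bar> + \<bar>coeff Q i\<bar>))"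
    proof (intro sum_mono)
      fix i
      have "\<bar>coeff r i\<bar> = (1 / (b - a)) * \<bar>coeff P i - coeff Q i\<bar>"
        using pos by (simp add: r_def abs_mult)
      also have "\<dots> \<le> (1 / (b - a)) * (\<bar>coeff P i\<bar> + \<bar>coeff Q i\<bar>)"
        using pos by (intro mult_left_mono) auto
      finally show "\<bar>coeff r i\<bar> \<le> (1 / (b - a)) * (\<bar>coeff P i\<bar> + \<bar>coeff Q i\<bar>)" .
    qed
    also have "\<dots> = (1 / (b - a)) * ((\<Sum>i\<le>Suc n. \<bar>coeff P i\<bar>) + (\<Sum>i\<le>Suc n. \<bar>coeff Q i\<bar>))"
      by (simp only: sum_distrib_left[symmetric] sum.distrib)
    also have "\<dots> \<le> (1 / g) * ((1 + M) * ?K ^ n + (1 + M) * ?K ^ n)"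
      using pos gap Suc.prems(4) nP nQ
      by (intro mult_mono add_mono add_nonneg_nonneg sum_nonneg) (auto simp: frac_le simp del: sum.atMost_Suc)
    also have "\<dots> = ?K ^ Suc n" by simp
    finally have "(\<Sum>i\<le>Suc n. \<bar>coeff r i\<bar>) \<le> ?K ^ Suc n" .
    moreover have "degree r \<le> Suc n"
      unfolding r_def using dP by (meson degree_diff_le degree_smult_le order_trans)
    moreover have "poly r x = 1" if "x \<in> L" for x
      using p(2) q(2) pos that by (cases "x = a") (auto simp: r field_simps)
    moreover have "poly r x = 0" if "x \<in> U" for x
      using p(3) q(3) pos that by (cases "x = b") (auto simp: r field_simps)
    ultimately show ?thesis by blast
  qed
qed

lemma poly_eq_sum_le:
  fixes p :: "real poly"
  assumes "degree p \<le> n"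
  shows "poly p x = (\<Sum>i\<le>n. coeff p i * x ^ i)"
  unfolding poly_altdef
  using assms by (intro sum.mono_neutral_left) (auto simp: coeff_eq_0)

text \<open>On \<open>T\<close> the indicator of \<open>x \<le> c\<close> agrees with a polynomial
  of degree at most \<open>n\<close>, so a difference of cumulative weights is a combination of
  moment differences, amplified by the sum of absolute coefficients. Only the gap straddling
  \<open>c\<close> enters, not the smallest gap in \<open>T\<close>.\<close>

lemma cdf_gap_bound:
  fixes x y w v :: "nat \<Rightarrow> real"
  assumes mom: "\<And>l. l \<le> n \<Longrightarrow> \<bar>(\<Sum>i<k. w i * x i ^ l) - (\<Sum>i<k. v i * y i ^ l)\<bar> \<le> h"
    and T: "T = x ` {..<k} \<union> y ` {..<k}" "card T \<le> Suc n"
    and g: "0 < g" "g \<le> 2 * (1 + M)"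
    and gap: "\<And>a b. a \<in> T \<Longrightarrow> b \<in> T \<Longrightarrow> a \<le> c \<Longrightarrow> c < b \<Longrightarrow> g \<le> b - a"
    and M: "\<And>a. a \<in> T \<Longrightarrow> \<bar>a\<bar> \<le> M"
  shows "\<bar>(\<Sum>i<k. w i * of_bool (x i \<le> c)) - (\<Sum>i<k. v i * of_bool (y i \<le> c))\<bar>
    \<le> h * (2 * (1 + M) / g) ^ n"
proof -
  let ?L = "{a\<in>T. a \<le> c}" and ?U = "{a\<in>T. c < a}"
  have fin: "finite T" using T by auto
  have "card ?L + card ?U = card (?L \<union> ?U)"
    using fin by (subst card_Un_disjoint) auto
  also have "?L \<union> ?U = T" by auto
  finally have "card ?L + card ?U \<le> Suc n" using T by simp
  then obtain p where p: "degree p \<le> n" "\<forall>a\<in>?L. poly p a = 1" "\<forall>b\<in>?U. poly p b = 0"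
    "(\<Sum>i\<le>n. \<bar>coeff p i\<bar>) \<le> (2 * (1 + M) / g) ^ n"
    using step_interpolation[of ?L ?U n g M] fin g gap M by auto
  have eval: "(\<Sum>i<k. u i * of_bool (z i \<le> c)) = (\<Sum>l\<le>n. coeff p l * (\<Sum>i<k. u i * z i ^ l))"
    if "z ` {..<k} \<subseteq> T" for u z :: "nat \<Rightarrow> real"
  proof -
    have "(\<Sum>i<k. u i * of_bool (z i \<le> c)) = (\<Sum>i<k. u i * poly p (z i))"
    proof (intro sum.cong refl)
      fix i assume "i \<in> {..<k}"
      then have "z i \<in> T" using that by auto
      then have "poly p (z i) = of_bool (z i \<le> c)"
        using p(2,3) by (cases "z i \<le> c") auto
      then show "u i * of_bool (z i \<le> c) = u i * poly p (z i)" by simp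
    qed
    also have "\<dots> = (\<Sum>i<k. \<Sum>l\<le>n. coeff p l * (u i * z i ^ l))"
      by (simp add: poly_eq_sum_le[OF p(1)] sum_distrib_left algebra_simps)
    also have "\<dots> = (\<Sum>l\<le>n. coeff p l * (\<Sum>i<k. u i * z i ^ l))"
      by (subst sum.swap) (simp add: sum_distrib_left)
    finally show ?thesis .
  qed
  have h: "0 \<le> h" using mom[of 0] by (smt (verit) le0)
  have "\<bar>(\<Sum>i<k. w i * of_bool (x i \<le> c)) - (\<Sum>i<k. v i * of_bool (y i \<le> c))\<bar>
    = \<bar>\<Sum>l\<le>n. coeff p l * ((\<Sum>i<k. w i * x i ^ l) - (\<Sum>i<k. v i * y i ^ l))\<bar>"
    using eval[of x w] eval[of y v] T
    by (simp only: right_diff_distrib sum_subtractf) simp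
  also have "\<dots> \<le> (\<Sum>l\<le>n. \<bar>coeff p l\<bar> * h)"
    by (rule order_trans[OF sum_abs], intro sum_mono) (auto simp: abs_mult intro!: mult_left_mono mom)
  also have "\<dots> = h * (\<Sum>l\<le>n. \<bar>coeff p l\<bar>)" by (simp add: sum_distrib_left mult.commute)
  also have "\<dots> \<le> h * (2 * (1 + M) / g) ^ n" using p(4) h by (rule mult_left_mono)
  finally show ?thesis .
qed

section \<open>Discrete transport plans and cumulative weights\<close>

definition transport_plan :: "nat \<Rightarrow> (nat \<Rightarrow> real) \<Rightarrow> (nat \<Rightarrow> real) \<Rightarrow> (nat \<Rightarrow> nat \<Rightarrow> real) \<Rightarrow> bool" where
  "transport_plan k w v \<pi> \<longleftrightarrow> (\<forall>i<k. \<forall>j<k. 0 \<le> \<pi> i j) \<and>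
     (\<forall>i<k. (\<Sum>j<k. \<pi> i j) = w i) \<and> (\<forall>j<k. (\<Sum>i<k. \<pi> i j) = v j)"

text \<open>The comonotone plan: mixed second differences of \<^term>\<open>min (F i) (G j)\<close>, where
  \<open>F\<close> and \<open>G\<close> are the cumulative weights.\<close>

lemma comonotone_plan_mono:
  fixes x y w v :: "nat \<Rightarrow> real"
  assumes w: "\<And>i. i < k \<Longrightarrow> 0 \<le> w i" and v: "\<And>i. i < k \<Longrightarrow> 0 \<le> v i"
    and eq: "(\<Sum>i<k. w i) = (\<Sum>i<k. v i)"
    and x: "mono_on {..<k} x" and y: "mono_on {..<k} y"
  shows "\<exists>\<pi>. transport_plan k w v \<pi> \<and>
    (\<forall>c. (\<Sum>i<k. \<Sum>j<k. \<pi> i j * \<bar>of_bool (x i \<le> c) - of_bool (y j \<le> c)\<bar>)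
       = \<bar>(\<Sum>i<k. w i * of_bool (x i \<le> c)) - (\<Sum>i<k. v i * of_bool (y i \<le> c))\<bar>)"
proof -
  define F where "F p = (\<Sum>i<p. w i)" for p
  define G where "G p = (\<Sum>i<p. v i)" for p
  define D where "D p q = min (F p) (G q)" for p q
  define \<pi> where "\<pi> i j = D (Suc i) (Suc j) - D i (Suc j) - (D (Suc i) j - D i j)" for i j
  have F: "F p \<le> F q" if "p \<le> q" "q \<le> k" for p q
    unfolding F_def using that w by (intro sum_mono2) auto
  have G: "G p \<le> G q" if "p \<le> q" "q \<le> k" for p q
    unfolding G_def using that v by (intro sum_mono2) auto
  have FG0: "F 0 = 0" "G 0 = 0" "F k = G k" using eq by (auto simp: F_def G_def)
  have D0: "D p 0 = 0" "D 0 p = 0" "D p k = F p" "D k p = G p" if "p \<le> k" for p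
    using that F[of 0 p] G[of 0 p] F[of p k] G[of p k] FG0 by (auto simp: D_def)
  \<comment> \<open>\<open>min\<close> is supermodular, so its mixed differences along the
    nondecreasing sequences \<open>F\<close> and \<open>G\<close> are nonnegative.\<close>
  have pos: "0 \<le> \<pi> i j" if "i < k" "j < k" for i j
    using F[of i "Suc i"] G[of j "Suc j"] that by (auto simp: \<pi>_def D_def min_def)
  have block: "(\<Sum>i<p. \<Sum>j<q. \<pi> i j) = D p q" if "p \<le> k" "q \<le> k" for p q
  proof -
    have "(\<Sum>j<q. \<pi> i j) = D (Suc i) q - D i q" if "i < p" for i
    proof -
      have "(\<Sum>j<q. \<pi> i j) = (\<Sum>j<q. (D (Suc i) (Suc j) - D i (Suc j)) - (D (Suc i) j - D i j))"
        by (simp add: \<pi>_def)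
      also have "\<dots> = (D (Suc i) q - D i q) - (D (Suc i) 0 - D i 0)"
        by (rule sum_lessThan_telescope)
      finally show ?thesis using D0 that \<open>p \<le> k\<close> by simp
    qed
    then have "(\<Sum>i<p. \<Sum>j<q. \<pi> i j) = (\<Sum>i<p. D (Suc i) q - D i q)" by simp
    also have "\<dots> = D p q - D 0 q" by (rule sum_lessThan_telescope)
    finally show ?thesis using D0 that by simp
  qed
  have row: "(\<Sum>j<k. \<pi> i j) = w i" if "i < k" for i
    using block[of "Suc i" k] block[of i k] that D0 by (simp add: F_def)
  have col: "(\<Sum>i<k. \<pi> i j) = v j" if "j < k" for j
    using block[of k "Suc j"] block[of k j] that D0 by (simp add: G_def sum.distrib)
  \<comment> \<open>For sorted points every threshold set \<open>z i \<le> c\<close> is an initial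
    segment of indices, so its weight is a value of \<open>F\<close> or \<open>G\<close>.\<close>
  have down: "\<exists>p\<le>k. \<forall>i<k. z i \<le> c \<longleftrightarrow> i < p" if z: "mono_on {..<k} z" for z :: "nat \<Rightarrow> real" and c
  proof (cases "\<exists>i<k. \<not> z i \<le> c")
    case True
    define p where "p = (LEAST i. i < k \<and> \<not> z i \<le> c)"
    have p: "p < k" "\<not> z p \<le> c"
      using LeastI_ex[OF True] by (auto simp: p_def)
    have "z i \<le> c \<longleftrightarrow> i < p" if "i < k" for i
      using not_less_Least[of i "\<lambda>i. i < k \<and> \<not> z i \<le> c"] that p mono_onD[OF z, of p i]
      by (fastforce simp: p_def[symmetric] not_less)
    then show ?thesis using p by (intro exI[of _ p]) auto
  next
    case False
    then show ?thesis by (intro exI[of _ k]) auto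
  qed
  have cost: "(\<Sum>i<k. \<Sum>j<k. \<pi> i j * \<bar>of_bool (x i \<le> c) - of_bool (y j \<le> c)\<bar>)
       = \<bar>(\<Sum>i<k. w i * of_bool (x i \<le> c)) - (\<Sum>i<k. v i * of_bool (y i \<le> c))\<bar>" for c
  proof -
    obtain p where p: "p \<le> k" "\<forall>i<k. x i \<le> c \<longleftrightarrow> i < p" using down[OF x] by blast
    obtain q where q: "q \<le> k" "\<forall>i<k. y i \<le> c \<longleftrightarrow> i < q" using down[OF y] by blast
    have trunc: "(\<Sum>i<k. u i * of_bool (i < r)) = (\<Sum>i<r. u i)" if "r \<le> k" for u :: "nat \<Rightarrow> real" and r
    proof -
      have "(\<Sum>i<k. u i * of_bool (i < r)) = (\<Sum>i\<in>{..<r}. u i * of_bool (i < r))"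
        using that by (intro sum.mono_neutral_right) auto
      then show ?thesis by simp
    qed
    have 1: "(\<Sum>i<k. w i * of_bool (x i \<le> c)) = F p"
      using trunc[OF p(1), of w] p by (simp add: F_def)
    have 2: "(\<Sum>i<k. v i * of_bool (y i \<le> c)) = G q"
      using trunc[OF q(1), of v] q by (simp add: G_def)
    \<comment> \<open>This uses \<open>|1_A - 1_B| = 1_A + 1_B - 2 1_A 1_B\<close>. The joint mass
      of two initial segments is \<open>D p q\<close>, and
      \<open>F + G - 2 min (F, G) = |F - G|\<close>.\<close>
    have "(\<Sum>i<k. \<Sum>j<k. \<pi> i j * \<bar>of_bool (x i \<le> c) - of_bool (y j \<le> c)\<bar>)
      = (\<Sum>i<k. \<Sum>j<k. \<pi> i j * of_bool (i < p) + \<pi> i j * of_bool (j < q)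
            - 2 * (\<pi> i j * of_bool (j < q) * of_bool (i < p)))"
      using p q by (intro sum.cong refl) auto
    also have "\<dots> = (\<Sum>i<k. (\<Sum>j<k. \<pi> i j) * of_bool (i < p)) + (\<Sum>i<k. \<Sum>j<k. \<pi> i j * of_bool (j < q))
            - 2 * (\<Sum>i<k. (\<Sum>j<k. \<pi> i j * of_bool (j < q)) * of_bool (i < p))"
      by (simp add: sum.distrib sum_subtractf sum_distrib_left sum_distrib_right mult.assoc
          del: sum_mult_of_bool_eq sum_of_bool_mult_eq)
    also have "\<dots> = F p + G q - 2 * D p q"
      using trunc[OF p(1)] trunc[OF q(1)] block[OF p(1), of k] block[OF _ q(1), of k] block[OF p(1) q(1)] D0 p q
      by simp
    also have "\<dots> = \<bar>F p - G q\<bar>" by (auto simp: D_def min_def)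
    finally show ?thesis using 1 2 by simp
  qed
  show ?thesis
    using pos row col cost unfolding transport_plan_def by (intro exI[of _ \<pi>]) auto
qed

lemma sorting_permutation:
  fixes x :: "nat \<Rightarrow> real"
  obtains \<sigma> where "bij_betw \<sigma> {..<k} {..<k}" "mono_on {..<k} (x \<circ> \<sigma>)"
proof
  let ?l = "sort_key x [0..<k]"
  have len: "length ?l = k" by simp
  have "bij_betw ((!) ?l) {..<length ?l} (set ?l)" by (rule bij_betw_nth) auto
  then show "bij_betw ((!) ?l) {..<k} {..<k}" by (simp add: atLeast0LessThan)
  have "sorted (map x ?l)" by simp
  then show "mono_on {..<k} (x \<circ> (!) ?l)"
    by (intro mono_onI) (metis comp_apply len length_map lessThan_iff nth_map sorted_nth_mono)
qed

text \<open>Sorting both supports reduces this to the monotone case, and the entries are carried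
  back along the inverse permutations. The plan is chosen before the threshold \<open>c\<close>, so
  the identity may be summed over thresholds.\<close>

lemma comonotone_plan:
  fixes x y w v :: "nat \<Rightarrow> real"
  assumes w: "\<And>i. i < k \<Longrightarrow> 0 \<le> w i" and v: "\<And>i. i < k \<Longrightarrow> 0 \<le> v i"
    and eq: "(\<Sum>i<k. w i) = (\<Sum>i<k. v i)"
  shows "\<exists>\<pi>. transport_plan k w v \<pi> \<and>
    (\<forall>c. (\<Sum>i<k. \<Sum>j<k. \<pi> i j * \<bar>of_bool (x i \<le> c) - of_bool (y j \<le> c)\<bar>)
       = \<bar>(\<Sum>i<k. w i * of_bool (x i \<le> c)) - (\<Sum>i<k. v i * of_bool (y i \<le> c))\<bar>)"
proof -
  obtain \<sigma> where \<sigma>: "bij_betw \<sigma> {..<k} {..<k}" "mono_on {..<k} (x \<circ> \<sigma>)"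
    using sorting_permutation by blast
  obtain \<tau> where \<tau>: "bij_betw \<tau> {..<k} {..<k}" "mono_on {..<k} (y \<circ> \<tau>)"
    using sorting_permutation by blast
  have re: "(\<Sum>i<k. f (\<sigma> i)) = (\<Sum>i<k. f i)" "(\<Sum>i<k. f (\<tau> i)) = (\<Sum>i<k. f i)" for f :: "nat \<Rightarrow> real"
    using sum.reindex_bij_betw[OF \<sigma>(1)] sum.reindex_bij_betw[OF \<tau>(1)] by auto
  have ran: "\<sigma> i < k" "\<tau> i < k" if "i < k" for i
    using \<sigma>(1) \<tau>(1) that by (auto simp: bij_betw_def)
  obtain \<rho> where \<rho>: "transport_plan k (w \<circ> \<sigma>) (v \<circ> \<tau>) \<rho>"
    "\<And>c. (\<Sum>i<k. \<Sum>j<k. \<rho> i j * \<bar>of_bool ((x \<circ> \<sigma>) i \<le> c) - of_bool ((y \<circ> \<tau>) j \<le> c)\<bar>)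
       = \<bar>(\<Sum>i<k. (w \<circ> \<sigma>) i * of_bool ((x \<circ> \<sigma>) i \<le> c)) - (\<Sum>i<k. (v \<circ> \<tau>) i * of_bool ((y \<circ> \<tau>) i \<le> c))\<bar>"
    using comonotone_plan_mono[OF _ _ _ \<sigma>(2) \<tau>(2), of "w \<circ> \<sigma>" "v \<circ> \<tau>"] w v ran eq re by auto
  define s where "s = inv_into {..<k} \<sigma>"
  define t where "t = inv_into {..<k} \<tau>"
  have s: "s (\<sigma> i) = i" "\<sigma> (s i) = i" "s i < k" if "i < k" for i
    using \<sigma>(1) that by (auto simp: s_def bij_betw_def f_inv_into_f inv_into_into)
      (metis inv_into_into lessThan_iff)
  have t: "t (\<tau> i) = i" "\<tau> (t i) = i" "t i < k" if "i < k" for i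
    using \<tau>(1) that by (auto simp: t_def bij_betw_def f_inv_into_f inv_into_into)
      (metis inv_into_into lessThan_iff)
  define \<pi> where "\<pi> i j = \<rho> (s i) (t j)" for i j
  have sums: "(\<Sum>i<k. \<Sum>j<k. \<pi> i j * f i j) = (\<Sum>i<k. \<Sum>j<k. \<rho> i j * f (\<sigma> i) (\<tau> j))" for f
  proof -
    have "(\<Sum>i<k. \<Sum>j<k. \<pi> i j * f i j) = (\<Sum>i<k. \<Sum>j<k. \<pi> (\<sigma> i) (\<tau> j) * f (\<sigma> i) (\<tau> j))"
      by (subst re(1)[symmetric], subst re(2)[symmetric]) simp
    then show ?thesis by (simp add: \<pi>_def s t)
  qed
  have "transport_plan k w v \<pi>"
  proof -
    have "(\<Sum>j<k. \<pi> i j) = w i" if "i < k" for i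
    proof -
      have "(\<Sum>j<k. \<pi> i j) = (\<Sum>j<k. \<pi> i (\<tau> j))" by (rule re(2)[symmetric])
      also have "\<dots> = (\<Sum>j<k. \<rho> (s i) j)" by (simp add: \<pi>_def t)
      finally show ?thesis using \<rho>(1) s that by (simp add: transport_plan_def)
    qed
    moreover have "(\<Sum>i<k. \<pi> i j) = v j" if "j < k" for j
    proof -
      have "(\<Sum>i<k. \<pi> i j) = (\<Sum>i<k. \<pi> (\<sigma> i) j)" by (rule re(1)[symmetric])
      also have "\<dots> = (\<Sum>i<k. \<rho> i (t j))" by (simp add: \<pi>_def s)
      finally show ?thesis using \<rho>(1) t that by (simp add: transport_plan_def)
    qed
    ultimately show ?thesis
      using \<rho>(1) s t by (auto simp: transport_plan_def \<pi>_def)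
  qed
  moreover have "(\<Sum>i<k. \<Sum>j<k. \<pi> i j * \<bar>of_bool (x i \<le> c) - of_bool (y j \<le> c)\<bar>)
       = \<bar>(\<Sum>i<k. w i * of_bool (x i \<le> c)) - (\<Sum>i<k. v i * of_bool (y i \<le> c))\<bar>" for c
    using \<rho>(2)[of c] re(1)[of "\<lambda>i. w i * of_bool (x i \<le> c)"] re(2)[of "\<lambda>i. v i * of_bool (y i \<le> c)"]
    by (simp add: sums)
  ultimately show ?thesis by blast
qed

text \<open>A discrete form of \<open>|x - y|\<close> as the integral over \<open>c\<close> of
  \<open>|1(x \<le> c) - 1(y \<le> c)|\<close>, whose integrand is constant between consecutive
  entries of the list. It turns transport cost into differences of cumulative weights.\<close>

lemma abs_diff_eq_sum_gaps:
  fixes ts :: "real list"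
  assumes "sorted ts" "x \<in> set ts" "y \<in> set ts"
  shows "\<bar>x - y\<bar> = (\<Sum>r<length ts - 1. (ts ! Suc r - ts ! r) * \<bar>of_bool (x \<le> ts ! r) - of_bool (y \<le> ts ! r)\<bar>)"
proof -
  have *: "y - x = (\<Sum>r<length ts - 1. (ts ! Suc r - ts ! r) * \<bar>of_bool (x \<le> ts ! r) - of_bool (y \<le> ts ! r)\<bar>)"
    if xy: "x \<le> y" "x \<in> set ts" "y \<in> set ts" for x y
  proof -
    obtain p where p: "p < length ts" "ts ! p = x" using xy by (auto simp: in_set_conv_nth)
    obtain q where q: "q < length ts" "ts ! q = y" using xy by (auto simp: in_set_conv_nth)
    show ?thesis
    proof (cases "x = y")
      case False
      then have "p < q" using xy p q sorted_nth_mono[OF assms(1), of q p] by (cases "p < q") auto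
      have "(ts ! Suc r - ts ! r) * \<bar>of_bool (x \<le> ts ! r) - of_bool (y \<le> ts ! r)\<bar>
         = (ts ! Suc r - ts ! r) * of_bool (p \<le> r \<and> r < q)" if "r < length ts - 1" for r
      proof -
        consider "r < p" | "p \<le> r" "r < q" | "q \<le> r" by linarith
        then show ?thesis
        proof cases
          case 1
          then have a: "ts ! r \<le> ts ! Suc r" "ts ! Suc r \<le> ts ! p"
            using that sorted_nth_mono[OF assms(1)] p by auto
          show ?thesis using 1 a p xy False by auto
        next
          case 2
          then have a: "ts ! p \<le> ts ! r" "ts ! r \<le> ts ! Suc r" "ts ! Suc r \<le> ts ! q"
            using that sorted_nth_mono[OF assms(1)] q by auto
          show ?thesis using 2 a p q by auto
        next
          case 3
          then have "ts ! q \<le> ts ! r"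
            using that sorted_nth_mono[OF assms(1)] by auto
          then show ?thesis using 3 q xy by auto
        qed
      qed
      then have "(\<Sum>r<length ts - 1. (ts ! Suc r - ts ! r) * \<bar>of_bool (x \<le> ts ! r) - of_bool (y \<le> ts ! r)\<bar>)
        = (\<Sum>r<length ts - 1. (ts ! Suc r - ts ! r) * of_bool (p \<le> r \<and> r < q))"
        by (intro sum.cong refl) auto
      also have "\<dots> = (\<Sum>r\<in>{p..<q}. ts ! Suc r - ts ! r)"
        using q by (intro sum.mono_neutral_cong_right) (auto simp del: sum_mult_of_bool_eq)
      also have "\<dots> = ts ! q - ts ! p"
        using \<open>p < q\<close> by (simp add: sum_Suc_diff')
      finally show ?thesis using p q by simp
    qed simp
  qed
  show ?thesis
  proof (cases "x \<le> y")
    case True then show ?thesis using *[of x y] assms by simp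
  next
    case False then show ?thesis using *[of y x] assms by (simp add: abs_minus_commute)
  qed
qed

text \<open>The comonotone cost is the sum over gaps \<open>g\<close> of \<open>g * d\<close>, with
  \<open>d\<close> the difference of cumulative weights across the gap. The interpolation bound
  degrades for small \<open>g\<close>, but such gaps contribute little: \<open>d * g ^ n\<close> is
  bounded, and \<open>d \<le> 1\<close> gives \<open>(g * d) ^ n \<le> d * g ^ n\<close>, whose root
  is taken. The atoms may be arbitrarily close together.\<close>

lemma moments_transport_real:
  fixes x y w v :: "nat \<Rightarrow> real"
  assumes w: "\<And>i. i < k \<Longrightarrow> 0 \<le> w i" "(\<Sum>i<k. w i) = 1"
    and v: "\<And>i. i < k \<Longrightarrow> 0 \<le> v i" "(\<Sum>i<k. v i) = 1"
    and mom: "\<And>l. l \<le> 2 * k - 1 \<Longrightarrow> \<bar>(\<Sum>i<k. w i * x i ^ l) - (\<Sum>i<k. v i * y i ^ l)\<bar> \<le> h"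
    and M: "\<And>i. i < k \<Longrightarrow> \<bar>x i\<bar> \<le> M" "\<And>i. i < k \<Longrightarrow> \<bar>y i\<bar> \<le> M"
  shows "\<exists>\<pi>. transport_plan k w v \<pi> \<and>
    (\<Sum>i<k. \<Sum>j<k. \<pi> i j * \<bar>x i - y j\<bar>) \<le> 4 * real k * (1 + M) * h powr (1 / (2 * real k - 1))"
proof -
  have k: "0 < k" using w(2) by (cases k) auto
  have M0: "0 \<le> M" using M(1)[OF k] by simp
  have h: "0 \<le> h" using mom[of 0] by (smt (verit) le0)
  obtain \<pi> where \<pi>: "transport_plan k w v \<pi>"
    "\<And>c. (\<Sum>i<k. \<Sum>j<k. \<pi> i j * \<bar>of_bool (x i \<le> c) - of_bool (y j \<le> c)\<bar>)
       = \<bar>(\<Sum>i<k. w i * of_bool (x i \<le> c)) - (\<Sum>i<k. v i * of_bool (y i \<le> c))\<bar>"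
    using comonotone_plan[of k w v x y] w v by auto
  define T where "T = x ` {..<k} \<union> y ` {..<k}"
  \<comment> \<open>Two sets of \<open>k\<close> atoms form at most \<open>2 * k = Suc n\<close>
    nodes.\<close>
  define n where "n = 2 * k - 1"
  have fin: "finite T" by (simp add: T_def)
  have "card T \<le> card (x ` {..<k}) + card (y ` {..<k})" unfolding T_def by (rule card_Un_le)
  also have "\<dots> \<le> k + k" by (intro add_mono) (metis card_image_le card_lessThan finite_lessThan)+
  finally have cT: "card T \<le> Suc n" using k by (simp add: n_def)
  have TM: "\<bar>a\<bar> \<le> M" if "a \<in> T" for a using that M by (auto simp: T_def)
  define ts where "ts = sorted_list_of_set T"
  have ts: "sorted ts" "set ts = T" "length ts = card T" "distinct ts"
    using fin by (auto simp: ts_def)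
  define d where "d r = \<bar>(\<Sum>i<k. w i * of_bool (x i \<le> ts ! r)) - (\<Sum>i<k. v i * of_bool (y i \<le> ts ! r))\<bar>" for r
  have gapb: "(ts ! Suc r - ts ! r) * d r \<le> 2 * (1 + M) * h powr (1 / real n)" if r: "r < length ts - 1" for r
  proof -
    define g where "g = ts ! Suc r - ts ! r"
    have "ts ! r \<le> ts ! Suc r" using sorted_nth_mono[OF ts(1), of r "Suc r"] r by auto
    moreover have "ts ! r \<noteq> ts ! Suc r" using ts(4) r by (auto simp: nth_eq_iff_index_eq)
    ultimately have g: "0 < g" by (simp add: g_def)
    have "ts ! r \<in> T" "ts ! Suc r \<in> T" using ts(2) r by (auto simp flip: ts(2))
    then have "\<bar>ts ! r\<bar> \<le> M" "\<bar>ts ! Suc r\<bar> \<le> M" using TM by auto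
    then have g2: "g \<le> 2 * (1 + M)" by (simp add: g_def)
    have gap: "g \<le> b - a" if ab: "a \<in> T" "b \<in> T" "a \<le> ts ! r" "ts ! r < b" for a b
    proof -
      obtain q where q: "q < length ts" "ts ! q = b" using ab ts(2) by (auto simp: in_set_conv_nth)
      have "r < q" using sorted_nth_mono[OF ts(1), of q r] q ab(4) r by (cases "r < q") force+
      then have "ts ! Suc r \<le> b" using sorted_nth_mono[OF ts(1), of "Suc r" q] q by auto
      then show ?thesis using ab by (simp add: g_def)
    qed
    have "d r \<le> h * (2 * (1 + M) / g) ^ n"
      unfolding d_def using mom gap TM cT g g2
      by (intro cdf_gap_bound[where T=T]) (auto simp: n_def T_def)
    then have "d r * g ^ n \<le> h * (2 * (1 + M)) ^ n"
      using g by (simp add: power_divide field_simps)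
    moreover have d01: "0 \<le> d r" "d r \<le> 1"
    proof -
      have "0 \<le> (\<Sum>i<k. u i * of_bool (z i \<le> ts ! r)) \<and> (\<Sum>i<k. u i * of_bool (z i \<le> ts ! r)) \<le> 1"
        if "\<And>i. i < k \<Longrightarrow> 0 \<le> u i" "(\<Sum>i<k. u i) = 1" for u z :: "nat \<Rightarrow> real"
        using that(1) sum_mono[of "{..<k}" "\<lambda>i. u i * of_bool (z i \<le> ts ! r)" u]
        by (auto simp: that(2) intro!: sum_nonneg)
      from this[of w x] this[of v y] w v show "0 \<le> d r" "d r \<le> 1" by (auto simp: d_def)
    qed
    moreover have "d r ^ n \<le> d r" using d01 k by (cases n) (auto simp: n_def mult_left_le power_le_one)
    ultimately have "d r ^ n * g ^ n \<le> h * (2 * (1 + M)) ^ n"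
      using g by (meson mult_right_mono order_trans less_imp_le zero_le_power)
    then have "(g * d r) ^ n \<le> h * (2 * (1 + M)) ^ n"
      unfolding power_mult_distrib[of g "d r" n] by (simp only: mult.commute)
    then have "((g * d r) ^ n) powr (1 / real n) \<le> (h * (2 * (1 + M)) ^ n) powr (1 / real n)"
      using g d01 by (intro powr_mono2) auto
    also have "\<dots> = h powr (1 / real n) * ((2 * (1 + M)) ^ n) powr (1 / real n)"
      using h M0 by (simp add: powr_mult)
    also have "((2 * (1 + M)) ^ n) powr (1 / real n) = 2 * (1 + M)"
      using M0 k by (subst powr_realpow[symmetric]) (auto simp: powr_powr n_def)
    also have "((g * d r) ^ n) powr (1 / real n) = g * d r"
    proof (cases "g * d r = 0")
      case True
      have "0 < n" using k by (simp add: n_def)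
      then show ?thesis unfolding True by (simp add: zero_power)
    next
      case False
      then have "0 < g * d r" using g d01 by (auto simp: zero_less_mult_iff)
      then show ?thesis using k by (subst powr_realpow[symmetric]) (auto simp: powr_powr n_def)
    qed
    finally show ?thesis by (simp add: g_def mult.commute)
  qed
  have "(\<Sum>i<k. \<Sum>j<k. \<pi> i j * \<bar>x i - y j\<bar>)
    = (\<Sum>i<k. \<Sum>j<k. \<Sum>r<length ts - 1. (ts ! Suc r - ts ! r) * (\<pi> i j * \<bar>of_bool (x i \<le> ts ! r) - of_bool (y j \<le> ts ! r)\<bar>))"
  proof (intro sum.cong refl)
    fix i j assume "i \<in> {..<k}" "j \<in> {..<k}"
    then have "x i \<in> set ts" "y j \<in> set ts" by (auto simp: ts T_def)
    from abs_diff_eq_sum_gaps[OF ts(1) this]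
    show "\<pi> i j * \<bar>x i - y j\<bar> = (\<Sum>r<length ts - 1. (ts ! Suc r - ts ! r) * (\<pi> i j * \<bar>of_bool (x i \<le> ts ! r) - of_bool (y j \<le> ts ! r)\<bar>))"
      by (simp add: sum_distrib_left algebra_simps)
  qed
  also have "\<dots> = (\<Sum>i<k. \<Sum>r<length ts - 1. \<Sum>j<k. (ts ! Suc r - ts ! r) * (\<pi> i j * \<bar>of_bool (x i \<le> ts ! r) - of_bool (y j \<le> ts ! r)\<bar>))"
    by (intro sum.cong refl sum.swap)
  also have "\<dots> = (\<Sum>r<length ts - 1. \<Sum>i<k. \<Sum>j<k. (ts ! Suc r - ts ! r) * (\<pi> i j * \<bar>of_bool (x i \<le> ts ! r) - of_bool (y j \<le> ts ! r)\<bar>))"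
    by (rule sum.swap)
  also have "\<dots> = (\<Sum>r<length ts - 1. (ts ! Suc r - ts ! r) * d r)"
    unfolding d_def \<pi>(2)[symmetric] sum_distrib_left ..
  also have "\<dots> \<le> (\<Sum>r<length ts - 1. 2 * (1 + M) * h powr (1 / real n))"
    by (intro sum_mono) (use gapb in auto)
  also have "\<dots> = real (length ts - 1) * (2 * (1 + M) * h powr (1 / real n))" by simp
  \<comment> \<open>At most \<open>2 * k\<close> gaps, each costing \<open>2 * (1 + M)\<close> times
    the root of \<open>h\<close>; hence the constant \<open>4 * k * (1 + M)\<close>.\<close>
  also have "\<dots> \<le> real (2 * k) * (2 * (1 + M) * h powr (1 / real n))"
    using cT M0 k by (intro mult_right_mono) (auto simp: ts n_def)
  also have "real n = 2 * real k - 1" using k by (simp add: n_def)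
  finally show ?thesis using \<pi>(1) by (auto simp: algebra_simps)
qed

section \<open>From generating functions to transport plans\<close>

lemma enorm_eq_L2_set: "enorm d x = L2_set x {..<d}"
  by (simp add: enorm_def L2_set_def)

lemma enorm_nonneg: "0 \<le> enorm d x"
  by (simp add: enorm_eq_L2_set L2_set_nonneg)

lemma enorm_power2: "(enorm d x)\<^sup>2 = (\<Sum>i<d. (x i)\<^sup>2)"
  by (simp add: enorm_def sum_nonneg)

lemma enorm_scale: "enorm d (\<lambda>i. c * x i) = \<bar>c\<bar> * enorm d x"
  by (simp add: enorm_def power_mult_distrib sum_distrib_left[symmetric] real_sqrt_mult)

lemma abs_dot_le_enorm: "\<bar>\<Sum>i<d. s i * x i\<bar> \<le> enorm d s * enorm d x"
proof -
  have "\<bar>\<Sum>i<d. s i * x i\<bar> \<le> (\<Sum>i<d. \<bar>s i\<bar> * \<bar>x i\<bar>)"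
    by (rule order_trans[OF sum_abs]) (simp add: abs_mult)
  also have "\<dots> \<le> enorm d s * enorm d x"
    unfolding enorm_eq_L2_set by (rule L2_set_mult_ineq)
  finally show ?thesis .
qed

lemma edist_triangle: "edist d x z \<le> edist d x y + edist d y z"
  using L2_set_triangle_ineq[of "\<lambda>i. x i - y i" "\<lambda>i. y i - z i" "{..<d}"]
  by (simp add: edist_def enorm_eq_L2_set)

text \<open>Counting: for fixed \<open>v\<close> with largest coordinate \<open>r\<^sub>0\<close>, two integer directions that agree off
  \<open>r\<^sub>0\<close> and are both nearly orthogonal to \<open>v\<close> must coincide, so each \<open>v\<close> excludes at most
  \<open>(N + 1) ^ (m - 1)\<close> of the \<open>(N + 1) ^ m\<close> directions.\<close>

lemma integer_direction:
  fixes v :: "'i \<Rightarrow> nat \<Rightarrow> real"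
  assumes "finite I"
  shows "\<exists>\<theta> :: nat \<Rightarrow> nat. (\<forall>r<m. \<theta> r \<le> card I) \<and>
    (\<forall>i\<in>I. \<forall>r<m. \<bar>v i r\<bar> \<le> 2 * \<bar>\<Sum>r<m. real (\<theta> r) * v i r\<bar>)"
proof (cases "m = 0")
  case False
  define N where "N = card I"
  define \<Omega> where "\<Omega> = (PiE {..<m} (\<lambda>_. {..N}) :: (nat \<Rightarrow> nat) set)"
  have fin\<Omega>: "finite \<Omega>" by (auto simp: \<Omega>_def intro: finite_PiE)
  have card\<Omega>: "card \<Omega> = (N + 1) ^ m" by (simp add: \<Omega>_def card_PiE)
  have "\<exists>r0<m. \<forall>r<m. \<bar>v i r\<bar> \<le> \<bar>v i r0\<bar>" for i
  proof -
    have "Max ((\<lambda>r. \<bar>v i r\<bar>) ` {..<m}) \<in> (\<lambda>r. \<bar>v i r\<bar>) ` {..<m}"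
      using False by (intro Max_in) auto
    then obtain r0 where "r0 < m" "\<bar>v i r0\<bar> = Max ((\<lambda>r. \<bar>v i r\<bar>) ` {..<m})" by auto
    then show ?thesis by (intro exI[of _ r0]) auto
  qed
  then obtain r0 where r0: "\<And>i. r0 i < m" "\<And>i r. r < m \<Longrightarrow> \<bar>v i r\<bar> \<le> \<bar>v i (r0 i)\<bar>"
    by metis
  define bad where "bad i = {\<theta>\<in>\<Omega>. 2 * \<bar>\<Sum>r<m. real (\<theta> r) * v i r\<bar> < \<bar>v i (r0 i)\<bar>}" for i
  have "card (bad i) \<le> (N + 1) ^ (m - 1)" for i
  proof -
    let ?J = "{..<m} - {r0 i}"
    have split: "(\<Sum>r<m. real (\<theta> r) * v i r) = real (\<theta> (r0 i)) * v i (r0 i) + (\<Sum>r\<in>?J. real (\<theta> r) * v i r)"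
      for \<theta> :: "nat \<Rightarrow> nat"
      using r0(1)[of i] by (subst sum.remove[of _ "r0 i"]) auto
    have "inj_on (\<lambda>\<theta>. restrict \<theta> ?J) (bad i)"
    proof (rule inj_onI)
      fix \<theta> \<phi> assume in_bad: "\<theta> \<in> bad i" "\<phi> \<in> bad i" and eq: "restrict \<theta> ?J = restrict \<phi> ?J"
      have eqJ: "\<theta> r = \<phi> r" if "r \<in> ?J" for r using fun_cong[OF eq, of r] that by simp
      have same: "(\<Sum>r\<in>?J. real (\<theta> r) * v i r) = (\<Sum>r\<in>?J. real (\<phi> r) * v i r)"
        using eqJ by (intro sum.cong) auto
      \<comment> \<open>The threshold one half makes two bad directions differ in their
        \<open>r0 i\<close> term by less than \<open>|V|\<close>; their integer coefficients there
        differ by less than 1 and are equal.\<close>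
      have half: "\<bar>A - B\<bar> < \<bar>V\<bar>" if "2 * \<bar>A + S\<bar> < \<bar>V\<bar>" "2 * \<bar>B + S\<bar> < \<bar>V\<bar>" for A B S V :: real
        using that abs_triangle_ineq4[of "A + S" "B + S"] by simp
      have diff: "\<bar>(real (\<theta> (r0 i)) - real (\<phi> (r0 i))) * v i (r0 i)\<bar> < \<bar>v i (r0 i)\<bar>"
        unfolding left_diff_distrib using in_bad same
        by (intro half[of _ "\<Sum>r\<in>?J. real (\<phi> r) * v i r"]) (auto simp: bad_def split)
      have small: "\<bar>c\<bar> < 1" if "\<bar>c * V\<bar> < \<bar>V\<bar>" for c V :: real
      proof (rule ccontr)
        assume "\<not> \<bar>c\<bar> < 1"
        then have "1 * \<bar>V\<bar> \<le> \<bar>c\<bar> * \<bar>V\<bar>" by (intro mult_right_mono) auto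
        with that show False by (simp add: abs_mult)
      qed
      have "\<theta> (r0 i) = \<phi> (r0 i)" using small[OF diff] by linarith
      then have "\<theta> r = \<phi> r" if "r < m" for r using eqJ[of r] that by (cases "r = r0 i") auto
      then show "\<theta> = \<phi>"
        using in_bad by (intro PiE_ext[of \<theta> "{..<m}" "\<lambda>_. {..N}"]) (auto simp: bad_def \<Omega>_def)
    qed
    moreover have "(\<lambda>\<theta>. restrict \<theta> ?J) ` bad i \<subseteq> PiE ?J (\<lambda>_. {..N})"
    proof (intro image_subsetI)
      fix \<theta> assume "\<theta> \<in> bad i"
      then have "\<theta> \<in> PiE {..<m} (\<lambda>_. {..N})" by (simp add: bad_def \<Omega>_def)
      then show "restrict \<theta> ?J \<in> PiE ?J (\<lambda>_. {..N})" by (simp add: PiE_iff)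
    qed
    ultimately have "card (bad i) \<le> card (PiE ?J (\<lambda>_. {..N}))"
      by (rule card_inj_on_le) (simp add: finite_PiE)
    also have "\<dots> = (N + 1) ^ (m - 1)"
      using r0(1)[of i] by (simp add: card_PiE)
    finally show ?thesis .
  qed
  then have "(\<Sum>i\<in>I. card (bad i)) \<le> N * (N + 1) ^ (m - 1)"
    using sum_bounded_above[of I "\<lambda>i. card (bad i)" "(N + 1) ^ (m - 1)"] by (simp add: N_def)
  then have "card (\<Union>i\<in>I. bad i) \<le> N * (N + 1) ^ (m - 1)"
    using card_UN_le[OF assms, of bad] by linarith
  also have "\<dots> < (N + 1) * (N + 1) ^ (m - 1)" by simp
  also have "\<dots> = card \<Omega>" using False by (cases m) (auto simp: card\<Omega>)
  finally have lt: "card (\<Union>i\<in>I. bad i) < card \<Omega>" .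
  have "\<not> \<Omega> \<subseteq> (\<Union>i\<in>I. bad i)"
  proof
    assume "\<Omega> \<subseteq> (\<Union>i\<in>I. bad i)"
    moreover have "finite (\<Union>i\<in>I. bad i)"
      using assms fin\<Omega> by (auto simp: bad_def)
    ultimately show False using card_mono lt by (metis leD)
  qed
  then obtain \<theta> where \<theta>: "\<theta> \<in> \<Omega>" "\<And>i. i \<in> I \<Longrightarrow> \<theta> \<notin> bad i" by blast
  have "\<bar>v i r\<bar> \<le> 2 * \<bar>\<Sum>r<m. real (\<theta> r) * v i r\<bar>" if "i \<in> I" "r < m" for i r
    using \<theta>(1) \<theta>(2)[OF that(1)] r0(2)[OF that(2), of i] by (auto simp: bad_def)
  moreover have "\<theta> r \<le> card I" if "r < m" for r
    using \<theta>(1) that by (auto simp: \<Omega>_def N_def)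
  ultimately show ?thesis by blast
qed simp

definition mgf :: "nat \<Rightarrow> nat \<Rightarrow> (nat \<Rightarrow> real) \<Rightarrow> (nat \<Rightarrow> nat \<Rightarrow> real) \<Rightarrow> (nat \<Rightarrow> real) \<Rightarrow> real" where
  "mgf d k w a s = (\<Sum>j<k. w j * exp (\<Sum>i<d. s i * a j i))"

text \<open>The logarithm is Lipschitz with constant \<open>exp R\<close> on
  \<open>[exp (-R), exp R]\<close>; this undoes the exponentiation of the projected atoms.\<close>

lemma abs_diff_le_exp_diff:
  fixes x y :: real
  assumes "\<bar>x\<bar> \<le> R" "\<bar>y\<bar> \<le> R"
  shows "\<bar>x - y\<bar> \<le> exp R * \<bar>exp x - exp y\<bar>"
proof -
  have *: "x - y \<le> exp R * (exp x - exp y)" if "y \<le> x" "\<bar>y\<bar> \<le> R" for x y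
  proof -
    have "x - y \<le> exp (x - y) - 1" using exp_ge_add_one_self[of "x - y"] by linarith
    also have "\<dots> \<le> exp (R + y) * (exp (x - y) - 1)"
      using that mult_right_mono[of 1 "exp (R + y)" "exp (x - y) - 1"] by auto
    also have "\<dots> = exp R * (exp x - exp y)"
      by (simp add: exp_add[symmetric] algebra_simps)
    finally show ?thesis .
  qed
  have "exp x \<le> exp y \<longleftrightarrow> x \<le> y" by simp
  then show ?thesis
    using *[of x y] *[of y x] assms by (cases "x \<le> y") (auto simp: abs_if)
qed

text \<open>In the variable \<open>z = exp (s \<theta> \<bullet> x)\<close> the \<open>l\<close>-th moment is the moment generating function
  at \<open>l s \<theta>\<close>, so one-dimensional moment comparison applies without any Gaussian moments.\<close>

lemma mgf_transport:
  fixes R h :: real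
  assumes R: "R > 0" and m: "m \<le> k"
    and va: "valid_params m k R w a" and vb: "valid_params m k R v b"
    and h: "\<And>s. enorm m s \<le> 1 \<Longrightarrow> \<bar>mgf m k w a s - mgf m k v b s\<bar> \<le> h"
  shows "\<exists>\<pi>. transport_plan k w v \<pi> \<and>
    (\<Sum>i<k. \<Sum>j<k. \<pi> i j * edist m (a i) (b j))
      \<le> 16 * exp R * (1 + exp R) * real k ^ 5 * h powr (1 / (2 * real k - 1))"
proof -
  have k: "0 < k" using va by (cases k) (auto simp: valid_params_def)
  have "\<exists>\<theta> :: nat \<Rightarrow> nat. (\<forall>r<m. \<theta> r \<le> k ^ 2) \<and> (\<forall>i<k. \<forall>j<k. \<forall>r<m.
      \<bar>a i r - b j r\<bar> \<le> 2 * \<bar>\<Sum>r<m. real (\<theta> r) * (a i r - b j r)\<bar>)"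
    using integer_direction[of "{..<k} \<times> {..<k}" m "\<lambda>(i, j) r. a i r - b j r"]
    by (simp add: power2_eq_square Ball_def) blast
  then obtain \<theta> :: "nat \<Rightarrow> nat" where \<theta>: "\<And>r. r < m \<Longrightarrow> \<theta> r \<le> k ^ 2"
    "\<And>i j r. i < k \<Longrightarrow> j < k \<Longrightarrow> r < m \<Longrightarrow> \<bar>a i r - b j r\<bar> \<le> 2 * \<bar>\<Sum>r<m. real (\<theta> r) * (a i r - b j r)\<bar>"
    by blast
  \<comment> \<open>The coordinates of \<open>\<theta>\<close> are at most \<open>k ^ 2\<close> and
    \<open>m \<le> k\<close>, so its norm is at most \<open>k ^ 2 * sqrt k\<close>. The scaling
    gives \<open>\<phi>\<close> norm at most \<open>1 / (2 * k)\<close>, so that all multiples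
    \<open>l * \<phi>\<close> with \<open>l \<le> 2 * k - 1\<close> stay in the unit ball, where the
    bound \<open>h\<close> is available.\<close>
  define s where "s = 1 / (2 * real k ^ 3 * sqrt (real k))"
  have s: "0 < s" using k by (simp add: s_def)
  define \<phi> where "\<phi> r = s * real (\<theta> r)" for r
  have "(enorm m (\<lambda>r. real (\<theta> r)))\<^sup>2 \<le> (\<Sum>r<m. (real k ^ 2)\<^sup>2)"
    unfolding enorm_power2 using \<theta>(1) by (intro sum_mono power_mono) (auto simp flip: of_nat_power)
  also have "\<dots> \<le> real k * (real k ^ 2)\<^sup>2" using m by (simp add: mult_right_mono)
  also have "\<dots> = (sqrt (real k) * real k ^ 2)\<^sup>2" by (simp add: power_mult_distrib)
  finally have "enorm m (\<lambda>r. real (\<theta> r)) \<le> sqrt (real k) * real k ^ 2"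
    by (rule power2_le_imp_le) simp
  then have "enorm m \<phi> \<le> s * (sqrt (real k) * real k ^ 2)"
    using s unfolding \<phi>_def enorm_scale by (simp add: mult_left_mono del: mult_le_cancel_left_pos)
  also have "\<dots> = 1 / (2 * real k)" using k by (simp add: s_def power2_eq_square power3_eq_cube)
  finally have \<phi>: "enorm m \<phi> \<le> 1 / (2 * real k)" .
  have "1 / (2 * real k) \<le> 1" using k by simp
  then have \<phi>1: "enorm m \<phi> \<le> 1" using \<phi> by linarith
  have proj: "\<bar>\<Sum>r<m. \<phi> r * c r\<bar> \<le> R" if "enorm m c \<le> R" for c
  proof -
    have "\<bar>\<Sum>r<m. \<phi> r * c r\<bar> \<le> enorm m \<phi> * enorm m c" by (rule abs_dot_le_enorm)
    also have "\<dots> \<le> 1 * R"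
      using that \<phi>1 R by (intro mult_mono) (auto simp: enorm_nonneg)
    finally show ?thesis by simp
  qed
  define x where "x i = (\<Sum>r<m. \<phi> r * a i r)" for i
  define y where "y i = (\<Sum>r<m. \<phi> r * b i r)" for i
  have xy: "\<bar>x i\<bar> \<le> R" "\<bar>y i\<bar> \<le> R" if "i < k" for i
    using that va vb proj by (auto simp: x_def y_def valid_params_def)
  have mom: "\<bar>(\<Sum>i<k. w i * exp (x i) ^ l) - (\<Sum>i<k. v i * exp (y i) ^ l)\<bar> \<le> h" if l: "l \<le> 2 * k - 1" for l
  proof -
    have "enorm m (\<lambda>r. real l * \<phi> r) = real l * enorm m \<phi>" by (simp add: enorm_scale)
    also have "\<dots> \<le> real (2 * k) * (1 / (2 * real k))"
      using \<phi> l by (intro mult_mono) (auto simp: enorm_nonneg)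
    also have "\<dots> = 1" using k by simp
    finally have "\<bar>mgf m k w a (\<lambda>r. real l * \<phi> r) - mgf m k v b (\<lambda>r. real l * \<phi> r)\<bar> \<le> h" by (rule h)
    then show ?thesis
      by (simp add: mgf_def x_def y_def exp_of_nat_mult[symmetric] sum_distrib_left algebra_simps)
  qed
  have "\<exists>\<pi>. transport_plan k w v \<pi> \<and>
    (\<Sum>i<k. \<Sum>j<k. \<pi> i j * \<bar>exp (x i) - exp (y j)\<bar>) \<le> 4 * real k * (1 + exp R) * h powr (1 / (2 * real k - 1))"
    using va vb mom xy
    by (intro moments_transport_real) (auto simp: valid_params_def abs_le_iff)
  then obtain \<pi> where \<pi>: "transport_plan k w v \<pi>"
    "(\<Sum>i<k. \<Sum>j<k. \<pi> i j * \<bar>exp (x i) - exp (y j)\<bar>) \<le> 4 * real k * (1 + exp R) * h powr (1 / (2 * real k - 1))"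
    by blast
  \<comment> \<open>Each coordinate of the difference is at most \<open>2 * q\<close>, and
    \<open>q = |x i - y j| / s\<close>; this costs \<open>2 * sqrt k / s = 4 * k ^ 4\<close>. The
    moment comparison supplies the fifth factor \<open>k\<close>.\<close>
  have dist: "edist m (a i) (b j) \<le> 4 * real k ^ 4 * exp R * \<bar>exp (x i) - exp (y j)\<bar>" if ij: "i < k" "j < k" for i j
  proof -
    define q where "q = \<bar>\<Sum>r<m. real (\<theta> r) * (a i r - b j r)\<bar>"
    have "(edist m (a i) (b j))\<^sup>2 \<le> (\<Sum>r<m. (2 * q)\<^sup>2)"
      unfolding edist_def enorm_power2
    proof (intro sum_mono)
      fix r assume "r \<in> {..<m}"
      then have "\<bar>a i r - b j r\<bar> \<le> \<bar>2 * q\<bar>" using \<theta>(2)[OF ij, of r] by (simp add: q_def)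
      then show "(a i r - b j r)\<^sup>2 \<le> (2 * q)\<^sup>2" by (simp only: abs_le_square_iff)
    qed
    also have "\<dots> \<le> real k * (2 * q)\<^sup>2" using m by (simp add: mult_right_mono)
    also have "\<dots> = (sqrt (real k) * (2 * q))\<^sup>2" by (simp add: power_mult_distrib)
    finally have "edist m (a i) (b j) \<le> sqrt (real k) * (2 * q)"
      by (rule power2_le_imp_le) (simp add: q_def)
    also have "x i - y j = s * (\<Sum>r<m. real (\<theta> r) * (a i r - b j r))"
      by (simp add: x_def y_def \<phi>_def sum_distrib_left right_diff_distrib sum_subtractf mult.assoc)
    then have "q = \<bar>x i - y j\<bar> / s" using s by (simp add: q_def abs_mult)
    then have "sqrt (real k) * (2 * q) = 4 * real k ^ 4 * \<bar>x i - y j\<bar>"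
      by (simp add: s_def power_def eval_nat_numeral)
    also have "\<dots> \<le> 4 * real k ^ 4 * (exp R * \<bar>exp (x i) - exp (y j)\<bar>)"
      using abs_diff_le_exp_diff[OF xy(1)[OF ij(1)] xy(2)[OF ij(2)]] by (intro mult_left_mono) auto
    finally show ?thesis by (simp add: mult.assoc)
  qed
  have "(\<Sum>i<k. \<Sum>j<k. \<pi> i j * edist m (a i) (b j))
     \<le> (\<Sum>i<k. \<Sum>j<k. \<pi> i j * (4 * real k ^ 4 * exp R * \<bar>exp (x i) - exp (y j)\<bar>))"
    using \<pi>(1) dist by (intro sum_mono mult_left_mono) (auto simp: transport_plan_def)
  also have "\<dots> = 4 * real k ^ 4 * exp R * (\<Sum>i<k. \<Sum>j<k. \<pi> i j * \<bar>exp (x i) - exp (y j)\<bar>)"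
    by (simp add: sum_distrib_left algebra_simps)
  also have "\<dots> \<le> 4 * real k ^ 4 * exp R * (4 * real k * (1 + exp R) * h powr (1 / (2 * real k - 1)))"
    using \<pi>(2) by (intro mult_left_mono) auto
  also have "\<dots> = 16 * exp R * (1 + exp R) * real k ^ 5 * h powr (1 / (2 * real k - 1))"
    by (simp add: eval_nat_numeral algebra_simps)
  finally show ?thesis using \<pi>(1) by blast
qed

section \<open>Mixtures and Gaussian densities\<close>

lemma space_Rd: "space (Rd d) = PiE {..<d} (\<lambda>_. UNIV)"
  by (simp add: Rd_def space_PiM)

lemma sets_lebd[measurable_cong, simp]: "sets (lebd d) = sets (Rd d)"
  unfolding lebd_def Rd_def by (rule sets_PiM_cong) auto

lemma space_lebd[simp]: "space (lebd d) = space (Rd d)"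
  by (rule sets_eq_imp_space_eq) simp

lemma sigma_finite_lebd: "sigma_finite_measure (lebd d)"
proof -
  interpret product_sigma_finite "\<lambda>_::nat. lborel :: real measure" by standard
  show ?thesis unfolding lebd_def by (rule sigma_finite) simp
qed

lemma measurable_Rd_component: "i < d \<Longrightarrow> (\<lambda>x. x i) \<in> borel_measurable (Rd d)"
  unfolding Rd_def by (rule measurable_component_singleton) simp

lemma measurable_gmix_density[measurable]: "gmix_density d k w a \<in> borel_measurable (Rd d)"
  unfolding gmix_density_def
  by (intro borel_measurable_sum borel_measurable_times borel_measurable_const borel_measurable_prod
      measurable_compose[OF _ borel_measurable_normal_density] borel_measurable_diff measurable_Rd_component) auto

lemma measurable_edist[measurable]: "(\<lambda>z. edist d (fst z) (snd z)) \<in> borel_measurable (Rd d \<Otimes>\<^sub>M Rd d)"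
  unfolding edist_def enorm_def
  by (intro measurable_compose[OF _ borel_measurable_sqrt] borel_measurable_sum borel_measurable_power
      borel_measurable_diff measurable_compose[OF measurable_fst measurable_Rd_component]
      measurable_compose[OF measurable_snd measurable_Rd_component]) auto

text \<open>\<open>mixG\<close> is built from a raw set function. As the image of a weighted measure
  on the indices it is seen to be countably additive, and coinciding atoms add their
  weights.\<close>

lemma mixG_eq_distr:
  assumes "\<And>j. j < k \<Longrightarrow> a j \<in> space (Rd d)"
  shows "mixG d k w a = distr (point_measure {..<k} (\<lambda>j. ennreal (w j))) (Rd d) a"
    (is "_ = ?D")
proof -
  have "(\<Sum>j<k. ennreal (w j) * indicator A (a j)) = emeasure ?D A" if "A \<in> sets (Rd d)" for A
  proof -
    have "emeasure ?D A = emeasure (point_measure {..<k} (\<lambda>j. ennreal (w j))) (a -` A \<inter> {..<k})"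
      using assms that by (subst emeasure_distr) (auto simp: space_point_measure)
    also have "\<dots> = (\<Sum>j\<in>a -` A \<inter> {..<k}. ennreal (w j))"
      by (subst emeasure_point_measure_finite) auto
    also have "\<dots> = (\<Sum>j<k. ennreal (w j) * indicator A (a j))"
      by (intro sum.mono_neutral_cong_left) (auto simp: indicator_def)
    finally show ?thesis by simp
  qed
  then have "mixG d k w a = measure_of (space ?D) (sets ?D) (emeasure ?D)"
    unfolding mixG_def by (subst measure_of_eq) (auto simp: sets.sigma_sets_eq sets.space_closed)
  also have "\<dots> = ?D" by (rule measure_of_of_measure)
  finally show ?thesis .
qed

lemma sets_mixG[simp]: "sets (mixG d k w a) = sets (Rd d)"
  unfolding mixG_def by (simp add: sets.sigma_sets_eq sets.space_closed)

lemma prob_space_mixG: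
  assumes "valid_params d k R w a"
  shows "prob_space (mixG d k w a)"
proof -
  have "mixG d k w a = distr (point_measure {..<k} (\<lambda>j. ennreal (w j))) (Rd d) a"
    using assms by (intro mixG_eq_distr) (auto simp: valid_params_def)
  moreover have "prob_space (point_measure {..<k} (\<lambda>j. ennreal (w j)))"
    using assms by (intro prob_spaceI) (subst emeasure_point_measure_finite,
        auto simp: space_point_measure valid_params_def intro: sum_ennreal[THEN trans])
  ultimately show ?thesis
    using assms by (auto intro!: prob_space.prob_space_distr simp: valid_params_def)
qed

text \<open>The coupling is the image of the plan, seen as a measure on pairs of indices; indices
  instead of atoms keep repeated atoms harmless.\<close>

lemma W1_le_plan:
  assumes plan: "transport_plan k w v \<pi>"
    and a: "\<And>j. j < k \<Longrightarrow> a j \<in> space (Rd d)" and b: "\<And>j. j < k \<Longrightarrow> b j \<in> space (Rd d)"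
    and tot: "(\<Sum>j<k. w j) = 1"
  shows "W1 d (mixG d k w a) (mixG d k v b) \<le> ennreal (\<Sum>i<k. \<Sum>j<k. \<pi> i j * edist d (a i) (b j))"
proof -
  let ?S = "{..<k} \<times> {..<k}"
  define P where "P = point_measure ?S (\<lambda>(i, j). ennreal (\<pi> i j))"
  define C where "C = distr P (Rd d \<Otimes>\<^sub>M Rd d) (\<lambda>(i, j). (a i, b j))"
  have pos: "0 \<le> \<pi> i j" if "i < k" "j < k" for i j using plan that by (simp add: transport_plan_def)
  have meas: "(\<lambda>(i, j). (a i, b j)) \<in> measurable P (Rd d \<Otimes>\<^sub>M Rd d)"
    using a b by (auto simp: P_def space_pair_measure)
  have emP: "emeasure P X = (\<Sum>(i, j)\<in>X. ennreal (\<pi> i j))" if "X \<subseteq> ?S" for X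
    unfolding P_def using that by (subst emeasure_point_measure_finite) auto
  have row: "(\<Sum>j<k. ennreal (\<pi> i j)) = ennreal (w i)" if "i < k" for i
    using plan that by (subst sum_ennreal) (auto simp: transport_plan_def)
  have col: "(\<Sum>i<k. ennreal (\<pi> i j)) = ennreal (v j)" if "j < k" for j
    using plan that by (subst sum_ennreal) (auto simp: transport_plan_def)
  have w0: "0 \<le> w i" if "i < k" for i
    using plan that by (auto simp: transport_plan_def intro!: sum_nonneg) (metis lessThan_iff sum_nonneg)
  have "prob_space P"
  proof (rule prob_spaceI)
    have "emeasure P (space P) = (\<Sum>i<k. \<Sum>j<k. ennreal (\<pi> i j))"
      by (subst emP) (auto simp: P_def space_point_measure sum.cartesian_product)
    also have "\<dots> = (\<Sum>i<k. ennreal (w i))" using row by simp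
    also have "\<dots> = 1" using tot w0 by (subst sum_ennreal) auto
    finally show "emeasure P (space P) = 1" .
  qed
  then have prob: "prob_space C" unfolding C_def by (rule prob_space.prob_space_distr[OF _ meas])
  have fst: "distr C (Rd d) fst = mixG d k w a"
  proof -
    have "distr C (Rd d) fst = distr P (Rd d) (\<lambda>(i, j). a i)"
      unfolding C_def by (subst distr_distr[OF _ meas]) (auto simp: comp_def case_prod_unfold)
    also have "\<dots> = distr (point_measure {..<k} (\<lambda>j. ennreal (w j))) (Rd d) a"
    proof (rule measure_eqI)
      fix A assume "A \<in> sets (distr P (Rd d) (\<lambda>(i, j). a i))"
      then have A: "A \<in> sets (Rd d)" by simp
      have "emeasure (distr P (Rd d) (\<lambda>(i, j). a i)) A = emeasure P ((a -` A \<inter> {..<k}) \<times> {..<k})"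
        using A a by (subst emeasure_distr) (auto simp: P_def space_point_measure intro!: arg_cong[where f="emeasure _"])
      also have "\<dots> = (\<Sum>i\<in>a -` A \<inter> {..<k}. \<Sum>j<k. ennreal (\<pi> i j))"
        by (subst emP) (auto simp: sum.cartesian_product)
      also have "\<dots> = (\<Sum>i\<in>a -` A \<inter> {..<k}. ennreal (w i))" using row by simp
      also have "\<dots> = emeasure (distr (point_measure {..<k} (\<lambda>j. ennreal (w j))) (Rd d) a) A"
        using A a by (subst emeasure_distr) (auto simp: space_point_measure emeasure_point_measure_finite)
      finally show "emeasure (distr P (Rd d) (\<lambda>(i, j). a i)) A
        = emeasure (distr (point_measure {..<k} (\<lambda>j. ennreal (w j))) (Rd d) a) A" .
    qed simp
    also have "\<dots> = mixG d k w a" using a by (subst mixG_eq_distr) auto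
    finally show ?thesis .
  qed
  have snd: "distr C (Rd d) snd = mixG d k v b"
  proof -
    have "distr C (Rd d) snd = distr P (Rd d) (\<lambda>(i, j). b j)"
      unfolding C_def by (subst distr_distr[OF _ meas]) (auto simp: comp_def case_prod_unfold)
    also have "\<dots> = distr (point_measure {..<k} (\<lambda>j. ennreal (v j))) (Rd d) b"
    proof (rule measure_eqI)
      fix A assume "A \<in> sets (distr P (Rd d) (\<lambda>(i, j). b j))"
      then have A: "A \<in> sets (Rd d)" by simp
      have "emeasure (distr P (Rd d) (\<lambda>(i, j). b j)) A = emeasure P ({..<k} \<times> (b -` A \<inter> {..<k}))"
        using A b by (subst emeasure_distr) (auto simp: P_def space_point_measure intro!: arg_cong[where f="emeasure _"])
      also have "\<dots> = (\<Sum>i<k. \<Sum>j\<in>b -` A \<inter> {..<k}. ennreal (\<pi> i j))"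
        by (subst emP) (auto simp: sum.cartesian_product)
      also have "\<dots> = (\<Sum>j\<in>b -` A \<inter> {..<k}. \<Sum>i<k. ennreal (\<pi> i j))" by (rule sum.swap)
      also have "\<dots> = (\<Sum>j\<in>b -` A \<inter> {..<k}. ennreal (v j))" using col by simp
      also have "\<dots> = emeasure (distr (point_measure {..<k} (\<lambda>j. ennreal (v j))) (Rd d) b) A"
        using A b by (subst emeasure_distr) (auto simp: space_point_measure emeasure_point_measure_finite)
      finally show "emeasure (distr P (Rd d) (\<lambda>(i, j). b j)) A
        = emeasure (distr (point_measure {..<k} (\<lambda>j. ennreal (v j))) (Rd d) b) A" .
    qed simp
    also have "\<dots> = mixG d k v b" using b by (subst mixG_eq_distr) auto
    finally show ?thesis .
  qed
  have "C \<in> couplings d (mixG d k w a) (mixG d k v b)"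
    using prob fst snd by (simp add: couplings_def C_def)
  then have "W1 d (mixG d k w a) (mixG d k v b) \<le> (\<integral>\<^sup>+ z. ennreal (edist d (fst z) (snd z)) \<partial>C)"
    unfolding W1_def by (rule INF_lower)
  also have "\<dots> = (\<integral>\<^sup>+ x. (case x of (i, j) \<Rightarrow> ennreal (edist d (a i) (b j))) \<partial>P)"
    unfolding C_def by (subst nn_integral_distr[OF meas]) (auto intro!: nn_integral_cong)
  also have "\<dots> = (\<Sum>i<k. \<Sum>j<k. ennreal (\<pi> i j) * ennreal (edist d (a i) (b j)))"
    unfolding P_def by (subst nn_integral_point_measure_finite)
      (auto simp: sum.cartesian_product intro!: sum.cong)
  also have "\<dots> = (\<Sum>i<k. \<Sum>j<k. ennreal (\<pi> i j * edist d (a i) (b j)))"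
    using pos by (intro sum.cong refl) (auto simp: ennreal_mult' edist_def enorm_nonneg)
  also have "\<dots> = ennreal (\<Sum>i<k. \<Sum>j<k. \<pi> i j * edist d (a i) (b j))"
  proof -
    have nn: "0 \<le> \<pi> i j * edist d (a i) (b j)" if "i < k" "j < k" for i j
      using pos[OF that] by (simp add: edist_def enorm_nonneg)
    have "(\<Sum>j<k. ennreal (\<pi> i j * edist d (a i) (b j))) = ennreal (\<Sum>j<k. \<pi> i j * edist d (a i) (b j))"
      if "i < k" for i using nn that by (intro sum_ennreal) auto
    then show ?thesis using nn by (subst sum_ennreal[symmetric]) (auto intro!: sum_nonneg)
  qed
  finally show ?thesis .
qed

section \<open>Translations of Lebesgue measure and product Gaussians\<close>

text \<open>The restriction keeps translated points extensional, hence inside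
  \<open>space (Rd d)\<close>.\<close>

definition shift :: "nat \<Rightarrow> (nat \<Rightarrow> real) \<Rightarrow> (nat \<Rightarrow> real) \<Rightarrow> nat \<Rightarrow> real" where
  "shift d c x = (\<lambda>i\<in>{..<d}. x i + c i)"

lemma measurable_shift[measurable]: "shift d c \<in> measurable (Rd d) (Rd d)"
  unfolding shift_def[abs_def] Rd_def
  by (intro measurable_restrict borel_measurable_add measurable_component_singleton) auto

lemma distr_lebd_shift: "distr (lebd d) (lebd d) (shift d c) = lebd d"
proof -
  interpret product_sigma_finite "\<lambda>_::nat. lborel :: real measure" by standard
  have "distr (lebd d) (lebd d) (shift d c) = PiM {..<d} (\<lambda>_. lborel)"
  proof (rule PiM_eqI)
    fix A :: "nat \<Rightarrow> real set" assume A: "\<And>i. i \<in> {..<d} \<Longrightarrow> A i \<in> sets lborel"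
    have "emeasure (distr (lebd d) (lebd d) (shift d c)) (PiE {..<d} A)
      = emeasure (lebd d) (shift d c -` PiE {..<d} A \<inter> space (lebd d))"
      by (intro emeasure_distr) (measurable, use A in \<open>auto simp: Rd_def intro!: sets_PiM_I_finite\<close>)
    also have "shift d c -` PiE {..<d} A \<inter> space (lebd d) = PiE {..<d} (\<lambda>i. (+) (c i) -` A i)"
      by (auto simp: space_Rd shift_def PiE_iff add.commute)
    also have "emeasure (lebd d) \<dots> = (\<Prod>i<d. emeasure lborel ((+) (c i) -` A i))"
      unfolding lebd_def using A
      by (intro emeasure_PiM) (auto intro!: measurable_sets_borel[where M=borel])
    also have "\<dots> = (\<Prod>i<d. emeasure lborel (A i))"
    proof (intro prod.cong refl)
      fix i assume "i \<in> {..<d}"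
      have "emeasure lborel (A i) = emeasure (distr lborel borel ((+) (c i))) (A i)"
        by (simp add: lborel_distr_plus)
      also have "\<dots> = emeasure lborel ((+) (c i) -` A i)"
        using A \<open>i \<in> {..<d}\<close> by (subst emeasure_distr) auto
      finally show "emeasure lborel ((+) (c i) -` A i) = emeasure lborel (A i)" by simp
    qed
    finally show "emeasure (distr (lebd d) (lebd d) (shift d c)) (PiE {..<d} A) = (\<Prod>i<d. emeasure lborel (A i))" .
  qed (auto simp: lebd_def)
  then show ?thesis by (simp add: lebd_def)
qed

lemma nn_integral_lebd_shift:
  assumes [measurable]: "f \<in> borel_measurable (Rd d)"
  shows "(\<integral>\<^sup>+x. f (shift d c x) \<partial>lebd d) = (\<integral>\<^sup>+x. f x \<partial>lebd d)"
proof -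
  have "(\<integral>\<^sup>+x. f x \<partial>lebd d) = (\<integral>\<^sup>+x. f x \<partial>distr (lebd d) (lebd d) (shift d c))"
    by (simp add: distr_lebd_shift)
  also have "\<dots> = (\<integral>\<^sup>+x. f (shift d c x) \<partial>lebd d)" by (rule nn_integral_distr) auto
  finally show ?thesis by simp
qed

definition normal_prod :: "nat \<Rightarrow> (nat \<Rightarrow> real) \<Rightarrow> real" where
  "normal_prod d x = (\<Prod>i<d. std_normal_density (x i))"

lemma measurable_normal_prod[measurable]: "normal_prod d \<in> borel_measurable (Rd d)"
  unfolding normal_prod_def
  by (intro borel_measurable_prod measurable_compose[OF _ borel_measurable_normal_density] measurable_Rd_component) auto

lemma normal_prod_pos: "0 < normal_prod d x"
  unfolding normal_prod_def by (intro prod_pos) (auto simp: normal_density_pos)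

lemma normal_prod_eq: "normal_prod d x = (1 / sqrt (2 * pi)) ^ d * exp (- (\<Sum>i<d. (x i)\<^sup>2) / 2)"
  unfolding normal_prod_def std_normal_density_def prod.distrib
  by (simp add: exp_sum[symmetric] sum_negf sum_divide_distrib)

lemma normal_prod_shift: "normal_prod d (shift d c x) = normal_prod d (\<lambda>i. x i + c i)"
  by (simp add: normal_prod_def shift_def)

lemma gmix_density_eq: "gmix_density d k w a x = (\<Sum>j<k. w j * normal_prod d (\<lambda>i. x i - a j i))"
  by (simp add: gmix_density_def normal_prod_def)

lemma measurable_normal_prod_diff[measurable]: "(\<lambda>x. normal_prod d (\<lambda>i. x i - c i)) \<in> borel_measurable (Rd d)"
  unfolding normal_prod_def
  by (intro borel_measurable_prod measurable_compose[OF _ borel_measurable_normal_density]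
      borel_measurable_diff measurable_Rd_component) auto

lemma nn_integral_normal_prod_diff: "(\<integral>\<^sup>+x. ennreal (normal_prod d (\<lambda>i. x i - c i)) \<partial>lebd d) = 1"
proof -
  interpret product_sigma_finite "\<lambda>_::nat. lborel :: real measure" by standard
  have "(\<integral>\<^sup>+x. ennreal (normal_prod d (\<lambda>i. x i - c i)) \<partial>lebd d)
    = (\<integral>\<^sup>+x. (\<Prod>i<d. ennreal (normal_density (c i) 1 (x i))) \<partial>PiM {..<d} (\<lambda>_. lborel))"
    unfolding lebd_def normal_prod_def
    by (intro nn_integral_cong) (simp add: prod_ennreal normal_density_nonneg, simp add: normal_density_def)
  also have "\<dots> = (\<Prod>i<d. \<integral>\<^sup>+x. ennreal (normal_density (c i) 1 x) \<partial>lborel)"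
    by (rule product_nn_integral_prod) auto
  also have "\<dots> = 1"
    by (simp add: nn_integral_eq_integral normal_density_nonneg)
  finally show ?thesis .
qed

lemma nn_integral_normal_prod: "(\<integral>\<^sup>+x. ennreal (normal_prod d x) \<partial>lebd d) = 1"
  using nn_integral_normal_prod_diff[of d "\<lambda>_. 0"] by simp

section \<open>Orthogonal projections of Gaussian mixtures\<close>

text \<open>The matrix \<open>b\<close> is stored by rows. With \<open>tr b\<close> and the
  dimensions exchanged, the same operator is the transpose; for orthonormal rows that is the
  isometric embedding of \<open>R^m\<close> onto the row space.\<close>

definition linmap :: "nat \<Rightarrow> nat \<Rightarrow> (nat \<Rightarrow> nat \<Rightarrow> real) \<Rightarrow> (nat \<Rightarrow> real) \<Rightarrow> nat \<Rightarrow> real" where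
  "linmap m d b x = (\<lambda>r\<in>{..<m}. \<Sum>i<d. b r i * x i)"

abbreviation (input) tr :: "(nat \<Rightarrow> nat \<Rightarrow> real) \<Rightarrow> nat \<Rightarrow> nat \<Rightarrow> real" where
  "tr b \<equiv> \<lambda>i r. b r i"

definition orthonormal_rows :: "nat \<Rightarrow> nat \<Rightarrow> (nat \<Rightarrow> nat \<Rightarrow> real) \<Rightarrow> bool" where
  "orthonormal_rows m d b \<longleftrightarrow> (\<forall>r<m. \<forall>s<m. (\<Sum>i<d. b r i * b s i) = (if r = s then 1 else 0))"

lemma measurable_linmap[measurable]: "linmap m d b \<in> measurable (Rd d) (Rd m)"
  unfolding linmap_def[abs_def] Rd_def[of m]
  by (intro measurable_restrict borel_measurable_sum borel_measurable_times borel_measurable_const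
      measurable_Rd_component) auto

lemma linmap_in_space[simp]: "linmap m d b x \<in> space (Rd m)"
  by (simp add: linmap_def space_Rd)

lemma linmap_shift: "linmap m d b (shift d c x) = shift m (linmap m d b c) (linmap m d b x)"
  by (auto simp: linmap_def shift_def fun_eq_iff sum.distrib algebra_simps)

lemma linmap_adjoint:
  "(\<Sum>i<d. x i * linmap d m (tr b) y i) = (\<Sum>r<m. linmap m d b x r * y r)"
proof -
  have "(\<Sum>i<d. x i * linmap d m (tr b) y i) = (\<Sum>i<d. \<Sum>r<m. b r i * x i * y r)"
    by (simp add: linmap_def sum_distrib_left algebra_simps)
  also have "\<dots> = (\<Sum>r<m. \<Sum>i<d. b r i * x i * y r)" by (rule sum.swap)
  finally show ?thesis by (simp add: linmap_def sum_distrib_right)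
qed

lemma linmap_tr_inverse:
  assumes "orthonormal_rows m d b" "r < m"
  shows "linmap m d b (linmap d m (tr b) y) r = y r"
proof -
  have "linmap m d b (linmap d m (tr b) y) r = (\<Sum>i<d. \<Sum>s<m. b r i * b s i * y s)"
    using assms(2) by (simp add: linmap_def sum_distrib_left algebra_simps)
  also have "\<dots> = (\<Sum>s<m. (\<Sum>i<d. b r i * b s i) * y s)"
    by (subst sum.swap) (simp add: sum_distrib_right)
  also have "\<dots> = (\<Sum>s<m. if r = s then y s else 0)"
    using assms by (intro sum.cong) (auto simp: orthonormal_rows_def)
  finally show ?thesis using assms(2) by simp
qed

lemma enorm_linmap_tr:
  assumes "orthonormal_rows m d b"
  shows "enorm d (linmap d m (tr b) y) = enorm m y"
proof -
  have "(\<Sum>i<d. (linmap d m (tr b) y i)\<^sup>2) = (\<Sum>r<m. (y r)\<^sup>2)"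
    using linmap_adjoint[where x="linmap d m (tr b) y" and d=d and m=m and b=b and y=y] linmap_tr_inverse[OF assms]
    by (simp add: power2_eq_square)
  then show ?thesis by (simp add: enorm_def)
qed

lemma measurable_shift_pair[measurable (raw)]:
  assumes [measurable]: "f \<in> measurable N (Rd d)" "g \<in> measurable N (Rd d)"
  shows "(\<lambda>x. shift d (f x) (g x)) \<in> measurable N (Rd d)"
  unfolding shift_def[abs_def] Rd_def[of d]
  by (intro measurable_restrict borel_measurable_add measurable_compose[OF assms(1) measurable_Rd_component]
      measurable_compose[OF assms(2) measurable_Rd_component]) auto

text \<open>Both sides agree up to the factor \<open>K = \<integral> Q(x) N(-Bx) dx\<close>: averaging the left-hand side over
  the translations \<open>x \<mapsto> x + B\<^sup>T y\<close> produces \<open>K\<close> times the right-hand side because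
  \<open>N(x + B\<^sup>T y) = Q(x) N(Bx + y)\<close> with \<open>Q\<close> invariant under these translations; \<open>f = 1\<close> gives \<open>K = 1\<close>.\<close>

lemma nn_integral_normal_linmap:
  assumes b: "orthonormal_rows m d b" and f[measurable]: "f \<in> borel_measurable (Rd m)"
  shows "(\<integral>\<^sup>+x. ennreal (normal_prod d x) * f (linmap m d b x) \<partial>lebd d)
    = (\<integral>\<^sup>+y. ennreal (normal_prod m y) * f y \<partial>lebd m)"
proof -
  define B where "B = linmap m d b"
  define T where "T = linmap d m (tr b)"
  \<comment> \<open>The bracketed factor is \<open>1 / normal_prod m (B x)\<close>, so
    \<open>Q\<close> is the Gaussian density of the component of \<open>x\<close> orthogonal to the
    rows.\<close>
  define Q where "Q x = normal_prod d x * (exp ((\<Sum>r<m. (B x r)\<^sup>2) / 2) * sqrt (2 * pi) ^ m)" for x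
  have [measurable]: "B \<in> measurable (Rd d) (Rd m)" "T \<in> measurable (Rd m) (Rd d)"
    unfolding B_def T_def by measurable
  have "(\<lambda>x. \<Sum>r<m. (B x r)\<^sup>2) \<in> borel_measurable (Rd d)"
    by (intro borel_measurable_sum borel_measurable_power
      measurable_compose[OF \<open>B \<in> measurable (Rd d) (Rd m)\<close> measurable_Rd_component]) auto
  note this[measurable]
  have Q[measurable]: "Q \<in> borel_measurable (Rd d)" unfolding Q_def[abs_def] by measurable
  have Q0: "0 \<le> Q x" for x using normal_prod_pos[of d x] by (auto simp: Q_def)
  have N0: "0 \<le> normal_prod n x" for n x using normal_prod_pos[of n x] by simp
  have BT: "B (shift d (T y) x) = shift m y (B x)" for x y
    unfolding B_def T_def linmap_shift using linmap_tr_inverse[OF b, of _ y]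
    by (auto simp: shift_def fun_eq_iff)
  have key3: "normal_prod m y * (exp ((\<Sum>r<m. (y r)\<^sup>2) / 2) * sqrt (2 * pi) ^ m) = 1" for y
    by (simp add: normal_prod_eq exp_minus power_divide)
  have key1: "normal_prod d (shift d (T y) x) = Q x * normal_prod m (shift m y (B x))" for x y
  proof -
    have sq: "(\<Sum>i<d. (x i + T y i)\<^sup>2) = (\<Sum>i<d. (x i)\<^sup>2) + 2 * (\<Sum>r<m. B x r * y r) + (\<Sum>r<m. (y r)\<^sup>2)"
      using linmap_adjoint[where x=x and d=d and m=m and b=b and y=y] enorm_linmap_tr[OF b, of y]
      unfolding B_def[symmetric] T_def[symmetric]
      by (simp add: power2_sum sum.distrib enorm_def sum_distrib_left[symmetric] mult.assoc)
    have sq': "(\<Sum>r<m. (B x r + y r)\<^sup>2) = (\<Sum>r<m. (B x r)\<^sup>2) + 2 * (\<Sum>r<m. B x r * y r) + (\<Sum>r<m. (y r)\<^sup>2)"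
      by (simp add: power2_sum sum.distrib sum_distrib_left[symmetric] mult.assoc)
    have "normal_prod d (shift d (T y) x)
      = (1 / sqrt (2 * pi)) ^ d * exp (- (\<Sum>i<d. (x i)\<^sup>2) / 2 + ((\<Sum>r<m. (B x r)\<^sup>2) / 2 + - (\<Sum>r<m. (B x r + y r)\<^sup>2) / 2))"
      unfolding normal_prod_shift unfolding normal_prod_eq sq sq' by (simp add: field_simps)
    also have "\<dots> = Q x * normal_prod m (shift m y (B x))"
      unfolding Q_def normal_prod_shift unfolding normal_prod_eq exp_add
      by (simp add: power_divide)
    finally show ?thesis .
  qed
  have key2: "Q (shift d (T z) x) = Q x" for x z
    unfolding Q_def[of "shift d (T z) x"] BT key1 using key3[of "shift m z (B x)"]
    by (simp add: mult.assoc)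
  interpret L: pair_sigma_finite "lebd d" "lebd m"
    using sigma_finite_lebd by (simp add: pair_sigma_finite_def)
  define K where "K = (\<integral>\<^sup>+x. ennreal (Q x) * ennreal (normal_prod m (\<lambda>r. - B x r)) \<partial>lebd d)"
  have main: "(\<integral>\<^sup>+x. ennreal (normal_prod d x) * f (B x) \<partial>lebd d)
    = K * (\<integral>\<^sup>+y. ennreal (normal_prod m y) * f y \<partial>lebd m)"
    if f[measurable]: "f \<in> borel_measurable (Rd m)" for f
  proof -
    define g where "g y = ennreal (normal_prod m y) * f y" for y
    have g[measurable]: "g \<in> borel_measurable (Rd m)" unfolding g_def[abs_def] by measurable
    let ?E = "\<integral>\<^sup>+x. ennreal (normal_prod d x) * f (B x) \<partial>lebd d"
    have E: "?E = (\<integral>\<^sup>+x. ennreal (Q x) * g (shift m y (B x)) \<partial>lebd d)" for y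
    proof -
      have "?E = (\<integral>\<^sup>+x. ennreal (normal_prod d (shift d (T y) x)) * f (B (shift d (T y) x)) \<partial>lebd d)"
        by (rule nn_integral_lebd_shift[symmetric]) measurable
      then show ?thesis by (simp add: key1 BT g_def ennreal_mult Q0 N0 mult.assoc)
    qed
    \<comment> \<open>\<open>?E\<close> has the form \<open>E\<close> for every \<open>y\<close>;
      averaging with Gaussian weight in \<open>y\<close> brings in a double integral. Only
      translation invariance of Lebesgue measure is used from here on, no rotation.\<close>
    have "?E = (\<integral>\<^sup>+y. ennreal (normal_prod m y) \<partial>lebd m) * ?E" by (simp add: nn_integral_normal_prod)
    also have "\<dots> = (\<integral>\<^sup>+y. ennreal (normal_prod m y) * ?E \<partial>lebd m)"
      by (rule nn_integral_multc[symmetric]) measurable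
    also have "\<dots> = (\<integral>\<^sup>+y. \<integral>\<^sup>+x. ennreal (normal_prod m y) * (ennreal (Q x) * g (shift m y (B x))) \<partial>lebd d \<partial>lebd m)"
      by (intro nn_integral_cong) (subst E, subst nn_integral_cmult, auto)
    also have "\<dots> = (\<integral>\<^sup>+x. \<integral>\<^sup>+y. ennreal (normal_prod m y) * (ennreal (Q x) * g (shift m y (B x))) \<partial>lebd m \<partial>lebd d)"
      by (rule L.Fubini') measurable
    \<comment> \<open>The substitution \<open>z = y + B x\<close> frees the argument of
      \<open>g\<close> from \<open>x\<close>, so that the integral over \<open>x\<close> can be done
      first.\<close>
    also have "\<dots> = (\<integral>\<^sup>+x. \<integral>\<^sup>+z. g z * (ennreal (Q x) * ennreal (normal_prod m (shift m (\<lambda>r. - B x r) z))) \<partial>lebd m \<partial>lebd d)"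
    proof (rule nn_integral_cong)
      fix x
      have "(\<integral>\<^sup>+z. g z * (ennreal (Q x) * ennreal (normal_prod m (shift m (\<lambda>r. - B x r) z))) \<partial>lebd m)
        = (\<integral>\<^sup>+y. g (shift m (B x) y) * (ennreal (Q x) * ennreal (normal_prod m (shift m (\<lambda>r. - B x r) (shift m (B x) y)))) \<partial>lebd m)"
        by (rule nn_integral_lebd_shift[symmetric]) measurable
      also have "\<dots> = (\<integral>\<^sup>+y. ennreal (normal_prod m y) * (ennreal (Q x) * g (shift m y (B x))) \<partial>lebd m)"
      proof (intro nn_integral_cong)
        fix y
        have "shift m (B x) y = shift m y (B x)" by (auto simp: shift_def add.commute)
        moreover have "normal_prod m (shift m (\<lambda>r. - B x r) (shift m (B x) y)) = normal_prod m y"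
          by (simp add: normal_prod_def shift_def)
        ultimately show "g (shift m (B x) y) * (ennreal (Q x) * ennreal (normal_prod m (shift m (\<lambda>r. - B x r) (shift m (B x) y))))
          = ennreal (normal_prod m y) * (ennreal (Q x) * g (shift m y (B x)))"
          by (simp add: ac_simps)
      qed
      finally show "(\<integral>\<^sup>+y. ennreal (normal_prod m y) * (ennreal (Q x) * g (shift m y (B x))) \<partial>lebd m)
        = (\<integral>\<^sup>+z. g z * (ennreal (Q x) * ennreal (normal_prod m (shift m (\<lambda>r. - B x r) z))) \<partial>lebd m)" by simp
    qed
    also have "\<dots> = (\<integral>\<^sup>+z. \<integral>\<^sup>+x. g z * (ennreal (Q x) * ennreal (normal_prod m (shift m (\<lambda>r. - B x r) z))) \<partial>lebd d \<partial>lebd m)"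
    proof (rule L.Fubini'[symmetric])
      have "(\<lambda>p. normal_prod m (\<lambda>r. snd p r - B (fst p) r)) \<in> borel_measurable (Rd d \<Otimes>\<^sub>M Rd m)"
        unfolding normal_prod_def
        by (intro borel_measurable_prod measurable_compose[OF _ borel_measurable_normal_density] borel_measurable_diff
          measurable_compose[OF measurable_snd measurable_Rd_component]
          measurable_compose[OF measurable_compose[OF measurable_fst \<open>B \<in> measurable (Rd d) (Rd m)\<close>] measurable_Rd_component]) auto
      note this[measurable]
      show "(\<lambda>(x, z). g z * (ennreal (Q x) * ennreal (normal_prod m (shift m (\<lambda>r. - B x r) z)))) \<in> borel_measurable (lebd d \<Otimes>\<^sub>M lebd m)"
        unfolding normal_prod_shift case_prod_unfold by simp
    qed
    also have "\<dots> = (\<integral>\<^sup>+z. g z * K \<partial>lebd m)"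
    proof (intro nn_integral_cong)
      fix z
      have minus[measurable]: "(\<lambda>x. normal_prod m (\<lambda>r. z r - B x r)) \<in> borel_measurable (Rd d)" for z
        unfolding normal_prod_def
        by (intro borel_measurable_prod measurable_compose[OF _ borel_measurable_normal_density] borel_measurable_diff
          measurable_compose[OF \<open>B \<in> measurable (Rd d) (Rd m)\<close> measurable_Rd_component]) auto
      have "(\<integral>\<^sup>+x. g z * (ennreal (Q x) * ennreal (normal_prod m (shift m (\<lambda>r. - B x r) z))) \<partial>lebd d)
        = g z * (\<integral>\<^sup>+x. ennreal (Q x) * ennreal (normal_prod m (\<lambda>r. z r - B x r)) \<partial>lebd d)"
        unfolding normal_prod_shift by (subst nn_integral_cmult[symmetric]) auto
      \<comment> \<open>Shifting \<open>x\<close> by \<open>T z\<close> leaves \<open>Q\<close>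
        unchanged and turns \<open>z - B x\<close> into \<open>- B x\<close>, so the value no longer
        depends on \<open>z\<close>.\<close>
      also have "(\<integral>\<^sup>+x. ennreal (Q x) * ennreal (normal_prod m (\<lambda>r. z r - B x r)) \<partial>lebd d)
        = (\<integral>\<^sup>+x. ennreal (Q (shift d (T z) x)) * ennreal (normal_prod m (\<lambda>r. z r - B (shift d (T z) x) r)) \<partial>lebd d)"
        by (rule nn_integral_lebd_shift[symmetric]) measurable
      also have "\<dots> = K"
        unfolding K_def key2 BT by (intro nn_integral_cong) (simp add: normal_prod_def shift_def)
      finally show "(\<integral>\<^sup>+x. g z * (ennreal (Q x) * ennreal (normal_prod m (shift m (\<lambda>r. - B x r) z))) \<partial>lebd d) = g z * K" .
    qed
    also have "\<dots> = K * (\<integral>\<^sup>+z. g z \<partial>lebd m)"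
      by (subst nn_integral_multc) (auto simp: mult.commute)
    finally show ?thesis by (simp add: g_def)
  qed
  have "K = 1" using main[of "\<lambda>_. 1"] by (simp add: nn_integral_normal_prod)
  then show ?thesis using main[OF f] by (simp add: B_def)
qed

lemma nn_integral_normal_diff_linmap:
  assumes b: "orthonormal_rows m d b" and f[measurable]: "f \<in> borel_measurable (Rd m)"
  shows "(\<integral>\<^sup>+x. ennreal (normal_prod d (\<lambda>i. x i - c i)) * f (linmap m d b x) \<partial>lebd d)
    = (\<integral>\<^sup>+y. ennreal (normal_prod m (\<lambda>r. y r - linmap m d b c r)) * f y \<partial>lebd m)"
proof -
  have unshift: "normal_prod n (\<lambda>i. shift n e x i - e i) = normal_prod n x" for n e x
    by (simp add: normal_prod_def shift_def)
  have "(\<integral>\<^sup>+x. ennreal (normal_prod d (\<lambda>i. x i - c i)) * f (linmap m d b x) \<partial>lebd d)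
    = (\<integral>\<^sup>+x. ennreal (normal_prod d (\<lambda>i. shift d c x i - c i)) * f (linmap m d b (shift d c x)) \<partial>lebd d)"
    by (rule nn_integral_lebd_shift[symmetric]) measurable
  also have "\<dots> = (\<integral>\<^sup>+x. ennreal (normal_prod d x) * f (shift m (linmap m d b c) (linmap m d b x)) \<partial>lebd d)"
    by (simp add: unshift linmap_shift)
  also have "\<dots> = (\<integral>\<^sup>+y. ennreal (normal_prod m y) * f (shift m (linmap m d b c) y) \<partial>lebd m)"
    by (rule nn_integral_normal_linmap[OF b]) measurable
  also have "\<dots> = (\<integral>\<^sup>+y. ennreal (normal_prod m (\<lambda>r. shift m (linmap m d b c) y r - linmap m d b c r)) * f (shift m (linmap m d b c) y) \<partial>lebd m)"
    by (simp add: unshift)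
  also have "\<dots> = (\<integral>\<^sup>+y. ennreal (normal_prod m (\<lambda>r. y r - linmap m d b c r)) * f y \<partial>lebd m)"
    by (rule nn_integral_lebd_shift) measurable
  finally show ?thesis .
qed

section \<open>Gaussian mixtures as measures, and their projected laws\<close>

lemma sets_PGamma[measurable_cong, simp]: "sets (PGamma d k w a) = sets (Rd d)"
  by (simp add: PGamma_def)

lemma space_PGamma[simp]: "space (PGamma d k w a) = space (Rd d)"
  by (simp add: PGamma_def)

lemma nn_integral_gmix_density:
  assumes "\<And>j. j < k \<Longrightarrow> 0 \<le> w j" and [measurable]: "f \<in> borel_measurable (Rd d)"
  shows "(\<integral>\<^sup>+x. ennreal (gmix_density d k w a x) * f x \<partial>lebd d)
    = (\<Sum>j<k. ennreal (w j) * (\<integral>\<^sup>+x. ennreal (normal_prod d (\<lambda>i. x i - a j i)) * f x \<partial>lebd d))"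
proof -
  have N0: "0 \<le> normal_prod n x" for n x using normal_prod_pos[of n x] by simp
  have "ennreal (gmix_density d k w a x) * f x
    = (\<Sum>j<k. ennreal (w j) * (ennreal (normal_prod d (\<lambda>i. x i - a j i)) * f x))" for x
  proof -
    have "ennreal (gmix_density d k w a x) = (\<Sum>j<k. ennreal (w j * normal_prod d (\<lambda>i. x i - a j i)))"
      unfolding gmix_density_eq using assms(1) N0 by (intro sum_ennreal[symmetric]) auto
    also have "\<dots> = (\<Sum>j<k. ennreal (w j) * ennreal (normal_prod d (\<lambda>i. x i - a j i)))"
      using assms(1) N0 by (intro sum.cong) (auto simp: ennreal_mult)
    finally show ?thesis by (simp add: sum_distrib_right mult.assoc)
  qed
  then have "(\<integral>\<^sup>+x. ennreal (gmix_density d k w a x) * f x \<partial>lebd d)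
    = (\<Sum>j<k. \<integral>\<^sup>+x. ennreal (w j) * (ennreal (normal_prod d (\<lambda>i. x i - a j i)) * f x) \<partial>lebd d)"
    by (simp, subst nn_integral_sum) auto
  also have "\<dots> = (\<Sum>j<k. ennreal (w j) * (\<integral>\<^sup>+x. ennreal (normal_prod d (\<lambda>i. x i - a j i)) * f x \<partial>lebd d))"
    by (intro sum.cong refl nn_integral_cmult) auto
  finally show ?thesis .
qed

lemma gmix_density_nonneg:
  assumes "\<And>j. j < k \<Longrightarrow> 0 \<le> w j"
  shows "0 \<le> gmix_density d k w a x"
  unfolding gmix_density_eq using assms normal_prod_pos by (intro sum_nonneg mult_nonneg_nonneg) (auto simp: less_imp_le)

lemma prob_space_PGamma:
  assumes "\<And>j. j < k \<Longrightarrow> 0 \<le> w j" "(\<Sum>j<k. w j) = 1"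
  shows "prob_space (PGamma d k w a)"
proof (rule prob_spaceI)
  have "emeasure (PGamma d k w a) (space (PGamma d k w a)) = (\<integral>\<^sup>+x. ennreal (gmix_density d k w a x) * 1 \<partial>lebd d)"
    unfolding PGamma_def by (subst emeasure_density) (auto intro!: nn_integral_cong)
  also have "\<dots> = (\<Sum>j<k. ennreal (w j))"
    using assms by (subst nn_integral_gmix_density) (auto simp: nn_integral_normal_prod_diff)
  also have "\<dots> = 1" using assms by (subst sum_ennreal) auto
  finally show "emeasure (PGamma d k w a) (space (PGamma d k w a)) = 1" .
qed

text \<open>Orthonormal rows map \<open>N(0, I_d)\<close> to \<open>N(0, I_m)\<close>, so projected
  observations follow a mixture of the same family in dimension \<open>m\<close>, to which the
  estimator of that dimension applies.\<close>

lemma distr_PGamma_linmap: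
  assumes b: "orthonormal_rows m d b" and w: "\<And>j. j < k \<Longrightarrow> 0 \<le> w j"
  shows "distr (PGamma d k w a) (Rd m) (linmap m d b) = PGamma m k w (\<lambda>j. linmap m d b (a j))"
proof (rule measure_eqI)
  fix A assume "A \<in> sets (distr (PGamma d k w a) (Rd m) (linmap m d b))"
  then have A[measurable]: "A \<in> sets (Rd m)" by simp
  have "emeasure (distr (PGamma d k w a) (Rd m) (linmap m d b)) A
    = (\<integral>\<^sup>+x. ennreal (gmix_density d k w a x) * indicator A (linmap m d b x) \<partial>lebd d)"
    by (subst emeasure_distr, measurable)
       (auto simp: PGamma_def emeasure_density indicator_def intro!: nn_integral_cong)
  also have "\<dots> = (\<integral>\<^sup>+y. ennreal (gmix_density m k w (\<lambda>j. linmap m d b (a j)) y) * indicator A y \<partial>lebd m)"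
    using w by (simp add: nn_integral_gmix_density nn_integral_normal_diff_linmap[OF b])
  also have "\<dots> = emeasure (PGamma m k w (\<lambda>j. linmap m d b (a j))) A"
    unfolding PGamma_def by (subst emeasure_density) auto
  finally show "emeasure (distr (PGamma d k w a) (Rd m) (linmap m d b)) A
    = emeasure (PGamma m k w (\<lambda>j. linmap m d b (a j))) A" .
qed simp

section \<open>Generating functions and Hellinger distance\<close>

lemma mgf_nonneg: "(\<And>j. j < k \<Longrightarrow> 0 \<le> w j) \<Longrightarrow> 0 \<le> mgf d k w a s"
  unfolding mgf_def by (intro sum_nonneg) auto

text \<open>Completing the square: the exponential tilt by \<open>s\<close> turns the Gaussian
  centred at \<open>c\<close> into the one centred at \<open>c + s\<close>, times
  \<open>exp (s . c)\<close>.\<close>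

lemma nn_integral_exp_gmix_density:
  assumes w: "\<And>j. j < k \<Longrightarrow> 0 \<le> w j"
  shows "(\<integral>\<^sup>+x. ennreal (gmix_density d k w a x) * ennreal (exp ((\<Sum>i<d. s i * x i) - (\<Sum>i<d. (s i)\<^sup>2) / 2)) \<partial>lebd d)
    = ennreal (mgf d k w a s)"
proof -
  have N0: "0 \<le> normal_prod n x" for n x using normal_prod_pos[of n x] by simp
  have [measurable]: "(\<lambda>x. \<Sum>i<d. s i * x i) \<in> borel_measurable (Rd d)"
    by (intro borel_measurable_sum borel_measurable_times borel_measurable_const measurable_Rd_component) auto
  have "(\<integral>\<^sup>+x. ennreal (normal_prod d (\<lambda>i. x i - c i)) * ennreal (exp ((\<Sum>i<d. s i * x i) - (\<Sum>i<d. (s i)\<^sup>2) / 2)) \<partial>lebd d)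
    = ennreal (exp (\<Sum>i<d. s i * c i))" for c
  proof -
    have "normal_prod d (\<lambda>i. x i - c i) * exp ((\<Sum>i<d. s i * x i) - (\<Sum>i<d. (s i)\<^sup>2) / 2)
      = exp (\<Sum>i<d. s i * c i) * normal_prod d (\<lambda>i. x i - (c i + s i))" for x
    proof -
      have "- (\<Sum>i<d. (x i - c i)\<^sup>2) / 2 + ((\<Sum>i<d. s i * x i) - (\<Sum>i<d. (s i)\<^sup>2) / 2)
        = (\<Sum>i<d. s i * c i) + - (\<Sum>i<d. (x i - (c i + s i))\<^sup>2) / 2"
        by (simp only: sum_divide_distrib sum_negf[symmetric] sum.distrib[symmetric] sum_subtractf[symmetric],
            intro sum.cong refl, simp add: power2_eq_square field_simps)
      then have "exp (- (\<Sum>i<d. (x i - c i)\<^sup>2) / 2) * exp ((\<Sum>i<d. s i * x i) - (\<Sum>i<d. (s i)\<^sup>2) / 2)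
        = exp (\<Sum>i<d. s i * c i) * exp (- (\<Sum>i<d. (x i - (c i + s i))\<^sup>2) / 2)"
        by (simp only: exp_add[symmetric])
      then show ?thesis unfolding normal_prod_eq by (simp add: ac_simps)
    qed
    then have "(\<integral>\<^sup>+x. ennreal (normal_prod d (\<lambda>i. x i - c i)) * ennreal (exp ((\<Sum>i<d. s i * x i) - (\<Sum>i<d. (s i)\<^sup>2) / 2)) \<partial>lebd d)
      = (\<integral>\<^sup>+x. ennreal (exp (\<Sum>i<d. s i * c i)) * ennreal (normal_prod d (\<lambda>i. x i - (c i + s i))) \<partial>lebd d)"
      by (intro nn_integral_cong) (simp add: ennreal_mult[symmetric] N0)
    also have "\<dots> = ennreal (exp (\<Sum>i<d. s i * c i))"
      by (subst nn_integral_cmult) (auto simp: nn_integral_normal_prod_diff)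
    finally show ?thesis .
  qed
  then have "(\<integral>\<^sup>+x. ennreal (gmix_density d k w a x) * ennreal (exp ((\<Sum>i<d. s i * x i) - (\<Sum>i<d. (s i)\<^sup>2) / 2)) \<partial>lebd d)
    = (\<Sum>j<k. ennreal (w j) * ennreal (exp (\<Sum>i<d. s i * a j i)))"
    by (subst nn_integral_gmix_density) (auto simp: w)
  also have "\<dots> = (\<Sum>j<k. ennreal (w j * exp (\<Sum>i<d. s i * a j i)))"
    by (intro sum.cong) (auto simp: ennreal_mult w)
  also have "\<dots> = ennreal (mgf d k w a s)"
    unfolding mgf_def using w by (intro sum_ennreal) auto
  finally show ?thesis .
qed

lemma mgf_le:
  assumes "valid_params d k R w a" "R > 0" "enorm d s \<le> c"
  shows "mgf d k w a s \<le> exp (c * R)"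
proof -
  have "exp (\<Sum>i<d. s i * a j i) \<le> exp (c * R)" if "j < k" for j
  proof -
    have "(\<Sum>i<d. s i * a j i) \<le> enorm d s * enorm d (a j)"
      using abs_dot_le_enorm[of s "a j" d] by simp
    also have "\<dots> \<le> c * R"
      using assms that enorm_nonneg order_trans[OF enorm_nonneg assms(3)]
      by (intro mult_mono) (auto simp: valid_params_def)
    finally show ?thesis by simp
  qed
  then have "mgf d k w a s \<le> (\<Sum>j<k. w j * exp (c * R))"
    unfolding mgf_def using assms(1) by (intro sum_mono mult_left_mono) (auto simp: valid_params_def)
  also have "\<dots> = exp (c * R)" using assms(1) by (simp add: valid_params_def sum_distrib_right[symmetric])
  finally show ?thesis .
qed

text \<open>\<open>hellinger\<close> passes through \<open>enn2real\<close>, which sends infinity to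
  0. The extended value is kept so that finiteness can be proved before the squared distance serves
  as an upper bound.\<close>

definition hellinger_sq :: "nat \<Rightarrow> ((nat \<Rightarrow> real) \<Rightarrow> real) \<Rightarrow> ((nat \<Rightarrow> real) \<Rightarrow> real) \<Rightarrow> ennreal" where
  "hellinger_sq d p q = (\<integral>\<^sup>+ x. ennreal ((sqrt (p x) - sqrt (q x))\<^sup>2) \<partial>lebd d)"

lemma hellinger_sq_le:
  assumes "valid_params d k R w a" "valid_params d k R v b"
  shows "hellinger_sq d (gmix_density d k w a) (gmix_density d k v b) \<le> 2"
proof -
  let ?p = "gmix_density d k w a" and ?q = "gmix_density d k v b"
  have w: "\<And>j. j < k \<Longrightarrow> 0 \<le> w j" "(\<Sum>j<k. w j) = 1" and v: "\<And>j. j < k \<Longrightarrow> 0 \<le> v j" "(\<Sum>j<k. v j) = 1"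
    using assms by (auto simp: valid_params_def)
  have one: "(\<integral>\<^sup>+x. ennreal (gmix_density d k u c x) \<partial>lebd d) = 1"
    if "\<And>j. j < k \<Longrightarrow> 0 \<le> u j" "(\<Sum>j<k. u j) = 1" for u c
    using nn_integral_exp_gmix_density[of k u d c "\<lambda>_. 0"] that by (simp add: mgf_def)
  have p0: "0 \<le> ?p x" "0 \<le> ?q x" for x using w v by (auto intro: gmix_density_nonneg)
  have "hellinger_sq d ?p ?q \<le> (\<integral>\<^sup>+ x. ennreal (?p x) + ennreal (?q x) \<partial>lebd d)"
    unfolding hellinger_sq_def
  proof (intro nn_integral_mono)
    fix x
    have "(sqrt (?p x) - sqrt (?q x))\<^sup>2 = ?p x + ?q x - 2 * (sqrt (?p x) * sqrt (?q x))"
      using p0[of x] by (simp add: power2_diff)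
    also have "\<dots> \<le> ?p x + ?q x" using p0[of x] by simp
    finally show "ennreal ((sqrt (?p x) - sqrt (?q x))\<^sup>2) \<le> ennreal (?p x) + ennreal (?q x)"
      using p0[of x] by (simp add: ennreal_plus[symmetric] ennreal_leI del: ennreal_plus)
  qed
  also have "\<dots> = 2" using one[OF w] one[OF v] by (subst nn_integral_add) auto
  finally show ?thesis .
qed

text \<open>Cauchy--Schwarz for \<open>p - q = (\<surd>p - \<surd>q)(\<surd>p + \<surd>q)\<close> against the exponential
  \<open>exp (s \<bullet> x - |s|\<^sup>2 / 2)\<close>, whose mean under \<open>\<Gamma> * N(0, I)\<close> is the generating function of \<open>\<Gamma>\<close>.\<close>

lemma mgf_diff_le_hellinger:
  assumes va: "valid_params d k R w a" and vb: "valid_params d k R v b" and R: "R > 0" and s: "enorm d s \<le> 1"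
  shows "\<bar>mgf d k w a s - mgf d k v b s\<bar>
    \<le> 2 * exp (R + 1 / 2) * hellinger d (gmix_density d k w a) (gmix_density d k v b)"
proof -
  define e where "e x = exp ((\<Sum>i<d. s i * x i) - (\<Sum>i<d. (s i)\<^sup>2) / 2)" for x
  define e2 where "e2 x = exp ((\<Sum>i<d. (2 * s i) * x i) - (\<Sum>i<d. (2 * s i)\<^sup>2) / 2)" for x
  have e0: "0 \<le> e x" for x by (simp add: e_def)
  have sq1: "(\<Sum>i<d. (s i)\<^sup>2) \<le> 1" using s by (simp add: enorm_def)
  \<comment> \<open>The square of the tilt by \<open>s\<close> is the tilt by \<open>2 * s\<close>
    times \<open>exp (|s|^2)\<close>, so second moments of \<open>e\<close> become generating
    functions at \<open>2 * s\<close>.\<close>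
  have e_sq: "(e x)\<^sup>2 \<le> exp 1 * e2 x" for x
  proof -
    have "(e x)\<^sup>2 = exp (2 * ((\<Sum>i<d. s i * x i) - (\<Sum>i<d. (s i)\<^sup>2) / 2))"
      by (simp only: e_def exp_double)
    also have "\<dots> = exp (\<Sum>i<d. (s i)\<^sup>2) * e2 x"
      unfolding e2_def exp_add[symmetric]
      by (simp add: power_mult_distrib sum_distrib_left[symmetric] mult.assoc)
    also have "\<dots> \<le> exp 1 * e2 x" using sq1 by (intro mult_right_mono) (auto simp: e2_def)
    finally show ?thesis .
  qed
  have [measurable]: "(\<lambda>x. \<Sum>i<d. c i * x i) \<in> borel_measurable (Rd d)" for c
    by (intro borel_measurable_sum borel_measurable_times borel_measurable_const measurable_Rd_component) auto
  have [measurable]: "e \<in> borel_measurable (Rd d)" "e2 \<in> borel_measurable (Rd d)"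
    unfolding e_def[abs_def] e2_def[abs_def] by measurable
  have s2: "enorm d (\<lambda>i. 2 * s i) \<le> 2" using s by (simp add: enorm_scale)
  \<comment> \<open>One direction for arbitrary parameters; exchanging the mixtures gives the
    absolute value. The one-sided form avoids subtraction in \<open>ennreal\<close>.\<close>
  have half: "mgf d k w a s - mgf d k v b s
    \<le> 2 * exp (R + 1 / 2) * hellinger d (gmix_density d k w a) (gmix_density d k v b)"
    if va: "valid_params d k R w a" and vb: "valid_params d k R v b" for w a v b
  proof -
    let ?p = "gmix_density d k w a" and ?q = "gmix_density d k v b"
    have w: "\<And>j. j < k \<Longrightarrow> 0 \<le> w j" and v: "\<And>j. j < k \<Longrightarrow> 0 \<le> v j"
      using va vb by (auto simp: valid_params_def)
    have p0: "0 \<le> ?p x" "0 \<le> ?q x" for x using w v by (auto intro: gmix_density_nonneg)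
    define I where "I = (\<integral>\<^sup>+x. ennreal \<bar>sqrt (?p x) - sqrt (?q x)\<bar> * ennreal (e x * (sqrt (?p x) + sqrt (?q x))) \<partial>lebd d)"
    have "ennreal (mgf d k w a s) = (\<integral>\<^sup>+x. ennreal (?p x) * ennreal (e x) \<partial>lebd d)"
      unfolding e_def using w by (intro nn_integral_exp_gmix_density[symmetric])
    also have "\<dots> \<le> (\<integral>\<^sup>+x. ennreal (?q x) * ennreal (e x)
        + ennreal \<bar>sqrt (?p x) - sqrt (?q x)\<bar> * ennreal (e x * (sqrt (?p x) + sqrt (?q x))) \<partial>lebd d)"
    proof (intro nn_integral_mono)
      fix x
      have "?p x - ?q x = (sqrt (?p x) - sqrt (?q x)) * (sqrt (?p x) + sqrt (?q x))"
        using p0[of x] by (simp add: algebra_simps)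
      also have "\<dots> \<le> \<bar>sqrt (?p x) - sqrt (?q x)\<bar> * (sqrt (?p x) + sqrt (?q x))"
        using p0[of x] by (intro mult_right_mono) auto
      finally have "?p x * e x \<le> (?q x + \<bar>sqrt (?p x) - sqrt (?q x)\<bar> * (sqrt (?p x) + sqrt (?q x))) * e x"
        using e0[of x] by (intro mult_right_mono) auto
      then have "ennreal (?p x * e x) \<le> ennreal (?q x * e x + \<bar>sqrt (?p x) - sqrt (?q x)\<bar> * (e x * (sqrt (?p x) + sqrt (?q x))))"
        by (intro ennreal_leI) (simp add: algebra_simps)
      then show "ennreal (?p x) * ennreal (e x) \<le> ennreal (?q x) * ennreal (e x)
        + ennreal \<bar>sqrt (?p x) - sqrt (?q x)\<bar> * ennreal (e x * (sqrt (?p x) + sqrt (?q x)))"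
        using p0[of x] e0[of x] by (simp add: ennreal_mult[symmetric] ennreal_plus[symmetric] del: ennreal_plus)
    qed
    also have "\<dots> = (\<integral>\<^sup>+x. ennreal (?q x) * ennreal (e x) \<partial>lebd d) + I"
      unfolding I_def by (rule nn_integral_add) measurable
    also have "(\<integral>\<^sup>+x. ennreal (?q x) * ennreal (e x) \<partial>lebd d) = ennreal (mgf d k v b s)"
      unfolding e_def using v by (intro nn_integral_exp_gmix_density)
    finally have le: "ennreal (mgf d k w a s) \<le> ennreal (mgf d k v b s) + I" .
    have m1: "(\<integral>\<^sup>+x. ennreal (?p x) * ennreal (e2 x) \<partial>lebd d) = ennreal (mgf d k w a (\<lambda>i. 2 * s i))"
      unfolding e2_def by (rule nn_integral_exp_gmix_density) (rule w)
    have m2: "(\<integral>\<^sup>+x. ennreal (?q x) * ennreal (e2 x) \<partial>lebd d) = ennreal (mgf d k v b (\<lambda>i. 2 * s i))"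
      unfolding e2_def by (rule nn_integral_exp_gmix_density) (rule v)
    define H where "H = hellinger d ?p ?q"
    have H0: "0 \<le> H" by (simp add: H_def hellinger_def)
    have H2: "hellinger_sq d ?p ?q = ennreal (H\<^sup>2)"
    proof -
      have "hellinger_sq d ?p ?q < \<top>" using hellinger_sq_le[OF va vb] by (simp add: le_less_trans)
      then show ?thesis by (simp add: H_def hellinger_def hellinger_sq_def[symmetric])
    qed
    have "(\<integral>\<^sup>+x. (ennreal (e x * (sqrt (?p x) + sqrt (?q x))))\<^sup>2 \<partial>lebd d)
      \<le> (\<integral>\<^sup>+x. ennreal (2 * exp 1) * (ennreal (?p x) * ennreal (e2 x) + ennreal (?q x) * ennreal (e2 x)) \<partial>lebd d)"
    proof (intro nn_integral_mono)
      fix x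
      have "(sqrt (?p x) + sqrt (?q x))\<^sup>2 \<le> 2 * (?p x + ?q x)"
        using p0[of x] sum_squares_bound[of "sqrt (?p x)" "sqrt (?q x)"] by (simp add: power2_sum)
      then have "(e x)\<^sup>2 * (sqrt (?p x) + sqrt (?q x))\<^sup>2 \<le> (exp 1 * e2 x) * (2 * (?p x + ?q x))"
        using e_sq[of x] by (intro mult_mono) (auto simp: e2_def)
      then have "ennreal ((e x * (sqrt (?p x) + sqrt (?q x)))\<^sup>2) \<le> ennreal (2 * exp 1 * (?p x * e2 x + ?q x * e2 x))"
        by (intro ennreal_leI) (simp only: power_mult_distrib, simp add: algebra_simps)
      moreover have "0 \<le> e2 x" by (simp add: e2_def)
      ultimately show "(ennreal (e x * (sqrt (?p x) + sqrt (?q x))))\<^sup>2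
        \<le> ennreal (2 * exp 1) * (ennreal (?p x) * ennreal (e2 x) + ennreal (?q x) * ennreal (e2 x))"
        using p0[of x] e0[of x]
        by (simp add: ennreal_power ennreal_mult[symmetric] ennreal_plus[symmetric] del: ennreal_plus)
    qed
    also have "\<dots> = ennreal (2 * exp 1) * ((\<integral>\<^sup>+x. ennreal (?p x) * ennreal (e2 x) \<partial>lebd d) + (\<integral>\<^sup>+x. ennreal (?q x) * ennreal (e2 x) \<partial>lebd d))"
      by (subst nn_integral_cmult, measurable, subst nn_integral_add, auto)
    also have "\<dots> = ennreal (2 * exp 1) * (ennreal (mgf d k w a (\<lambda>i. 2 * s i)) + ennreal (mgf d k v b (\<lambda>i. 2 * s i)))"
      by (simp only: m1 m2)
    also have "\<dots> = ennreal (2 * exp 1 * (mgf d k w a (\<lambda>i. 2 * s i) + mgf d k v b (\<lambda>i. 2 * s i)))"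
      using w v by (simp add: mgf_nonneg ennreal_mult ennreal_plus[symmetric] del: ennreal_plus)
    also have "\<dots> \<le> ennreal (2 * exp 1 * (exp (2 * R) + exp (2 * R)))"
      using mgf_le[OF va R s2] mgf_le[OF vb R s2] by (intro ennreal_leI mult_left_mono add_mono) auto
    \<comment> \<open>Origin of the constant: 2 from
      \<open>(sqrt p + sqrt q)^2 \<le> 2 * (p + q)\<close>, \<open>exp 1\<close> from
      \<open>e_sq\<close>, and \<open>exp (2 * R)\<close> for each generating function at norm at
      most 2.\<close>
    also have "2 * exp 1 * (exp (2 * R) + exp (2 * R)) = (2 * exp (R + 1 / 2))\<^sup>2"
      by (simp add: power_mult_distrib exp_double[symmetric] exp_add[symmetric] algebra_simps)
    finally have G2: "(\<integral>\<^sup>+x. (ennreal (e x * (sqrt (?p x) + sqrt (?q x))))\<^sup>2 \<partial>lebd d) \<le> ennreal ((2 * exp (R + 1 / 2))\<^sup>2)" .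
    have "I\<^sup>2 \<le> (\<integral>\<^sup>+x. (ennreal \<bar>sqrt (?p x) - sqrt (?q x)\<bar>)\<^sup>2 \<partial>lebd d)
        * (\<integral>\<^sup>+x. (ennreal (e x * (sqrt (?p x) + sqrt (?q x))))\<^sup>2 \<partial>lebd d)"
      unfolding I_def by (rule Cauchy_Schwarz_nn_integral) measurable
    also have "(\<integral>\<^sup>+x. (ennreal \<bar>sqrt (?p x) - sqrt (?q x)\<bar>)\<^sup>2 \<partial>lebd d) = ennreal (H\<^sup>2)"
      unfolding H2[symmetric] hellinger_sq_def by (simp add: ennreal_power)
    also have "ennreal (H\<^sup>2) * (\<integral>\<^sup>+x. (ennreal (e x * (sqrt (?p x) + sqrt (?q x))))\<^sup>2 \<partial>lebd d)
      \<le> ennreal (H\<^sup>2) * ennreal ((2 * exp (R + 1 / 2))\<^sup>2)" using G2 by (intro mult_left_mono) auto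
    also have "\<dots> = ennreal ((2 * exp (R + 1 / 2) * H)\<^sup>2)"
      by (simp add: ennreal_mult[symmetric] power_mult_distrib mult.commute)
    finally have I2: "I\<^sup>2 \<le> ennreal ((2 * exp (R + 1 / 2) * H)\<^sup>2)" .
    have "I \<le> ennreal (2 * exp (R + 1 / 2) * H)"
    proof (cases I)
      case (real r)
      then have "r\<^sup>2 \<le> (2 * exp (R + 1 / 2) * H)\<^sup>2"
        using I2 by (simp add: ennreal_power)
      then show ?thesis using real H0 by (auto intro!: ennreal_leI power2_le_imp_le[of r])
    next
      case top
      then show ?thesis using I2 by (simp add: power2_eq_square ennreal_mult_top top_unique)
    qed
    then have "ennreal (mgf d k w a s) \<le> ennreal (mgf d k v b s) + ennreal (2 * exp (R + 1 / 2) * H)"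
      using le by (meson add_left_mono order_trans)
    also have "\<dots> = ennreal (mgf d k v b s + 2 * exp (R + 1 / 2) * H)"
      using v H0 by (intro ennreal_plus[symmetric]) (auto simp: mgf_nonneg)
    finally have "mgf d k w a s \<le> mgf d k v b s + 2 * exp (R + 1 / 2) * H"
      using v H0 by (subst (asm) ennreal_le_iff) (auto simp: mgf_nonneg)
    then show ?thesis by (simp add: H_def)
  qed
  have "hellinger d p q = hellinger d q p" for p q
    by (simp add: hellinger_def power2_commute)
  then show ?thesis using half[OF va vb] half[OF vb va] by (simp add: abs_le_iff)
qed

section \<open>The span of the estimated atoms\<close>

text \<open>Gram-Schmidt in which a vector with zero residual adds no row; hence \<open>m\<close>
  may be smaller than \<open>k\<close>, down to 0 when all vectors vanish.\<close>

lemma orthonormal_rows_spanning: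
  fixes v :: "nat \<Rightarrow> nat \<Rightarrow> real"
  shows "\<exists>m\<le>k. \<exists>b. orthonormal_rows m d b \<and>
    (\<forall>j<k. \<forall>i<d. v j i = (\<Sum>r<m. (\<Sum>l<d. b r l * v j l) * b r i))"
proof (induction k)
  case 0
  show ?case by (intro exI[of _ 0]) (auto simp: orthonormal_rows_def)
next
  case (Suc k)
  then obtain m b where m: "m \<le> k" and b: "orthonormal_rows m d b"
    and span: "\<And>j i. j < k \<Longrightarrow> i < d \<Longrightarrow> v j i = (\<Sum>r<m. (\<Sum>l<d. b r l * v j l) * b r i)"
    by blast
  define c where "c r = (\<Sum>l<d. b r l * v k l)" for r
  define u where "u i = v k i - (\<Sum>r<m. c r * b r i)" for i
  define N where "N = enorm d u"
  have ub: "(\<Sum>i<d. b r i * u i) = 0" if "r < m" for r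
  proof -
    have "(\<Sum>i<d. b r i * u i) = c r - (\<Sum>i<d. \<Sum>s<m. c s * (b r i * b s i))"
      by (simp add: u_def c_def right_diff_distrib sum_subtractf sum_distrib_left algebra_simps)
    also have "(\<Sum>i<d. \<Sum>s<m. c s * (b r i * b s i)) = (\<Sum>s<m. c s * (\<Sum>i<d. b r i * b s i))"
      by (subst sum.swap) (simp add: sum_distrib_left)
    also have "\<dots> = (\<Sum>s<m. if r = s then c s else 0)"
      using b that by (intro sum.cong) (auto simp: orthonormal_rows_def)
    finally show ?thesis using that by simp
  qed
  have combo: "(\<Sum>i<d. u i * (\<Sum>r<m. e r * b r i)) = 0" for e
  proof -
    have "(\<Sum>i<d. u i * (\<Sum>r<m. e r * b r i)) = (\<Sum>i<d. \<Sum>r<m. e r * (b r i * u i))"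
      by (simp add: sum_distrib_left algebra_simps)
    also have "\<dots> = (\<Sum>r<m. e r * (\<Sum>i<d. b r i * u i))"
      by (subst sum.swap) (simp add: sum_distrib_left)
    also have "\<dots> = 0" using ub by simp
    finally show ?thesis .
  qed
  have N2: "(\<Sum>i<d. u i * u i) = N\<^sup>2" unfolding N_def enorm_power2 by (simp add: power2_eq_square)
  show ?case
  proof (cases "N = 0")
    case True
    then have "u i = 0" if "i < d" for i
      using that N2 sum_nonneg_0[of "{..<d}" "\<lambda>i. u i * u i" i] by auto
    then have "v k i = (\<Sum>r<m. (\<Sum>l<d. b r l * v k l) * b r i)" if "i < d" for i
      using that by (auto simp: u_def c_def)
    then show ?thesis using m b span by (intro exI[of _ m]) (auto simp: less_Suc_eq)
  next
    case False
    \<comment> \<open>The new row is the normalized residual; by \<open>combo\<close> it is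
      orthogonal to all earlier vectors, so their expansions do not change.\<close>
    define b' where "b' = b(m := \<lambda>i. u i / N)"
    have b': "b' r = b r" if "r < m" for r using that by (simp add: b'_def)
    have b'm: "b' m = (\<lambda>i. u i / N)" by (simp add: b'_def)
    have "orthonormal_rows (Suc m) d b'"
      unfolding orthonormal_rows_def
    proof (intro allI impI)
      fix r s assume rs: "r < Suc m" "s < Suc m"
      consider "r < m" "s < m" | "r < m" "s = m" | "r = m" "s < m" | "r = m" "s = m" using rs by linarith
      then show "(\<Sum>i<d. b' r i * b' s i) = (if r = s then 1 else 0)"
      proof cases
        case 1 then show ?thesis using b b' by (simp add: orthonormal_rows_def)
      next
        case 2 then show ?thesis
          using ub[of r] by (simp add: b' b'm sum_divide_distrib[symmetric])
      next
        case 3 then show ?thesis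
          using ub[of s] by (simp add: b' b'm sum_divide_distrib[symmetric] mult.commute)
      next
        case 4 then show ?thesis
          using N2 False by (simp add: b'm sum_divide_distrib[symmetric] power2_eq_square)
      qed
    qed
    moreover have "v j i = (\<Sum>r<Suc m. (\<Sum>l<d. b' r l * v j l) * b' r i)" if j: "j < Suc k" and i: "i < d" for i j
    proof -
      have eq: "(\<Sum>r<Suc m. (\<Sum>l<d. b' r l * v j l) * b' r i)
        = (\<Sum>r<m. (\<Sum>l<d. b r l * v j l) * b r i) + (\<Sum>l<d. u l * v j l) / N * (u i / N)"
        by (simp add: b' b'm sum_divide_distrib)
      show ?thesis
      proof (cases "j < k")
        case True
        have "(\<Sum>l<d. u l * v j l) = (\<Sum>l<d. u l * (\<Sum>r<m. (\<Sum>l<d. b r l * v j l) * b r l))"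
          using span[OF True] by (intro sum.cong) auto
        then show ?thesis using combo eq span[OF True i] by simp
      next
        case False
        then have [simp]: "j = k" using j by simp
        have "(\<Sum>l<d. u l * v k l) = (\<Sum>l<d. u l * u l + u l * (\<Sum>r<m. c r * b r l))"
          by (intro sum.cong) (auto simp: u_def algebra_simps)
        then have "(\<Sum>l<d. u l * v k l) = N\<^sup>2" by (simp add: sum.distrib combo N2)
        then show ?thesis using \<open>N \<noteq> 0\<close> unfolding eq
          by (simp add: power2_eq_square u_def c_def)
      qed
    qed
    moreover have "Suc m \<le> Suc k" using m by simp
    ultimately show ?thesis by blast
  qed
qed

text \<open>\<open>|Bx|^2 = <x, B^T B x> \<le> |x| |Bx|\<close>, since \<open>B^T\<close> is
  isometric. Projected atoms therefore stay in the ball of radius \<open>R\<close>.\<close>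

lemma enorm_linmap_le:
  assumes "orthonormal_rows m d b"
  shows "enorm m (linmap m d b x) \<le> enorm d x"
proof -
  let ?y = "linmap m d b x"
  have "(enorm m ?y)\<^sup>2 = (\<Sum>i<d. x i * linmap d m (tr b) ?y i)"
    unfolding enorm_power2 unfolding power2_eq_square by (rule linmap_adjoint[symmetric])
  also have "\<dots> \<le> enorm d x * enorm m ?y"
    using abs_dot_le_enorm[of x "linmap d m (tr b) ?y" d] enorm_linmap_tr[OF assms, of ?y] by simp
  finally have "enorm m ?y * enorm m ?y \<le> enorm d x * enorm m ?y" by (simp add: power2_eq_square)
  then show ?thesis using enorm_nonneg[of m ?y] enorm_nonneg[of d x]
    by (cases "enorm m ?y = 0") (auto simp: mult_le_cancel_right)
qed

lemma valid_params_linmap: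
  assumes "valid_params d k R w a" "orthonormal_rows m d b"
  shows "valid_params m k R w (\<lambda>j. linmap m d b (a j))"
  using assms enorm_linmap_le[OF assms(2)] by (auto simp: valid_params_def intro: order_trans)

text \<open>For \<open>x \<ge> 0\<close> add \<open>exp x \<ge> 1 + x + x^2 / 2\<close> and
  \<open>exp (-x) \<ge> 1 - x\<close>. Using both signs cancels the linear term, so that generating
  functions near 1 force small second moments.\<close>

lemma sq_le_exp_add_exp:
  fixes x :: real
  shows "x\<^sup>2 / 2 \<le> exp x + exp (- x) - 2"
proof -
  have "x\<^sup>2 / 2 \<le> exp x + exp (- x) - 2" if "0 \<le> x" for x :: real
    using exp_lower_Taylor_quadratic[OF that] exp_ge_add_one_self[of "- x"] by simp
  from this[of x] this[of "- x"] show ?thesis by (cases "0 \<le> x") (auto simp: add.commute)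
qed

text \<open>If \<open>\<Gamma>'\<close> lives on the row space of \<open>b\<close>, then in any direction orthogonal to it the generating
  function of \<open>\<Gamma>'\<close> is \<open>1\<close>, so that of \<open>\<Gamma>\<close> is within \<open>h\<close> of \<open>1\<close> and controls second moments.\<close>

lemma projection_residual:
  assumes va: "valid_params d k R w a" and vb: "valid_params d k R v c"
    and b: "orthonormal_rows m d b"
    and span: "\<And>j i. j < k \<Longrightarrow> i < d \<Longrightarrow> c j i = (\<Sum>r<m. (\<Sum>l<d. b r l * c j l) * b r i)"
    and h: "\<And>s. enorm d s \<le> 1 \<Longrightarrow> \<bar>mgf d k v c s - mgf d k w a s\<bar> \<le> h"
  shows "(\<Sum>j<k. w j * edist d (linmap d m (tr b) (linmap m d b (a j))) (a j)) \<le> 2 * real k * sqrt h"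
proof -
  have w0: "0 \<le> w j" if "j < k" for j using va that by (simp add: valid_params_def)
  have w1: "w j \<le> 1" if "j < k" for j
    using va that member_le_sum[of j "{..<k}" w] by (auto simp: valid_params_def)
  have h0: "0 \<le> h" using h[of "\<lambda>_. 0"] by (auto simp: enorm_def)
  have "w j * edist d (linmap d m (tr b) (linmap m d b (a j))) (a j) \<le> 2 * sqrt h" if j: "j < k" for j
  proof -
    define P where "P = linmap d m (tr b) (linmap m d b (a j))"
    define u where "u i = a j i - P i" for i
    define N where "N = edist d P (a j)"
    have N: "N = enorm d u" by (simp add: N_def edist_def u_def enorm_def power2_commute)
    show ?thesis
    proof (cases "N = 0")
      case True then show ?thesis using h0 by (simp add: N_def P_def)
    next
      case False
      then have Npos: "0 < N" using enorm_nonneg[of d u] N by simp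
      have Bu: "(\<Sum>i<d. b r i * u i) = 0" if "r < m" for r
        using linmap_tr_inverse[OF b that, of "linmap m d b (a j)"] that
        by (simp add: u_def P_def right_diff_distrib sum_subtractf linmap_def[of m d b])
      have combo: "(\<Sum>i<d. u i * (\<Sum>r<m. e r * b r i)) = 0" for e
      proof -
        have "(\<Sum>i<d. u i * (\<Sum>r<m. e r * b r i)) = (\<Sum>i<d. \<Sum>r<m. e r * (b r i * u i))"
          by (simp add: sum_distrib_left algebra_simps)
        also have "\<dots> = (\<Sum>r<m. e r * (\<Sum>i<d. b r i * u i))"
          by (subst sum.swap) (simp add: sum_distrib_left)
        also have "\<dots> = 0" using Bu by simp
        finally show ?thesis .
      qed
      have uc: "(\<Sum>i<d. u i * c l i) = 0" if "l < k" for l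
      proof -
        have "(\<Sum>i<d. u i * c l i) = (\<Sum>i<d. u i * (\<Sum>r<m. (\<Sum>i<d. b r i * c l i) * b r i))"
          using span[OF that] by (intro sum.cong) auto
        then show ?thesis using combo by simp
      qed
      have uP: "(\<Sum>i<d. u i * P i) = 0"
        using combo[of "linmap m d b (a j)"] by (simp add: P_def linmap_def[of d m] mult.commute)
      have "(\<Sum>i<d. u i * a j i) = (\<Sum>i<d. u i * u i + u i * P i)"
        by (intro sum.cong) (auto simp: u_def algebra_simps)
      then have ua: "(\<Sum>i<d. u i * a j i) = N\<^sup>2"
        using uP enorm_power2[of d u] by (simp add: N sum.distrib power2_eq_square)
      \<comment> \<open>The test direction is the normalized residual of this particular atom. Each
        atom has its own direction, whence the factor \<open>k\<close> in the final sum.\<close>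
      define s where "s i = u i / N" for i
      have sd: "(\<Sum>i<d. s i * x i) = (\<Sum>i<d. u i * x i) / N" for x
        by (simp add: s_def sum_divide_distrib)
      have ns: "enorm d s = 1" "enorm d (\<lambda>i. - s i) = 1"
        using enorm_scale[of d "1 / N" u] enorm_scale[of d "- 1 / N" u] Npos N by (auto simp: s_def[abs_def])
      have "mgf d k v c s = (\<Sum>j<k. v j)" "mgf d k v c (\<lambda>i. - s i) = (\<Sum>j<k. v j)"
        unfolding mgf_def by (intro sum.cong refl; simp add: sum_negf sd uc)+
      then have "mgf d k v c s = 1" "mgf d k v c (\<lambda>i. - s i) = 1"
        using vb by (auto simp: valid_params_def)
      then have up: "mgf d k w a s + mgf d k w a (\<lambda>i. - s i) \<le> 2 + 2 * h"
        using h[of s] h[of "\<lambda>i. - s i"] ns by simp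
      have "w j * (N\<^sup>2 / 2) = w j * ((\<Sum>i<d. s i * a j i)\<^sup>2 / 2)"
        using Npos by (simp add: sd ua power2_eq_square)
      also have "\<dots> \<le> (\<Sum>l<k. w l * ((\<Sum>i<d. s i * a l i)\<^sup>2 / 2))"
        using j w0 by (intro member_le_sum) auto
      also have "\<dots> \<le> (\<Sum>l<k. w l * (exp (\<Sum>i<d. s i * a l i) + exp (- (\<Sum>i<d. s i * a l i)) - 2))"
        using w0 by (intro sum_mono mult_left_mono sq_le_exp_add_exp) auto
      also have "\<dots> = mgf d k w a s + mgf d k w a (\<lambda>i. - s i) - 2"
        using va by (simp add: mgf_def valid_params_def right_diff_distrib distrib_left sum.distrib
            sum_subtractf sum_negf sum_distrib_right[symmetric])
      also have "\<dots> \<le> 2 * h" using up by simp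
      finally have wN: "w j * N\<^sup>2 \<le> 4 * h" by simp
      \<comment> \<open>What is controlled is \<open>w j * N^2\<close>. Since
        \<open>w j \<le> 1\<close> it dominates \<open>(w j * N)^2\<close>, and the root gives a
        multiple of \<open>sqrt h\<close> however small the weight is.\<close>
      have "(w j * N)\<^sup>2 = w j * (w j * N\<^sup>2)" by (simp add: power2_eq_square)
      also have "\<dots> \<le> 1 * (w j * N\<^sup>2)" using w0[OF j] w1[OF j] by (intro mult_right_mono) auto
      finally have "(w j * N)\<^sup>2 \<le> (2 * sqrt h)\<^sup>2" using wN h0 by (simp add: power_mult_distrib)
      then have "w j * N \<le> 2 * sqrt h" by (rule power2_le_imp_le) (simp add: h0)
      then show ?thesis by (simp add: N_def P_def)
    qed
  qed
  then have "(\<Sum>j<k. w j * edist d (linmap d m (tr b) (linmap m d b (a j))) (a j)) \<le> (\<Sum>j<k. 2 * sqrt h)"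
    by (intro sum_mono) auto
  then show ?thesis by simp
qed

section \<open>A countable dense set of parameters\<close>

text \<open>Two properties matter: generating functions on the unit ball are Lipschitz for it, and
  it depends continuously on finitely many coordinates, so its balls are open in the product
  topology.\<close>

definition param_dist :: "nat \<Rightarrow> nat \<Rightarrow> (nat \<Rightarrow> real) \<Rightarrow> (nat \<Rightarrow> nat \<Rightarrow> real) \<Rightarrow> (nat \<Rightarrow> real) \<Rightarrow> (nat \<Rightarrow> nat \<Rightarrow> real) \<Rightarrow> real" where
  "param_dist d k w a v b = (\<Sum>j<k. \<bar>w j - v j\<bar> + (\<Sum>i<d. \<bar>a j i - b j i\<bar>))"

lemma abs_exp_diff_le:
  fixes x y :: real
  assumes "\<bar>x\<bar> \<le> R" "\<bar>y\<bar> \<le> R"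
  shows "\<bar>exp x - exp y\<bar> \<le> exp R * \<bar>x - y\<bar>"
proof -
  have *: "exp x - exp y \<le> exp R * (x - y)" if "y \<le> x" "\<bar>x\<bar> \<le> R" for x y
  proof -
    have "exp x - exp y = exp x * (1 - exp (y - x))" by (simp add: right_diff_distrib exp_add[symmetric])
    also have "1 - exp (y - x) \<le> x - y" using exp_ge_add_one_self[of "y - x"] by linarith
    then have "exp x * (1 - exp (y - x)) \<le> exp x * (x - y)" by (rule mult_left_mono) simp
    also have "\<dots> \<le> exp R * (x - y)" using that by (intro mult_right_mono) auto
    finally show ?thesis .
  qed
  show ?thesis using *[of x y] *[of y x] assms by (cases "x \<le> y") (auto simp: abs_if)
qed

lemma mgf_diff_le_param_dist:
  assumes va: "valid_params d k R w a" and vb: "valid_params d k R v b" and R: "0 < R" and s: "enorm d s \<le> 1"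
  shows "\<bar>mgf d k w a s - mgf d k v b s\<bar> \<le> exp R * param_dist d k w a v b"
proof -
  have bound: "\<bar>\<Sum>i<d. s i * x i\<bar> \<le> enorm d x" for x
    using abs_dot_le_enorm[of s x d] mult_right_mono[OF s enorm_nonneg[of d x]] by simp
  have "\<bar>w j * exp (\<Sum>i<d. s i * a j i) - v j * exp (\<Sum>i<d. s i * b j i)\<bar>
    \<le> exp R * (\<bar>w j - v j\<bar> + (\<Sum>i<d. \<bar>a j i - b j i\<bar>))" if j: "j < k" for j
  proof -
    let ?x = "\<Sum>i<d. s i * a j i" and ?y = "\<Sum>i<d. s i * b j i"
    have xy: "\<bar>?x\<bar> \<le> R" "\<bar>?y\<bar> \<le> R"
      using bound[of "a j"] bound[of "b j"] va vb j by (auto simp: valid_params_def intro: order_trans)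
    have v: "0 \<le> v j" "v j \<le> 1"
      using vb j member_le_sum[of j "{..<k}" v] by (auto simp: valid_params_def)
    have "\<bar>w j * exp ?x - v j * exp ?y\<bar> = \<bar>(w j - v j) * exp ?x + v j * (exp ?x - exp ?y)\<bar>"
      by (simp add: algebra_simps)
    also have "\<dots> \<le> \<bar>w j - v j\<bar> * exp ?x + v j * \<bar>exp ?x - exp ?y\<bar>"
      using v by (intro order_trans[OF abs_triangle_ineq]) (simp add: abs_mult)
    also have "\<dots> \<le> \<bar>w j - v j\<bar> * exp R + 1 * (exp R * \<bar>?x - ?y\<bar>)"
      using xy v abs_exp_diff_le[OF xy] by (intro add_mono mult_mono) auto
    also have "\<bar>?x - ?y\<bar> \<le> enorm d (\<lambda>i. a j i - b j i)"
      using bound[of "\<lambda>i. a j i - b j i"] by (simp add: right_diff_distrib sum_subtractf)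
    also have "\<dots> \<le> (\<Sum>i<d. \<bar>a j i - b j i\<bar>)"
      unfolding enorm_eq_L2_set by (rule L2_set_le_sum_abs)
    finally show ?thesis by (simp add: algebra_simps)
  qed
  then have "(\<Sum>j<k. \<bar>w j * exp (\<Sum>i<d. s i * a j i) - v j * exp (\<Sum>i<d. s i * b j i)\<bar>)
    \<le> exp R * param_dist d k w a v b"
    unfolding param_dist_def sum_distrib_left by (intro sum_mono) auto
  moreover have "\<bar>mgf d k w a s - mgf d k v b s\<bar>
    \<le> (\<Sum>j<k. \<bar>w j * exp (\<Sum>i<d. s i * a j i) - v j * exp (\<Sum>i<d. s i * b j i)\<bar>)"
    unfolding mgf_def sum_subtractf[symmetric] by (rule sum_abs)
  ultimately show ?thesis by linarith
qed

text \<open>The valid parameters are a subset of a separable, metrizable product space and have a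
  countable dense subset of their own, so the approximating points are valid too. The given
  \<open>w0\<close>, \<open>a0\<close> make it nonempty, hence enumerable by a sequence.\<close>

lemma dense_valid_params:
  assumes "valid_params d k R w0 a0"
  shows "\<exists>(V :: nat \<Rightarrow> nat \<Rightarrow> real) U. (\<forall>l. valid_params d k R (V l) (U l)) \<and>
    (\<forall>w a \<eta>. valid_params d k R w a \<longrightarrow> 0 < \<eta> \<longrightarrow> (\<exists>l. param_dist d k w a (V l) (U l) < \<eta>))"
proof -
  define S where "S = {p. valid_params d k R (fst p) (snd p)}"
  obtain D where D: "countable D" "D \<subseteq> S" "S \<subseteq> closure D" using separable[of S] by blast
  have "S \<noteq> {}" using assms by (auto simp: S_def)
  then have ne: "D \<noteq> {}" using D(3) by auto
  define V where "V l = fst (from_nat_into D l)" for l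
  define U where "U l = snd (from_nat_into D l)" for l
  have "valid_params d k R (V l) (U l)" for l
    using from_nat_into[OF ne, of l] D(2) by (auto simp: V_def U_def S_def)
  moreover have "\<exists>l. param_dist d k w a (V l) (U l) < \<eta>" if "valid_params d k R w a" "0 < \<eta>" for w a \<eta>
  proof -
    have c1: "continuous_on UNIV (\<lambda>p :: (nat \<Rightarrow> real) \<times> (nat \<Rightarrow> nat \<Rightarrow> real). fst p j)" for j
      by (rule continuous_on_product_then_coordinatewise[OF continuous_on_fst[OF continuous_on_id]])
    have c2: "continuous_on UNIV (\<lambda>p :: (nat \<Rightarrow> real) \<times> (nat \<Rightarrow> nat \<Rightarrow> real). snd p j i)" for j i
      by (rule continuous_on_product_then_coordinatewise[OF
            continuous_on_product_then_coordinatewise[OF continuous_on_snd[OF continuous_on_id]]])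
    have cont: "continuous_on UNIV (\<lambda>p. param_dist d k w a (fst p) (snd p))"
      unfolding param_dist_def
      by (intro continuous_on_sum continuous_on_add continuous_on_rabs continuous_on_diff continuous_on_const c1 c2)
    define O' where "O' = {p. param_dist d k w a (fst p) (snd p) < \<eta>}"
    have "open O'" unfolding O'_def using cont by (intro open_Collect_less continuous_on_const)
    moreover have "(w, a) \<in> O'" using that by (simp add: O'_def param_dist_def)
    moreover have "(w, a) \<in> closure D" using D(3) that by (auto simp: S_def)
    ultimately obtain p where p: "p \<in> D" "p \<in> O'"
      using open_Int_closure_eq_empty[of O' D] by auto
    then have "from_nat_into D (to_nat_on D p) = p" using D(1) by simp
    then show ?thesis using p by (intro exI[of _ "to_nat_on D p"]) (simp add: V_def U_def O'_def)
  qed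
  ultimately show ?thesis by blast
qed

section \<open>Quantized estimators\<close>

lemma sets_samples_PGamma[measurable_cong, simp]:
  "sets (samples n (PGamma d k w a)) = sets (samples n (Rd d))"
  unfolding samples_def by (rule sets_PiM_cong) auto

lemma space_samples_PGamma[simp]:
  "space (samples n (PGamma d k w a)) = space (samples n (Rd d))"
  by (rule sets_eq_imp_space_eq) simp

lemma space_samples_Rd: "space (samples n (Rd d)) = PiE {..<n} (\<lambda>_. space (Rd d))"
  by (simp add: samples_def space_PiM)

lemma space_samples_Rd_nonempty: "(\<lambda>i\<in>{..<n}. \<lambda>j\<in>{..<d}. 0) \<in> space (samples n (Rd d))"
  by (simp add: space_samples_Rd space_Rd)

lemma prob_space_samples_PGamma:
  assumes "valid_params d k R w a"
  shows "prob_space (samples n (PGamma d k w a))"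
  unfolding samples_def using assms
  by (intro prob_space_PiM prob_space_PGamma) (auto simp: valid_params_def)

lemma measurable_hellinger_estimator:
  assumes W: "\<And>j. (\<lambda>X. W X j) \<in> borel_measurable M"
    and A: "\<And>j i. (\<lambda>X. A X j i) \<in> borel_measurable M"
  shows "(\<lambda>X. hellinger d (gmix_density d k (W X) (A X)) (gmix_density d k w a)) \<in> borel_measurable M"
proof -
  interpret sigma_finite_measure "lebd d" by (rule sigma_finite_lebd)
  have "(\<lambda>p. gmix_density d k (W (fst p)) (A (fst p)) (snd p)) \<in> borel_measurable (M \<Otimes>\<^sub>M Rd d)"
    unfolding gmix_density_def
    by (intro borel_measurable_sum borel_measurable_times borel_measurable_prod
        measurable_compose[OF _ borel_measurable_normal_density] borel_measurable_diff
        measurable_compose[OF measurable_fst W] measurable_compose[OF measurable_fst A]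
        measurable_compose[OF measurable_snd measurable_Rd_component]) auto
  note this[measurable]
  have "(\<lambda>X. \<integral>\<^sup>+ x. ennreal ((sqrt (gmix_density d k (W X) (A X) x) - sqrt (gmix_density d k w a x))\<^sup>2) \<partial>lebd d)
    \<in> borel_measurable M"
    by (rule borel_measurable_nn_integral) (simp add: case_prod_unfold)
  note this[measurable]
  show ?thesis unfolding hellinger_def by measurable
qed

lemma hellinger_nonneg: "0 \<le> hellinger d p q"
  by (simp add: hellinger_def)

text \<open>An estimator is replaced by a measurable index into a countable list; a basis chosen
  later may then depend on the index arbitrarily without harming measurability. The error is handed
  on as one measurable function \<open>h\<close> valid for all \<open>s\<close> at once, because
  later arguments see only generating functions.\<close>

lemma exists_quantized_estimator:
  fixes W :: "(nat \<Rightarrow> nat \<Rightarrow> real) \<Rightarrow> nat \<Rightarrow> real" and A :: "(nat \<Rightarrow> nat \<Rightarrow> real) \<Rightarrow> nat \<Rightarrow> nat \<Rightarrow> real"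
  assumes R: "R > 0" and \<eta>: "\<eta> > 0"
    and valid: "\<And>X. X \<in> space (samples n (Rd m)) \<Longrightarrow> valid_params m k R (W X) (A X)"
    and W: "\<And>j. (\<lambda>X. W X j) \<in> borel_measurable (samples n (Rd m))"
    and A: "\<And>j i. (\<lambda>X. A X j i) \<in> borel_measurable (samples n (Rd m))"
    and risk: "\<And>w a. valid_params m k R w a \<Longrightarrow>
       (\<integral>\<^sup>+ X. ennreal (hellinger m (gmix_density m k (W X) (A X)) (gmix_density m k w a))
          \<partial>samples n (PGamma m k w a)) \<le> ennreal c"
    and c: "0 \<le> c"
  shows "\<exists>(g :: (nat \<Rightarrow> nat \<Rightarrow> real) \<Rightarrow> nat) V U. g \<in> measurable (samples n (Rd m)) (count_space UNIV)
    \<and> (\<forall>l. valid_params m k R (V l) (U l))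
    \<and> (\<forall>w a. valid_params m k R w a \<longrightarrow> (\<exists>h \<in> borel_measurable (samples n (Rd m)).
        (\<forall>X\<in>space (samples n (Rd m)). 0 \<le> h X
          \<and> (\<forall>s. enorm m s \<le> 1 \<longrightarrow> \<bar>mgf m k (V (g X)) (U (g X)) s - mgf m k w a s\<bar> \<le> h X))
        \<and> (\<integral>\<^sup>+ X. ennreal (h X) \<partial>samples n (PGamma m k w a)) \<le> ennreal (2 * exp (R + 1 / 2) * c + \<eta>)))"
proof -
  obtain V :: "nat \<Rightarrow> nat \<Rightarrow> real" and U where VU: "\<And>l. valid_params m k R (V l) (U l)"
    and dense: "\<And>w a \<epsilon>. valid_params m k R w a \<Longrightarrow> 0 < \<epsilon> \<Longrightarrow> \<exists>l. param_dist m k w a (V l) (U l) < \<epsilon>"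
    using dense_valid_params[OF valid[OF space_samples_Rd_nonempty]] by blast
  \<comment> \<open>Rounding within \<open>\<epsilon>\<close> moves generating functions by at most
    \<open>exp R * \<epsilon> = \<eta>\<close>.\<close>
  define \<epsilon> where "\<epsilon> = \<eta> / exp R"
  have \<epsilon>: "0 < \<epsilon>" using \<eta> by (simp add: \<epsilon>_def)
  \<comment> \<open>Taking the least admissible index makes the choice measurable.\<close>
  define g where "g X = (LEAST l. param_dist m k (W X) (A X) (V l) (U l) < \<epsilon>)" for X
  note W[measurable] A[measurable]
  have g: "g \<in> measurable (samples n (Rd m)) (count_space UNIV)"
    unfolding g_def[abs_def] param_dist_def by measurable
  have close: "param_dist m k (W X) (A X) (V (g X)) (U (g X)) < \<epsilon>" if "X \<in> space (samples n (Rd m))" for X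
    unfolding g_def using dense[OF valid[OF that] \<epsilon>] by (rule LeastI_ex)
  have "\<exists>h \<in> borel_measurable (samples n (Rd m)).
        (\<forall>X\<in>space (samples n (Rd m)). 0 \<le> h X
          \<and> (\<forall>s. enorm m s \<le> 1 \<longrightarrow> \<bar>mgf m k (V (g X)) (U (g X)) s - mgf m k w a s\<bar> \<le> h X))
        \<and> (\<integral>\<^sup>+ X. ennreal (h X) \<partial>samples n (PGamma m k w a)) \<le> ennreal (2 * exp (R + 1 / 2) * c + \<eta>)"
    if wa: "valid_params m k R w a" for w a
  proof -
    define H where "H X = hellinger m (gmix_density m k (W X) (A X)) (gmix_density m k w a)" for X
    have H[measurable]: "H \<in> borel_measurable (samples n (Rd m))"
      unfolding H_def[abs_def] by (rule measurable_hellinger_estimator[OF W A])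
    have H0: "0 \<le> H X" for X by (simp add: H_def hellinger_nonneg)
    define h where "h X = 2 * exp (R + 1 / 2) * H X + \<eta>" for X
    interpret prob_space "samples n (PGamma m k w a)" by (rule prob_space_samples_PGamma[OF wa])
    have "h \<in> borel_measurable (samples n (Rd m))" unfolding h_def[abs_def] by measurable
    moreover have "0 \<le> h X" for X using H0[of X] \<eta> by (simp add: h_def)
    moreover have "\<bar>mgf m k (V (g X)) (U (g X)) s - mgf m k w a s\<bar> \<le> h X"
      if X: "X \<in> space (samples n (Rd m))" and s: "enorm m s \<le> 1" for X s
    proof -
      have "\<bar>mgf m k (W X) (A X) s - mgf m k (V (g X)) (U (g X)) s\<bar> \<le> exp R * \<epsilon>"
        using mgf_diff_le_param_dist[OF valid[OF X] VU R s, of "g X"] close[OF X]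
        by (meson mult_left_mono less_imp_le exp_ge_zero order_trans)
      moreover have "exp R * \<epsilon> = \<eta>" by (simp add: \<epsilon>_def)
      moreover have "\<bar>mgf m k (W X) (A X) s - mgf m k w a s\<bar> \<le> 2 * exp (R + 1 / 2) * H X"
        unfolding H_def by (rule mgf_diff_le_hellinger[OF valid[OF X] wa R s])
      ultimately show ?thesis by (simp add: h_def)
    qed
    moreover have "(\<integral>\<^sup>+ X. ennreal (h X) \<partial>samples n (PGamma m k w a)) \<le> ennreal (2 * exp (R + 1 / 2) * c + \<eta>)"
    proof -
      have "(\<integral>\<^sup>+ X. ennreal (h X) \<partial>samples n (PGamma m k w a))
        = (\<integral>\<^sup>+ X. ennreal (2 * exp (R + 1 / 2)) * ennreal (H X) + ennreal \<eta> \<partial>samples n (PGamma m k w a))"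
        using H0 \<eta> by (intro nn_integral_cong) (simp add: h_def ennreal_mult[symmetric] ennreal_plus[symmetric] del: ennreal_plus)
      also have "\<dots> = ennreal (2 * exp (R + 1 / 2)) * (\<integral>\<^sup>+ X. ennreal (H X) \<partial>samples n (PGamma m k w a)) + ennreal \<eta>"
        by (subst nn_integral_add, measurable, measurable, subst nn_integral_cmult, measurable) (simp add: emeasure_space_1 del: space_samples_PGamma)
      also have "\<dots> \<le> ennreal (2 * exp (R + 1 / 2)) * ennreal c + ennreal \<eta>"
        using risk[OF wa] unfolding H_def by (intro add_right_mono mult_left_mono) auto
      also have "\<dots> = ennreal (2 * exp (R + 1 / 2) * c + \<eta>)"
        using c \<eta> by (simp add: ennreal_mult[symmetric] ennreal_plus[symmetric] del: ennreal_plus)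
      finally show ?thesis .
    qed
    ultimately show ?thesis by blast
  qed
  then show ?thesis using g VU by blast
qed

section \<open>Expectations of fractional powers\<close>

text \<open>The right-hand side is the tangent at \<open>c\<close> of the concave function
  \<open>x powr p\<close>.\<close>

lemma powr_le_linear:
  fixes x c p :: real
  assumes "0 \<le> x" "0 < c" "0 < p" "p \<le> 1"
  shows "x powr p \<le> c powr p * (p * (x / c) + (1 - p))"
proof (cases "x = 0")
  case True then show ?thesis using assms by simp
next
  case False
  have "(x / c) powr p * 1 powr (1 - p) \<le> p * (x / c) + (1 - p) * 1"
    using assms False by (intro Youngs_inequality_0) auto
  then have "c powr p * (x / c) powr p \<le> c powr p * (p * (x / c) + (1 - p))"
    using assms by (intro mult_left_mono) auto
  moreover have "c powr p * (x / c) powr p = x powr p"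
    using assms by (simp add: powr_mult[symmetric])
  ultimately show ?thesis by simp
qed

text \<open>Jensen for a concave power, by integrating the tangent at the bound \<open>c\<close> for
  the mean instead of at the mean. The condition \<open>0 < c\<close> is one reason why the
  positivity of the Hellinger rate is proved below.\<close>

lemma (in prob_space) nn_integral_powr_le:
  fixes f :: "'a \<Rightarrow> real"
  assumes f[measurable]: "f \<in> borel_measurable M" and f0: "\<And>x. x \<in> space M \<Longrightarrow> 0 \<le> f x"
    and p: "0 < p" "p \<le> 1" and c: "0 < c" and le: "(\<integral>\<^sup>+x. ennreal (f x) \<partial>M) \<le> ennreal c"
  shows "(\<integral>\<^sup>+x. ennreal (f x powr p) \<partial>M) \<le> ennreal (c powr p)"
proof -
  have "(\<integral>\<^sup>+x. ennreal (f x powr p) \<partial>M)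
    \<le> (\<integral>\<^sup>+x. ennreal (c powr p * p / c) * ennreal (f x) + ennreal (c powr p * (1 - p)) \<partial>M)"
  proof (rule nn_integral_mono)
    fix x assume "x \<in> space M"
    then have "f x powr p \<le> c powr p * p / c * f x + c powr p * (1 - p)"
      using powr_le_linear[OF f0 c p, of x] by (simp add: algebra_simps)
    then show "ennreal (f x powr p) \<le> ennreal (c powr p * p / c) * ennreal (f x) + ennreal (c powr p * (1 - p))"
      using f0[OF \<open>x \<in> space M\<close>] p c
      by (simp add: ennreal_mult[symmetric] ennreal_plus[symmetric] ennreal_leI del: ennreal_plus)
  qed
  also have "\<dots> = ennreal (c powr p * p / c) * (\<integral>\<^sup>+x. ennreal (f x) \<partial>M) + ennreal (c powr p * (1 - p))"
    by (subst nn_integral_add, measurable, measurable, subst nn_integral_cmult, measurable) (simp add: emeasure_space_1)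
  also have "\<dots> \<le> ennreal (c powr p * p / c) * ennreal c + ennreal (c powr p * (1 - p))"
    using le by (intro add_right_mono mult_left_mono) auto
  also have "\<dots> = ennreal (c powr p)"
    using c p by (simp add: ennreal_mult[symmetric] ennreal_plus[symmetric] algebra_simps del: ennreal_plus)
  finally show ?thesis .
qed

section \<open>Sample densities and positivity of the rate\<close>

lemma gmix_density_pos:
  assumes "valid_params d k R w a"
  shows "0 < gmix_density d k w a x"
proof -
  have w: "0 \<le> w j" if "j < k" for j using assms that by (simp add: valid_params_def)
  have "\<exists>j<k. 0 < w j"
  proof (rule ccontr)
    assume "\<not> (\<exists>j<k. 0 < w j)"
    then have "(\<Sum>j<k. w j) \<le> 0" by (intro sum_nonpos) (meson lessThan_iff not_le_imp_less)
    then show False using assms by (simp add: valid_params_def)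
  qed
  then obtain j where "j < k" "0 < w j" by blast
  then show ?thesis
    unfolding gmix_density_eq using w normal_prod_pos
    by (intro sum_pos2[of _ j]) (auto intro!: mult_nonneg_nonneg simp: less_imp_le)
qed

lemma samples_PGamma_eq_density:
  assumes va: "valid_params d k R w a"
  shows "samples n (PGamma d k w a)
    = density (PiM {..<n} (\<lambda>_. lebd d)) (\<lambda>X. \<Prod>i<n. ennreal (gmix_density d k w a (X i)))"
proof -
  interpret P: prob_space "PGamma d k w a"
    using va by (intro prob_space_PGamma) (auto simp: valid_params_def)
  interpret PP: product_sigma_finite "\<lambda>_::nat. PGamma d k w a" by standard
  interpret LL: product_sigma_finite "\<lambda>_::nat. lebd d"
    using sigma_finite_lebd by (simp add: product_sigma_finite_def)
  let ?f = "gmix_density d k w a"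
  have mf: "(\<lambda>X. \<Prod>i<n. ennreal (?f (X i))) \<in> borel_measurable (PiM {..<n} (\<lambda>_. lebd d))"
    by (intro borel_measurable_prod_ennreal measurable_compose[OF measurable_component_singleton]) auto
  have "density (PiM {..<n} (\<lambda>_. lebd d)) (\<lambda>X. \<Prod>i<n. ennreal (?f (X i))) = PiM {..<n} (\<lambda>_. PGamma d k w a)"
  proof (rule PP.PiM_eqI)
    show "sets (density (PiM {..<n} (\<lambda>_. lebd d)) (\<lambda>X. \<Prod>i<n. ennreal (?f (X i)))) = sets (PiM {..<n} (\<lambda>_. PGamma d k w a))"
      by (simp, rule sets_PiM_cong) auto
    fix A assume "\<And>i. i \<in> {..<n} \<Longrightarrow> A i \<in> sets (PGamma d k w a)"
    then have A[measurable]: "A i \<in> sets (Rd d)" if "i < n" for i using that by simp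
    have ind: "indicator (PiE {..<n} A) X = (\<Prod>i<n. indicator (A i) (X i) :: ennreal)"
      if "X \<in> space (PiM {..<n} (\<lambda>_. lebd d))" for X
      using that by (auto simp: indicator_def PiE_iff space_PiM intro!: prod.neutral)
    have "emeasure (density (PiM {..<n} (\<lambda>_. lebd d)) (\<lambda>X. \<Prod>i<n. ennreal (?f (X i)))) (PiE {..<n} A)
      = (\<integral>\<^sup>+X. (\<Prod>i<n. ennreal (?f (X i))) * indicator (PiE {..<n} A) X \<partial>PiM {..<n} (\<lambda>_. lebd d))"
      using A by (intro emeasure_density mf sets_PiM_I_finite) auto
    also have "\<dots> = (\<integral>\<^sup>+X. (\<Prod>i<n. ennreal (?f (X i)) * indicator (A i) (X i)) \<partial>PiM {..<n} (\<lambda>_. lebd d))"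
      by (intro nn_integral_cong) (simp add: ind prod.distrib)
    also have "\<dots> = (\<Prod>i<n. \<integral>\<^sup>+x. ennreal (?f x) * indicator (A i) x \<partial>lebd d)"
      using A by (intro LL.product_nn_integral_prod) auto
    also have "\<dots> = (\<Prod>i<n. emeasure (PGamma d k w a) (A i))"
      unfolding PGamma_def using A by (intro prod.cong refl emeasure_density[symmetric]) auto
    finally show "emeasure (density (PiM {..<n} (\<lambda>_. lebd d)) (\<lambda>X. \<Prod>i<n. ennreal (?f (X i)))) (PiE {..<n} A)
      = (\<Prod>i<n. emeasure (PGamma d k w a) (A i))" .
  qed simp
  then show ?thesis by (simp add: samples_def)
qed

text \<open>The product density is positive everywhere, so the null sets of the sample law are those
  of Lebesgue measure and do not depend on the parameters.\<close>

lemma AE_samples_PGamma_iff: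
  assumes "valid_params d k R w a"
  shows "(AE X in samples n (PGamma d k w a). P X) \<longleftrightarrow> (AE X in PiM {..<n} (\<lambda>_. lebd d). P X)"
proof -
  have "(\<lambda>X. \<Prod>i<n. ennreal (gmix_density d k w a (X i))) \<in> borel_measurable (PiM {..<n} (\<lambda>_. lebd d))"
    by (intro borel_measurable_prod_ennreal measurable_compose[OF measurable_component_singleton]) auto
  moreover have "0 < (\<Prod>i<n. ennreal (gmix_density d k w a (X i)))" for X
    using gmix_density_pos[OF assms] by (auto simp: zero_less_iff_neq_zero ennreal_eq_0_iff not_le)
  ultimately show ?thesis
    unfolding samples_PGamma_eq_density[OF assms] by (simp add: AE_density)
qed

text \<open>A zero Hellinger risk would identify \<open>\<delta>\<^sub>0\<close> and \<open>\<delta>\<^sub>R\<close> almost surely under mutually absolutely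
  continuous sample laws.\<close>

lemma hellinger_rate_pos:
  assumes R: "R > 0" and k: "0 < k"
    and valid: "\<And>X. X \<in> space (samples n (Rd 1)) \<Longrightarrow> valid_params 1 k R (W X) (A X)"
    and W: "\<And>j. (\<lambda>X. W X j) \<in> borel_measurable (samples n (Rd 1))"
    and A: "\<And>j i. (\<lambda>X. A X j i) \<in> borel_measurable (samples n (Rd 1))"
    and risk: "\<And>w a. valid_params 1 k R w a \<Longrightarrow>
       (\<integral>\<^sup>+ X. ennreal (hellinger 1 (gmix_density 1 k (W X) (A X)) (gmix_density 1 k w a))
          \<partial>samples n (PGamma 1 k w a)) \<le> ennreal c"
  shows "0 < c"
proof (rule ccontr)
  assume "\<not> 0 < c"
  \<comment> \<open>\<open>ennreal\<close> truncates negative numbers, so every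
    \<open>c \<le> 0\<close> means zero risk.\<close>
  then have c: "ennreal c = 0" by (simp add: ennreal_neg)
  define w :: "nat \<Rightarrow> real" where "w j = of_bool (j = 0)" for j
  \<comment> \<open>Point masses at \<open>t\<close> in dimension 1: index 0 carries all weight and
    the other atoms are copies. The generating function at \<open>s = 1\<close> is
    \<open>exp t\<close> and separates them.\<close>
  define a :: "real \<Rightarrow> nat \<Rightarrow> nat \<Rightarrow> real" where "a t j = (\<lambda>i\<in>{..<1}. t)" for t j
  have va: "valid_params 1 k R w (a t)" if "0 \<le> t" "t \<le> R" for t
  proof -
    have "(\<Sum>j<k. w j) = (\<Sum>j\<in>{0}. w j)"
      using k by (intro sum.mono_neutral_right) (auto simp: w_def)
    then show ?thesis using that by (auto simp: valid_params_def w_def a_def space_Rd enorm_def)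
  qed
  have mg: "mgf 1 k w (a t) (\<lambda>_. 1) = exp t" for t
  proof -
    have "mgf 1 k w (a t) (\<lambda>_. 1) = (\<Sum>j\<in>{0}. w j * exp (\<Sum>i<1. 1 * a t j i))"
      unfolding mgf_def using k by (intro sum.mono_neutral_right) (auto simp: w_def)
    then show ?thesis by (simp add: w_def a_def)
  qed
  have AE: "AE X in PiM {..<n} (\<lambda>_. lebd 1). X \<in> space (samples n (Rd 1)) \<longrightarrow> mgf 1 k (W X) (A X) (\<lambda>_. 1) = exp t"
    if t: "0 \<le> t" "t \<le> R" for t
  proof -
    define H where "H X = hellinger 1 (gmix_density 1 k (W X) (A X)) (gmix_density 1 k w (a t))" for X
    have H[measurable]: "H \<in> borel_measurable (samples n (Rd 1))"
      unfolding H_def[abs_def] by (rule measurable_hellinger_estimator[OF W A])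
    have "(\<integral>\<^sup>+ X. ennreal (H X) \<partial>samples n (PGamma 1 k w (a t))) = 0"
      using risk[OF va[OF t]] c by (simp add: H_def)
    then have "AE X in samples n (PGamma 1 k w (a t)). ennreal (H X) = 0"
      by (subst (asm) nn_integral_0_iff_AE) measurable
    then have "AE X in PiM {..<n} (\<lambda>_. lebd 1). ennreal (H X) = 0"
      by (simp add: AE_samples_PGamma_iff[OF va[OF t]])
    then show ?thesis
    proof (eventually_elim, intro impI)
      fix X assume "ennreal (H X) = 0" and X: "X \<in> space (samples n (Rd 1))"
      then have "H X = 0" using hellinger_nonneg by (simp add: H_def ennreal_eq_0_iff order_antisym)
      then show "mgf 1 k (W X) (A X) (\<lambda>_. 1) = exp t"
        using mgf_diff_le_hellinger[OF valid[OF X] va[OF t] R, of "\<lambda>_. 1"] mg[of t]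
        by (simp add: H_def enorm_def)
    qed
  qed
  have "space (PiM {..<n} (\<lambda>_. lebd 1)) = space (samples n (Rd 1))"
    by (simp add: space_PiM samples_def)
  then have "AE X in PiM {..<n} (\<lambda>_. lebd 1). X \<in> space (samples n (Rd 1))"
    using AE_space[of "PiM {..<n} (\<lambda>_. lebd 1)"] by simp
  moreover have "AE X in PiM {..<n} (\<lambda>_. lebd 1). X \<in> space (samples n (Rd 1)) \<longrightarrow> mgf 1 k (W X) (A X) (\<lambda>_. 1) = exp 0"
    using R by (intro AE) auto
  moreover have "AE X in PiM {..<n} (\<lambda>_. lebd 1). X \<in> space (samples n (Rd 1)) \<longrightarrow> mgf 1 k (W X) (A X) (\<lambda>_. 1) = exp R"
    using R by (intro AE) auto
  ultimately have none: "AE X in PiM {..<n} (\<lambda>_. lebd 1). False"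
    by eventually_elim (use R in auto)
  interpret prob_space "samples n (PGamma 1 k w (a 0))"
    by (rule prob_space_samples_PGamma[OF va]) (use R in auto)
  have "AE X in samples n (PGamma 1 k w (a 0)). False"
    by (subst AE_samples_PGamma_iff[OF va[of 0]]) (use R none in auto)
  then show False using AE_False by simp
qed

section \<open>Sample splitting\<close>

lemma edist_linmap_tr:
  assumes "orthonormal_rows m d b"
  shows "edist d (linmap d m (tr b) x) (linmap d m (tr b) y) = edist m x y"
proof -
  have "edist d (linmap d m (tr b) x) (linmap d m (tr b) y) = enorm d (linmap d m (tr b) (\<lambda>r. x r - y r))"
    by (simp add: edist_def enorm_def linmap_def right_diff_distrib sum_subtractf)
  then show ?thesis by (simp add: enorm_linmap_tr[OF assms] edist_def)
qed

lemma edist_nonneg: "0 \<le> edist d x y"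
  by (simp add: edist_def enorm_nonneg)

text \<open>The route from a lifted estimated atom to \<open>a j\<close> goes through the projection
  of \<open>a j\<close>. The first leg is an \<open>m\<close>-dimensional distance because the lift
  is isometric; the second depends on \<open>j\<close> alone, so the plan sums out to its marginal
  \<open>w\<close>.\<close>

lemma W1_lift_le:
  assumes R: "R > 0" and m: "m \<le> k" and b: "orthonormal_rows m d b"
    and vv: "valid_params m k R v u" and va: "valid_params d k R w a"
    and h: "\<And>s. enorm m s \<le> 1 \<Longrightarrow> \<bar>mgf m k v u s - mgf m k w (\<lambda>j. linmap m d b (a j)) s\<bar> \<le> h"
  shows "W1 d (mixG d k v (\<lambda>j. linmap d m (tr b) (u j))) (mixG d k w a)
    \<le> ennreal ((\<Sum>j<k. w j * edist d (linmap d m (tr b) (linmap m d b (a j))) (a j))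
        + 16 * exp R * (1 + exp R) * real k ^ 5 * h powr (1 / (2 * real k - 1)))"
proof -
  let ?B = "linmap m d b" and ?T = "linmap d m (tr b)"
  obtain \<pi> where \<pi>: "transport_plan k v w \<pi>"
    "(\<Sum>i<k. \<Sum>j<k. \<pi> i j * edist m (u i) (?B (a j)))
      \<le> 16 * exp R * (1 + exp R) * real k ^ 5 * h powr (1 / (2 * real k - 1))"
    using mgf_transport[OF R m vv valid_params_linmap[OF va b] h] by blast
  have "W1 d (mixG d k v (\<lambda>j. ?T (u j))) (mixG d k w a)
    \<le> ennreal (\<Sum>i<k. \<Sum>j<k. \<pi> i j * edist d (?T (u i)) (a j))"
    using vv va by (intro W1_le_plan[OF \<pi>(1)]) (auto simp: valid_params_def)
  also have "\<dots> \<le> ennreal ((\<Sum>j<k. w j * edist d (?T (?B (a j))) (a j))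
        + (\<Sum>i<k. \<Sum>j<k. \<pi> i j * edist m (u i) (?B (a j))))"
  proof (rule ennreal_leI)
    have "(\<Sum>i<k. \<Sum>j<k. \<pi> i j * edist d (?T (u i)) (a j))
      \<le> (\<Sum>i<k. \<Sum>j<k. \<pi> i j * edist m (u i) (?B (a j)) + \<pi> i j * edist d (?T (?B (a j))) (a j))"
    proof (intro sum_mono)
      fix i j assume "i \<in> {..<k}" "j \<in> {..<k}"
      then have "0 \<le> \<pi> i j" using \<pi>(1) by (auto simp: transport_plan_def)
      then have "\<pi> i j * edist d (?T (u i)) (a j)
        \<le> \<pi> i j * (edist d (?T (u i)) (?T (?B (a j))) + edist d (?T (?B (a j))) (a j))"
        by (intro mult_left_mono edist_triangle)
      then show "\<pi> i j * edist d (?T (u i)) (a j)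
        \<le> \<pi> i j * edist m (u i) (?B (a j)) + \<pi> i j * edist d (?T (?B (a j))) (a j)"
        by (simp only: edist_linmap_tr[OF b] distrib_left)
    qed
    also have "\<dots> = (\<Sum>i<k. \<Sum>j<k. \<pi> i j * edist m (u i) (?B (a j)))
        + (\<Sum>j<k. \<Sum>i<k. \<pi> i j * edist d (?T (?B (a j))) (a j))"
      by (simp only: sum.distrib) (subst (2) sum.swap, rule refl)
    also have "(\<Sum>j<k. \<Sum>i<k. \<pi> i j * edist d (?T (?B (a j))) (a j))
        = (\<Sum>j<k. w j * edist d (?T (?B (a j))) (a j))"
      using \<pi>(1) by (intro sum.cong refl) (simp add: sum_distrib_right[symmetric] transport_plan_def)
    finally show "(\<Sum>i<k. \<Sum>j<k. \<pi> i j * edist d (?T (u i)) (a j))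
      \<le> (\<Sum>j<k. w j * edist d (?T (?B (a j))) (a j)) + (\<Sum>i<k. \<Sum>j<k. \<pi> i j * edist m (u i) (?B (a j)))"
      by simp
  qed
  also have "\<dots> \<le> ennreal ((\<Sum>j<k. w j * edist d (?T (?B (a j))) (a j))
        + 16 * exp R * (1 + exp R) * real k ^ 5 * h powr (1 / (2 * real k - 1)))"
    using \<pi>(2) by (intro ennreal_leI) simp
  finally show ?thesis .
qed

section \<open>Laws of the two halves of the sample\<close>

lemma nn_integral_samples_split:
  assumes P: "prob_space P" and F: "F \<in> borel_measurable (samples (2 * n) P)"
  shows "(\<integral>\<^sup>+X. F X \<partial>samples (2 * n) P)
    = (\<integral>\<^sup>+x. \<integral>\<^sup>+y. F (merge {..<n} {n..<2*n} (x, y)) \<partial>PiM {n..<2*n} (\<lambda>_. P) \<partial>samples n P)"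
proof -
  interpret P: prob_space P by fact
  interpret product_sigma_finite "\<lambda>_::nat. P" by standard
  have "{..<n} \<union> {n..<2*n} = {..<2*n}" "{..<n} \<inter> {n..<2*n} = {}" by auto
  then show ?thesis
    using product_nn_integral_fold[of "{..<n}" "{n..<2*n}" F] F by (simp add: samples_def)
qed

text \<open>The offset \<open>n + i\<close> renumbers the second half of a sample of size
  \<open>2 * n\<close> to indices below \<open>n\<close>, as an estimator from \<open>n\<close>
  observations expects.\<close>

definition push_samples :: "nat \<Rightarrow> ('a \<Rightarrow> 'b) \<Rightarrow> (nat \<Rightarrow> 'a) \<Rightarrow> nat \<Rightarrow> 'b" where
  "push_samples n f X = (\<lambda>i\<in>{..<n}. f (X (n + i)))"

lemma measurable_push_samples:
  assumes "f \<in> measurable M N" "{n..<2*n} \<subseteq> J"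
  shows "push_samples n f \<in> measurable (PiM J (\<lambda>_. M)) (PiM {..<n} (\<lambda>_. N))"
  unfolding push_samples_def[abs_def]
proof (intro measurable_restrict)
  fix i assume "i \<in> {..<n}"
  then have "n + i \<in> J" using assms(2) by auto
  then have "(\<lambda>X. X (n + i)) \<in> measurable (PiM J (\<lambda>_. M)) M"
    by (rule measurable_component_singleton)
  then show "(\<lambda>X. f (X (n + i))) \<in> measurable (PiM J (\<lambda>_. M)) N"
    by (rule measurable_compose[OF _ assms(1)])
qed

lemma distr_push_samples:
  assumes P: "prob_space P" and f: "f \<in> measurable P N"
  shows "distr (PiM {n..<2*n} (\<lambda>_. P)) (PiM {..<n} (\<lambda>_. N)) (push_samples n f)
    = PiM {..<n} (\<lambda>_. distr P N f)"
proof -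
  interpret P: prob_space P by fact
  interpret PS: product_sigma_finite "\<lambda>_::nat. P" by standard
  interpret D: prob_space "distr P N f" by (rule P.prob_space_distr[OF f])
  interpret DS: product_sigma_finite "\<lambda>_::nat. distr P N f" by standard
  have mp: "push_samples n f \<in> measurable (PiM {n..<2*n} (\<lambda>_. P)) (PiM {..<n} (\<lambda>_. N))"
    by (rule measurable_push_samples[OF f]) simp
  show ?thesis
  proof (rule DS.PiM_eqI)
    show "sets (distr (PiM {n..<2*n} (\<lambda>_. P)) (PiM {..<n} (\<lambda>_. N)) (push_samples n f))
      = sets (PiM {..<n} (\<lambda>_. distr P N f))"
      by (simp, rule sets_PiM_cong) auto
    fix A assume "\<And>i. i \<in> {..<n} \<Longrightarrow> A i \<in> sets (distr P N f)"
    then have A: "A i \<in> sets N" if "i < n" for i using that by simp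
    have "emeasure (distr (PiM {n..<2*n} (\<lambda>_. P)) (PiM {..<n} (\<lambda>_. N)) (push_samples n f)) (PiE {..<n} A)
      = emeasure (PiM {n..<2*n} (\<lambda>_. P)) (push_samples n f -` PiE {..<n} A \<inter> space (PiM {n..<2*n} (\<lambda>_. P)))"
      using A by (intro emeasure_distr mp sets_PiM_I_finite) auto
    also have "push_samples n f -` PiE {..<n} A \<inter> space (PiM {n..<2*n} (\<lambda>_. P))
      = PiE {n..<2*n} (\<lambda>j. f -` A (j - n) \<inter> space P)"
    proof (intro set_eqI iffI)
      fix X assume X: "X \<in> push_samples n f -` PiE {..<n} A \<inter> space (PiM {n..<2*n} (\<lambda>_. P))"
      then have ext: "X \<in> PiE {n..<2*n} (\<lambda>_. space P)" by (simp add: space_PiM)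
      have fX: "f (X j) \<in> A (j - n)" if "j \<in> {n..<2*n}" for j
      proof -
        have jn: "j - n < n" "n + (j - n) = j" using that by auto
        have "push_samples n f X \<in> PiE {..<n} A" using X by blast
        then have "push_samples n f X (j - n) \<in> A (j - n)" using jn(1) by (rule PiE_mem[OF _ lessThan_iff[THEN iffD2]])
        moreover have "push_samples n f X (j - n) = f (X j)"
          unfolding push_samples_def restrict_def using jn by (simp only: lessThan_iff if_True)
        ultimately show ?thesis by simp
      qed
      show "X \<in> PiE {n..<2*n} (\<lambda>j. f -` A (j - n) \<inter> space P)"
      proof (rule PiE_I)
        fix j assume j: "j \<in> {n..<2*n}"
        show "X j \<in> f -` A (j - n) \<inter> space P" using fX[OF j] PiE_mem[OF ext j] by simp
      qed (rule PiE_arb[OF ext])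
    next
      fix X assume X: "X \<in> PiE {n..<2*n} (\<lambda>j. f -` A (j - n) \<inter> space P)"
      have "f (X (n + i)) \<in> A i" if "i < n" for i
        using PiE_mem[OF X, of "n + i"] that by simp
      then have "push_samples n f X \<in> PiE {..<n} A" by (simp add: push_samples_def PiE_iff)
      moreover have "X \<in> space (PiM {n..<2*n} (\<lambda>_. P))" using X by (simp add: space_PiM PiE_iff)
      ultimately show "X \<in> push_samples n f -` PiE {..<n} A \<inter> space (PiM {n..<2*n} (\<lambda>_. P))" by simp
    qed
    also have "emeasure (PiM {n..<2*n} (\<lambda>_. P)) \<dots> = (\<Prod>j\<in>{n..<2*n}. emeasure P (f -` A (j - n) \<inter> space P))"
      using A by (intro PS.emeasure_PiM) (auto intro!: measurable_sets[OF f])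
    also have "\<dots> = (\<Prod>j\<in>{n..<2*n}. emeasure (distr P N f) (A (j - n)))"
      using A by (intro prod.cong refl emeasure_distr[OF f, symmetric]) auto
    also have "\<dots> = (\<Prod>i\<in>{..<n}. emeasure (distr P N f) (A i))"
      by (rule prod.reindex_bij_witness[of _ "\<lambda>i. i + n" "\<lambda>j. j - n"]) auto
    finally show "emeasure (distr (PiM {n..<2*n} (\<lambda>_. P)) (PiM {..<n} (\<lambda>_. N)) (push_samples n f)) (PiE {..<n} A)
      = (\<Prod>i\<in>{..<n}. emeasure (distr P N f) (A i))" .
  qed simp
qed

text \<open>\<open>k \<le> 2 ^ k \<le> 2 ^ (4 k - 2)\<close>. It absorbs the dimension
  \<open>m \<le> k\<close> of the second stage into the constant 2.\<close>

lemma powr_root_le_2: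
  assumes "0 < k"
  shows "real k powr (1 / (4 * real k - 2)) \<le> 2"
proof -
  have e: "0 < 4 * real k - 2" using assms by (cases k) auto
  have "real k \<le> 2 powr real k" using of_nat_less_two_power[of k, where 'a=real] by (simp add: powr_realpow)
  also have "\<dots> \<le> 2 powr (4 * real k - 2)" using assms by (intro powr_mono) (cases k, auto)
  finally have "real k powr (1 / (4 * real k - 2)) \<le> (2 powr (4 * real k - 2)) powr (1 / (4 * real k - 2))"
    using e by (intro powr_mono2) auto
  also have "\<dots> = 2" using e by (simp add: powr_powr)
  finally show ?thesis .
qed

text \<open>The square root halves the exponent \<open>1 / (2 k - 1)\<close> to
  \<open>1 / (4 k - 2)\<close>. Since \<open>\<kappa> \<ge> 1\<close>, its power is at most
  \<open>\<kappa>\<close>, which keeps the constant independent of \<open>k\<close>.\<close>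

lemma stage2_constant_le:
  fixes \<kappa> ck :: real
  assumes k: "0 < k" and n: "1 \<le> n" and ck: "0 < ck" and \<kappa>: "1 \<le> \<kappa>"
  shows "(\<kappa> * ck * sqrt (real k / real n)) powr (1 / (2 * real k - 1))
    \<le> 2 * \<kappa> * ck powr (1 / (2 * real k - 1)) * (1 / real n) powr (1 / (4 * real k - 2))"
proof -
  define p where "p = 1 / (2 * real k - 1)"
  define q where "q = 1 / (4 * real k - 2)"
  have e: "1 \<le> 2 * real k - 1" using k by (cases k) auto
  have p: "0 < p" "p \<le> 1" using e by (auto simp: p_def)
  have q: "1 / 2 * p = q" using e by (simp add: p_def q_def field_simps)
  have "sqrt (real k / real n) powr p = (real k / real n) powr (1 / 2 * p)"
    by (simp add: powr_half_sqrt[symmetric] powr_powr)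
  also have "\<dots> = (real k * (1 / real n)) powr q" unfolding q by simp
  also have "\<dots> = real k powr q * (1 / real n) powr q" by (rule powr_mult)
  also have "\<dots> \<le> 2 * (1 / real n) powr q"
    using powr_root_le_2[OF k] by (intro mult_right_mono) (auto simp: q_def)
  finally have 1: "sqrt (real k / real n) powr p \<le> 2 * (1 / real n) powr q" .
  have "\<kappa> powr p \<le> \<kappa> powr 1" using \<kappa> p by (intro powr_mono) auto
  then have 2: "\<kappa> powr p \<le> \<kappa>" using \<kappa> by simp
  have "(\<kappa> * ck * sqrt (real k / real n)) powr p = \<kappa> powr p * ck powr p * sqrt (real k / real n) powr p"
    using \<kappa> ck by (simp add: powr_mult)
  also have "\<dots> \<le> \<kappa> * ck powr p * (2 * (1 / real n) powr q)"
    using 1 2 \<kappa> by (intro mult_mono) auto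
  finally show ?thesis by (simp add: p_def q_def algebra_simps)
qed

lemma valid_params_lift:
  assumes "valid_params m k R v u" "orthonormal_rows m d b"
  shows "valid_params d k R v (\<lambda>j. linmap d m (tr b) (u j))"
  using assms(1) enorm_linmap_tr[OF assms(2)] by (auto simp: valid_params_def)

lemma two_stage_estimator:
  fixes R ck \<kappa> :: real and g :: "nat \<Rightarrow> (nat \<Rightarrow> nat \<Rightarrow> real) \<Rightarrow> nat"
    and V :: "nat \<Rightarrow> nat \<Rightarrow> nat \<Rightarrow> real" and U :: "nat \<Rightarrow> nat \<Rightarrow> nat \<Rightarrow> nat \<Rightarrow> real"
  assumes R: "R > 0" and k: "0 < k" and n: "1 \<le> n" and ck: "0 < ck" and \<kappa>: "1 \<le> \<kappa>"
    and g: "\<And>m. g m \<in> measurable (samples n (Rd m)) (count_space UNIV)"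
    and VU: "\<And>m l. valid_params m k R (V m l) (U m l)"
    and risk: "\<And>m w a. valid_params m k R w a \<Longrightarrow> \<exists>h \<in> borel_measurable (samples n (Rd m)).
        (\<forall>X\<in>space (samples n (Rd m)). 0 \<le> h X
          \<and> (\<forall>s. enorm m s \<le> 1 \<longrightarrow> \<bar>mgf m k (V m (g m X)) (U m (g m X)) s - mgf m k w a s\<bar> \<le> h X))
        \<and> (\<integral>\<^sup>+ X. ennreal (h X) \<partial>samples n (PGamma m k w a)) \<le> ennreal (\<kappa> * ck * sqrt (real (max 1 m) / real n))"
  shows "\<exists>Ghat :: (nat \<Rightarrow> nat \<Rightarrow> real) \<Rightarrow> (nat \<Rightarrow> real) measure.
    (\<forall>X\<in>space (samples (2*n) (Rd d)). prob_space (Ghat X) \<and> sets (Ghat X) = sets (Rd d)) \<and>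
    (\<forall>w a. valid_params d k R w a \<longrightarrow>
       (\<lambda>X. W1 d (Ghat X) (mixG d k w a)) \<in> borel_measurable (samples (2*n) (Rd d)) \<and>
       (\<integral>\<^sup>+ X. W1 d (Ghat X) (mixG d k w a) \<partial>samples (2*n) (PGamma d k w a))
       \<le> ennreal (2 * real k * sqrt \<kappa> * (sqrt ck * (real d / real n) powr (1/4))
          + 32 * exp R * (1 + exp R) * \<kappa> * (real k ^ 5 * ck powr (1 / (2 * real k - 1)) * (1 / real n) powr (1 / (4 * real k - 2)))))"
proof -
  define K where "K = 16 * exp R * (1 + exp R) * real k ^ 5"
  define p where "p = 1 / (2 * real k - 1)"
  have K0: "0 \<le> K" by (simp add: K_def add_nonneg_nonneg)
  have p01: "0 < p" "p \<le> 1" using k by (cases k; auto simp: p_def)+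
  \<comment> \<open>One basis per list index \<open>l\<close>, spanning the atoms of that entry.
    Countably many arbitrary choices suffice, with no measurable selection.\<close>
  define Q where "Q l m b \<longleftrightarrow> m \<le> k \<and> orthonormal_rows m d b \<and>
    (\<forall>j<k. \<forall>i<d. U d l j i = (\<Sum>r<m. (\<Sum>l'<d. b r l' * U d l j l') * b r i))" for l m b
  have "\<forall>l. \<exists>m b. Q l m b"
    unfolding Q_def using orthonormal_rows_spanning by blast
  then obtain mm bb where "\<And>l. Q l (mm l) (bb l)" by metis
  then have mm: "\<And>l. mm l \<le> k" and bb: "\<And>l. orthonormal_rows (mm l) d (bb l)"
    and span: "\<And>l j i. j < k \<Longrightarrow> i < d \<Longrightarrow> U d l j i = (\<Sum>r<mm l. (\<Sum>l'<d. bb l r l' * U d l j l') * bb l r i)"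
    by (auto simp: Q_def)
  define G where "G i l = mixG d k (V (mm i) l) (\<lambda>j. linmap d (mm i) (tr (bb i)) (U (mm i) l j))" for i l
  \<comment> \<open>\<open>I\<close> reads the first half and selects the basis; \<open>L i\<close>
    reads the second half projected along basis \<open>i\<close> and selects the estimate
    there.\<close>
  define I where "I X = g d (restrict X {..<n})" for X :: "nat \<Rightarrow> nat \<Rightarrow> real"
  define L where "L i X = g (mm i) (push_samples n (linmap (mm i) d (bb i)) X)" for i X
  define Ghat where "Ghat X = G (I X) (L (I X) X)" for X
  have mI: "I \<in> measurable (samples (2*n) (Rd d)) (count_space UNIV)"
    unfolding I_def[abs_def]
    by (rule measurable_compose[OF _ g]) (auto simp: samples_def intro!: measurable_restrict_subset)
  have mL: "L i \<in> measurable (samples (2*n) (Rd d)) (count_space UNIV)" for i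
    unfolding L_def[abs_def]
    by (rule measurable_compose[OF _ g]) (auto simp: samples_def intro!: measurable_push_samples)
  have "prob_space (Ghat X)" "sets (Ghat X) = sets (Rd d)" for X
    using prob_space_mixG[OF valid_params_lift[OF VU bb]] by (auto simp: Ghat_def G_def)
  moreover have mW: "(\<lambda>X. W1 d (Ghat X) N) \<in> borel_measurable (samples (2*n) (Rd d))" for N
  proof -
    have "(\<lambda>X. W1 d (G i (L i X)) N) \<in> borel_measurable (samples (2*n) (Rd d))" for i
      by (rule measurable_compose[OF mL]) simp
    from measurable_compose_countable[OF this mI] show ?thesis by (simp add: Ghat_def)
  qed
  moreover have "(\<integral>\<^sup>+ X. W1 d (Ghat X) (mixG d k w a) \<partial>samples (2*n) (PGamma d k w a))
       \<le> ennreal (2 * real k * sqrt \<kappa> * (sqrt ck * (real d / real n) powr (1/4))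
          + 32 * exp R * (1 + exp R) * \<kappa> * (real k ^ 5 * ck powr (1 / (2 * real k - 1)) * (1 / real n) powr (1 / (4 * real k - 2))))"
    if va: "valid_params d k R w a" for w a
  proof -
    let ?P = "PGamma d k w a" and ?J = "{n..<2*n}" and ?N = "mixG d k w a"
    have w0: "\<And>j. j < k \<Longrightarrow> 0 \<le> w j" using va by (simp add: valid_params_def)
    interpret P: prob_space ?P
      using va by (intro prob_space_PGamma) (auto simp: valid_params_def)
    interpret S: prob_space "samples n ?P" by (rule prob_space_samples_PGamma[OF va])
    interpret SJ: prob_space "PiM ?J (\<lambda>_. ?P)" by (intro prob_space_PiM P.prob_space_axioms)
    define s1 where "s1 i = (\<Sum>j<k. w j * edist d (linmap d (mm i) (tr (bb i)) (linmap (mm i) d (bb i) (a j))) (a j))" for i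
    have s10: "0 \<le> s1 i" for i unfolding s1_def using w0 by (intro sum_nonneg mult_nonneg_nonneg) (auto simp: edist_nonneg)
    define B1 where "B1 = 2 * real k * sqrt \<kappa> * (sqrt ck * (real d / real n) powr (1/4))"
    define B2 where "B2 = K * (\<kappa> * ck * sqrt (real k / real n)) powr p"
    have B0: "0 \<le> B1" "0 \<le> B2" using K0 ck \<kappa> by (auto simp: B1_def B2_def)
    \<comment> \<open>Given the first half \<open>x\<close>, index and basis are fixed while the
      second half remains independent of them, so its projection follows a fixed mixture
      law.\<close>
    have stage2: "(\<integral>\<^sup>+y. W1 d (Ghat (merge {..<n} ?J (x, y))) ?N \<partial>PiM ?J (\<lambda>_. ?P)) \<le> ennreal (s1 (g d x)) + ennreal B2"
      if x: "x \<in> space (samples n ?P)" for x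
    proof -
      define i where "i = g d x"
      define m where "m = mm i"
      define b where "b = bb i"
      have b: "orthonormal_rows m d b" using bb by (simp add: b_def m_def)
      have m: "m \<le> k" using mm by (simp add: m_def)
      let ?f = "push_samples n (linmap m d b)"
      have vBa: "valid_params m k R w (\<lambda>j. linmap m d b (a j))" by (rule valid_params_linmap[OF va b])
      obtain h where h[measurable]: "h \<in> borel_measurable (samples n (Rd m))"
        and h0: "\<And>X. X \<in> space (samples n (Rd m)) \<Longrightarrow> 0 \<le> h X"
        and hm: "\<And>X s. X \<in> space (samples n (Rd m)) \<Longrightarrow> enorm m s \<le> 1 \<Longrightarrow>
          \<bar>mgf m k (V m (g m X)) (U m (g m X)) s - mgf m k w (\<lambda>j. linmap m d b (a j)) s\<bar> \<le> h X"
        and hi: "(\<integral>\<^sup>+ X. ennreal (h X) \<partial>samples n (PGamma m k w (\<lambda>j. linmap m d b (a j))))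
          \<le> ennreal (\<kappa> * ck * sqrt (real (max 1 m) / real n))"
        using risk[OF vBa] by blast
      have mB: "linmap m d b \<in> measurable ?P (Rd m)"
        using measurable_linmap by (simp cong: measurable_cong_sets)
      have mf: "?f \<in> measurable (PiM ?J (\<lambda>_. ?P)) (samples n (Rd m))"
        unfolding samples_def by (rule measurable_push_samples[OF mB]) simp
      have law: "distr (PiM ?J (\<lambda>_. ?P)) (samples n (Rd m)) ?f = samples n (PGamma m k w (\<lambda>j. linmap m d b (a j)))"
      proof -
        from distr_push_samples[OF P.prob_space_axioms mB]
        show ?thesis by (simp add: samples_def distr_PGamma_linmap[OF b w0])
      qed
      interpret S2: prob_space "samples n (PGamma m k w (\<lambda>j. linmap m d b (a j)))"
        by (rule prob_space_samples_PGamma[OF vBa])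
      have "(\<integral>\<^sup>+y. W1 d (Ghat (merge {..<n} ?J (x, y))) ?N \<partial>PiM ?J (\<lambda>_. ?P))
        \<le> (\<integral>\<^sup>+y. ennreal (s1 i) + ennreal K * ennreal (h (?f y) powr p) \<partial>PiM ?J (\<lambda>_. ?P))"
      proof (rule nn_integral_mono)
        fix y assume y: "y \<in> space (PiM ?J (\<lambda>_. ?P))"
        have fy: "?f y \<in> space (samples n (Rd m))" using measurable_space[OF mf y] .
        have "restrict (merge {..<n} ?J (x, y)) {..<n} = x"
          using x by (auto simp: fun_eq_iff restrict_def merge_def space_samples_Rd PiE_iff extensional_def)
        then have I: "I (merge {..<n} ?J (x, y)) = i" by (simp add: I_def i_def)
        have "push_samples n f (merge {..<n} ?J (x, y)) = push_samples n f y" for f :: "(nat \<Rightarrow> real) \<Rightarrow> nat \<Rightarrow> real"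
          by (auto simp: push_samples_def fun_eq_iff merge_def)
        then have L: "L i (merge {..<n} ?J (x, y)) = g m (?f y)" by (simp add: L_def m_def b_def)
        have "W1 d (Ghat (merge {..<n} ?J (x, y))) ?N \<le> ennreal (s1 i + K * h (?f y) powr p)"
          unfolding Ghat_def I L G_def s1_def K_def p_def m_def[symmetric] b_def[symmetric]
          by (rule W1_lift_le[OF R m b VU va]) (rule hm[OF fy])
        then show "W1 d (Ghat (merge {..<n} ?J (x, y))) ?N \<le> ennreal (s1 i) + ennreal K * ennreal (h (?f y) powr p)"
          using s10[of i] K0 by (simp add: ennreal_mult)
      qed
      also have "\<dots> = ennreal (s1 i) + ennreal K * (\<integral>\<^sup>+y. ennreal (h (?f y) powr p) \<partial>PiM ?J (\<lambda>_. ?P))"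
      proof -
        have [measurable]: "(\<lambda>y. h (?f y)) \<in> borel_measurable (PiM ?J (\<lambda>_. ?P))"
          by (rule measurable_compose[OF mf h])
        show ?thesis
          by (subst nn_integral_add, measurable, subst nn_integral_cmult, measurable) (simp add: SJ.emeasure_space_1)
      qed
      also have "(\<integral>\<^sup>+y. ennreal (h (?f y) powr p) \<partial>PiM ?J (\<lambda>_. ?P))
        = (\<integral>\<^sup>+X. ennreal (h X powr p) \<partial>samples n (PGamma m k w (\<lambda>j. linmap m d b (a j))))"
        unfolding law[symmetric] by (rule nn_integral_distr[symmetric, OF mf]) measurable
      \<comment> \<open>The maximum covers \<open>m = 0\<close>, where the rate would vanish but the
        tangent bound wants a positive constant. Afterwards \<open>1 \<le> k\<close> and
        \<open>m \<le> k\<close> replace it by \<open>k\<close>.\<close>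
      also have "\<dots> \<le> ennreal ((\<kappa> * ck * sqrt (real (max 1 m) / real n)) powr p)"
        using h0 hi p01 \<kappa> ck n by (intro S2.nn_integral_powr_le) (auto simp del: of_nat_max)
      also have "\<dots> \<le> ennreal ((\<kappa> * ck * sqrt (real k / real n)) powr p)"
        using p01 \<kappa> ck n m k
        by (intro ennreal_leI powr_mono2 mult_left_mono real_sqrt_le_mono divide_right_mono) auto
      also have "ennreal K * \<dots> = ennreal B2" using K0 by (simp add: B2_def ennreal_mult)
      finally show ?thesis by (simp add: i_def add_left_mono mult_left_mono)
    qed
    have stage1: "(\<integral>\<^sup>+x. ennreal (s1 (g d x)) \<partial>samples n ?P) \<le> ennreal B1"
    \<comment> \<open>\<open>B1\<close> vanishes for \<open>d = 0\<close> while the rate in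
      \<open>risk\<close> has \<open>max 1 d\<close>; in dimension 0 all distances are 0.\<close>
    proof (cases "d = 0")
      case True
      then have "s1 i = 0" for i by (simp add: s1_def edist_def enorm_def)
      then show ?thesis by simp
    next
      case False
      obtain h where h[measurable]: "h \<in> borel_measurable (samples n (Rd d))"
        and h0: "\<And>X. X \<in> space (samples n (Rd d)) \<Longrightarrow> 0 \<le> h X"
        and hm: "\<And>X s. X \<in> space (samples n (Rd d)) \<Longrightarrow> enorm d s \<le> 1 \<Longrightarrow>
          \<bar>mgf d k (V d (g d X)) (U d (g d X)) s - mgf d k w a s\<bar> \<le> h X"
        and hi: "(\<integral>\<^sup>+ X. ennreal (h X) \<partial>samples n ?P) \<le> ennreal (\<kappa> * ck * sqrt (real (max 1 d) / real n))"
        using risk[OF va] by blast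
      have "(\<integral>\<^sup>+x. ennreal (s1 (g d x)) \<partial>samples n ?P)
        \<le> (\<integral>\<^sup>+x. ennreal (2 * real k) * ennreal (h x powr (1 / 2)) \<partial>samples n ?P)"
      proof (rule nn_integral_mono)
        fix x assume "x \<in> space (samples n ?P)"
        then have x: "x \<in> space (samples n (Rd d))" by simp
        have "s1 (g d x) \<le> 2 * real k * sqrt (h x)"
          unfolding s1_def by (rule projection_residual[OF va VU bb span hm[OF x]]) auto
        then have "ennreal (s1 (g d x)) \<le> ennreal (2 * real k * h x powr (1 / 2))"
          using h0[OF x] by (intro ennreal_leI) (simp add: powr_half_sqrt)
        then show "ennreal (s1 (g d x)) \<le> ennreal (2 * real k) * ennreal (h x powr (1 / 2))"
          by (simp add: ennreal_mult)
      qed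
      also have "\<dots> = ennreal (2 * real k) * (\<integral>\<^sup>+x. ennreal (h x powr (1 / 2)) \<partial>samples n ?P)"
        by (rule nn_integral_cmult) measurable
      also have "\<dots> \<le> ennreal (2 * real k) * ennreal ((\<kappa> * ck * sqrt (real d / real n)) powr (1 / 2))"
        using h0 hi \<kappa> ck n False by (intro mult_left_mono S.nn_integral_powr_le) (auto simp: max_def)
      also have "\<dots> = ennreal (2 * real k * (\<kappa> * ck * sqrt (real d / real n)) powr (1 / 2))"
        by (simp add: ennreal_mult)
      also have "(\<kappa> * ck * sqrt (real d / real n)) powr (1 / 2) = sqrt \<kappa> * (sqrt ck * (real d / real n) powr (1 / 4))"
      proof -
        have "sqrt (real d / real n) = (real d / real n) powr (1 / 2)" by (simp add: powr_half_sqrt)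
        then have "(\<kappa> * ck * sqrt (real d / real n)) powr (1 / 2) = \<kappa> powr (1 / 2) * ck powr (1 / 2) * (real d / real n) powr (1 / 4)"
          using \<kappa> ck by (simp add: powr_mult powr_powr)
        then show ?thesis using \<kappa> ck by (simp add: powr_half_sqrt)
      qed
      finally show ?thesis by (simp add: B1_def mult.assoc)
    qed
    have "(\<integral>\<^sup>+ X. W1 d (Ghat X) ?N \<partial>samples (2*n) ?P)
      = (\<integral>\<^sup>+x. \<integral>\<^sup>+y. W1 d (Ghat (merge {..<n} ?J (x, y))) ?N \<partial>PiM ?J (\<lambda>_. ?P) \<partial>samples n ?P)"
      by (rule nn_integral_samples_split[OF P.prob_space_axioms]) (use mW in simp)
    also have "\<dots> \<le> (\<integral>\<^sup>+x. ennreal (s1 (g d x)) + ennreal B2 \<partial>samples n ?P)"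
      by (rule nn_integral_mono) (rule stage2)
    also have "\<dots> = (\<integral>\<^sup>+x. ennreal (s1 (g d x)) \<partial>samples n ?P) + ennreal B2"
    proof -
      have [measurable]: "(\<lambda>x. ennreal (s1 (g d x))) \<in> borel_measurable (samples n (Rd d))"
        by (rule measurable_compose[OF g]) simp
      show ?thesis by (subst nn_integral_add, measurable) (simp add: S.emeasure_space_1 del: space_samples_PGamma)
    qed
    also have "\<dots> \<le> ennreal B1 + ennreal B2" using stage1 by (rule add_right_mono)
    also have "\<dots> = ennreal (B1 + B2)" using B0 by simp
    also have "\<dots> \<le> ennreal (B1 + 32 * exp R * (1 + exp R) * \<kappa> * (real k ^ 5 * ck powr (1 / (2 * real k - 1)) * (1 / real n) powr (1 / (4 * real k - 2))))"
    proof (intro ennreal_leI add_left_mono)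
      have "B2 \<le> K * (2 * \<kappa> * ck powr p * (1 / real n) powr (1 / (4 * real k - 2)))"
        unfolding B2_def p_def using K0 by (intro mult_left_mono stage2_constant_le k n ck \<kappa>)
      then show "B2 \<le> 32 * exp R * (1 + exp R) * \<kappa> * (real k ^ 5 * ck powr (1 / (2 * real k - 1)) * (1 / real n) powr (1 / (4 * real k - 2)))"
        by (simp add: K_def p_def algebra_simps)
    qed
    finally show ?thesis by (simp add: B1_def)
  qed
  ultimately show ?thesis by blast
qed

theorem mainTheorem10:
  fixes R :: real
  assumes "R > 0"
  shows "\<exists>C>0. \<forall>(k::nat) (ck::real) (n::nat).
    k \<ge> 2 \<longrightarrow> n \<ge> 1 \<longrightarrow>
    (\<forall>d. \<exists>(W :: (nat \<Rightarrow> nat \<Rightarrow> real) \<Rightarrow> nat \<Rightarrow> real)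
             (A :: (nat \<Rightarrow> nat \<Rightarrow> real) \<Rightarrow> nat \<Rightarrow> nat \<Rightarrow> real).
        (\<forall>X\<in>space (samples n (Rd d)). valid_params d k R (W X) (A X)) \<and>
        (\<forall>j. (\<lambda>X. W X j) \<in> borel_measurable (samples n (Rd d))) \<and>
        (\<forall>j i. (\<lambda>X. A X j i) \<in> borel_measurable (samples n (Rd d))) \<and>
        (\<forall>w a. valid_params d k R w a \<longrightarrow>
           (\<integral>\<^sup>+ X. ennreal (hellinger d (gmix_density d k (W X) (A X)) (gmix_density d k w a))
               \<partial>samples n (PGamma d k w a))
           \<le> ennreal (ck * sqrt (real d / real n)))) \<longrightarrow>
    (\<forall>d. \<exists>Ghat :: (nat \<Rightarrow> nat \<Rightarrow> real) \<Rightarrow> (nat \<Rightarrow> real) measure.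
        (\<forall>X\<in>space (samples (2*n) (Rd d)). prob_space (Ghat X) \<and> sets (Ghat X) = sets (Rd d)) \<and>
        (\<forall>w a. valid_params d k R w a \<longrightarrow>
           (\<lambda>X. W1 d (Ghat X) (mixG d k w a)) \<in> borel_measurable (samples (2*n) (Rd d)) \<and>
           (\<integral>\<^sup>+ X. W1 d (Ghat X) (mixG d k w a) \<partial>samples (2*n) (PGamma d k w a))
           \<le> ennreal ((C * real k) powr (real k / 2) * sqrt ck * (real d / real n) powr (1/4)
                + C * real k ^ 5 * ck powr (1 / (2 * real k - 1)) * (1 / real n) powr (1 / (4 * real k - 2)))))"
proof -
  \<comment> \<open>\<open>2 * exp (R + 1 / 2)\<close> is the Hellinger factor; the added 1 pays for
    rounding with a tolerance equal to the rate itself.\<close>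
  define \<kappa> where "\<kappa> = 2 * exp (R + 1 / 2) + 1"
  have \<kappa>: "1 \<le> \<kappa>" by (simp add: \<kappa>_def)
  \<comment> \<open>The transport constant \<open>16 * exp R * (1 + exp R)\<close>, doubled by the
    root of \<open>k\<close>, times \<open>\<kappa>\<close>.\<close>
  define C where "C = 32 * exp R * (1 + exp R) * \<kappa>"
  have "1 * 1 \<le> exp R * (1 + exp R)" using assms by (intro mult_mono) auto
  then have C: "32 * \<kappa> \<le> C" using \<kappa> mult_right_mono[of 1 "exp R * (1 + exp R)" "32 * \<kappa>"]
    by (simp add: C_def algebra_simps)
  show ?thesis
  proof (intro exI[of _ C] conjI allI impI)
    show "0 < C" using C \<kappa> by linarith
  next
    fix k :: nat and ck :: real and n d :: nat
    assume k: "2 \<le> k" and n: "1 \<le> n"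
    assume hyp: "\<forall>d. \<exists>(W :: (nat \<Rightarrow> nat \<Rightarrow> real) \<Rightarrow> nat \<Rightarrow> real)
             (A :: (nat \<Rightarrow> nat \<Rightarrow> real) \<Rightarrow> nat \<Rightarrow> nat \<Rightarrow> real).
        (\<forall>X\<in>space (samples n (Rd d)). valid_params d k R (W X) (A X)) \<and>
        (\<forall>j. (\<lambda>X. W X j) \<in> borel_measurable (samples n (Rd d))) \<and>
        (\<forall>j i. (\<lambda>X. A X j i) \<in> borel_measurable (samples n (Rd d))) \<and>
        (\<forall>w a. valid_params d k R w a \<longrightarrow>
           (\<integral>\<^sup>+ X. ennreal (hellinger d (gmix_density d k (W X) (A X)) (gmix_density d k w a))
               \<partial>samples n (PGamma d k w a))
           \<le> ennreal (ck * sqrt (real d / real n)))"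
    \<comment> \<open>\<open>ck\<close> is an arbitrary real; its sign is read off from the
      one-dimensional estimator.\<close>
    have "0 < ck * sqrt (real 1 / real n)"
    proof -
      obtain W A where "\<And>X. X \<in> space (samples n (Rd 1)) \<Longrightarrow> valid_params 1 k R (W X) (A X)"
        "\<And>j. (\<lambda>X. W X j) \<in> borel_measurable (samples n (Rd 1))"
        "\<And>j i. (\<lambda>X. A X j i) \<in> borel_measurable (samples n (Rd 1))"
        "\<And>w a. valid_params 1 k R w a \<Longrightarrow>
           (\<integral>\<^sup>+ X. ennreal (hellinger 1 (gmix_density 1 k (W X) (A X)) (gmix_density 1 k w a))
               \<partial>samples n (PGamma 1 k w a)) \<le> ennreal (ck * sqrt (real 1 / real n))"
        using hyp[rule_format, of 1] by blast
      then show ?thesis using k by (intro hellinger_rate_pos[OF assms, of k n W A]) auto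
    qed
    then have ck: "0 < ck" using n by (simp add: zero_less_mult_iff)
    define E where "E m g V U \<longleftrightarrow> g \<in> measurable (samples n (Rd m)) (count_space UNIV)
      \<and> (\<forall>l. valid_params m k R (V l) (U l))
      \<and> (\<forall>w a. valid_params m k R w a \<longrightarrow> (\<exists>h \<in> borel_measurable (samples n (Rd m)).
          (\<forall>X\<in>space (samples n (Rd m)). 0 \<le> h X
            \<and> (\<forall>s. enorm m s \<le> 1 \<longrightarrow> \<bar>mgf m k (V (g X)) (U (g X)) s - mgf m k w a s\<bar> \<le> h X))
          \<and> (\<integral>\<^sup>+ X. ennreal (h X) \<partial>samples n (PGamma m k w a)) \<le> ennreal (\<kappa> * ck * sqrt (real (max 1 m) / real n))))"
      for m and g :: "(nat \<Rightarrow> nat \<Rightarrow> real) \<Rightarrow> nat" and V U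
    have "\<exists>g V U. E m g V U" for m
    proof -
      obtain W A where WA: "\<And>X. X \<in> space (samples n (Rd m)) \<Longrightarrow> valid_params m k R (W X) (A X)"
        "\<And>j. (\<lambda>X. W X j) \<in> borel_measurable (samples n (Rd m))"
        "\<And>j i. (\<lambda>X. A X j i) \<in> borel_measurable (samples n (Rd m))"
        "\<And>w a. valid_params m k R w a \<Longrightarrow>
           (\<integral>\<^sup>+ X. ennreal (hellinger m (gmix_density m k (W X) (A X)) (gmix_density m k w a))
               \<partial>samples n (PGamma m k w a)) \<le> ennreal (ck * sqrt (real m / real n))"
        using hyp[rule_format, of m] by blast
      \<comment> \<open>With \<open>max 1 m\<close> the rate is positive in dimension 0 as well and
        can serve as the rounding tolerance.\<close>
      let ?c = "ck * sqrt (real (max 1 m) / real n)"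
      have c: "0 < ?c" using ck n by simp
      have "ck * sqrt (real m / real n) \<le> ?c"
        using ck by (intro mult_left_mono real_sqrt_le_mono divide_right_mono) auto
      then have "ennreal (ck * sqrt (real m / real n)) \<le> ennreal ?c" by (rule ennreal_leI)
      note risk = order_trans[OF WA(4) this]
      have "2 * exp (R + 1 / 2) * ?c + ?c = \<kappa> * ck * sqrt (real (max 1 m) / real n)"
        by (simp add: \<kappa>_def algebra_simps)
      with exists_quantized_estimator[OF assms c WA(1-3) risk less_imp_le[OF c]]
      show ?thesis unfolding E_def by simp
    qed
    then obtain g V U where "\<And>m. E m (g m) (V m) (U m)" by metis
    then have est:
      "\<And>m. (g m :: (nat \<Rightarrow> nat \<Rightarrow> real) \<Rightarrow> nat) \<in> measurable (samples n (Rd m)) (count_space UNIV)"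
      "\<And>m l. valid_params m k R (V m l) (U m l)"
      "\<And>m w a. valid_params m k R w a \<Longrightarrow> \<exists>h \<in> borel_measurable (samples n (Rd m)).
          (\<forall>X\<in>space (samples n (Rd m)). 0 \<le> h X
            \<and> (\<forall>s. enorm m s \<le> 1 \<longrightarrow> \<bar>mgf m k (V m (g m X)) (U m (g m X)) s - mgf m k w a s\<bar> \<le> h X))
          \<and> (\<integral>\<^sup>+ X. ennreal (h X) \<partial>samples n (PGamma m k w a)) \<le> ennreal (\<kappa> * ck * sqrt (real (max 1 m) / real n))"
      by (auto simp: E_def)
    \<comment> \<open>For \<open>k \<ge> 2\<close> the exponent \<open>k / 2\<close> is at least 1,
      and so is the base, hence \<open>(C * k) powr (k / 2)\<close> dominates \<open>C * k\<close>
      and with it the linear factor of the first stage.\<close>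
    have "2 * real k * sqrt \<kappa> \<le> (C * real k) powr (real k / 2)"
    proof -
      have "sqrt \<kappa> \<le> \<kappa>" using \<kappa> by (intro real_le_lsqrt) (auto simp: power2_eq_square)
      then have "2 * real k * sqrt \<kappa> \<le> C * real k" using C \<kappa> mult_left_mono[of "2 * sqrt \<kappa>" C "real k"]
        by (simp add: mult.commute mult.left_commute)
      also have "1 \<le> C * real k" using C \<kappa> k mult_mono[of 1 C 1 "real k"] by auto
      then have "C * real k \<le> (C * real k) powr (real k / 2)"
        using k powr_mono[of 1 "real k / 2" "C * real k"] by simp
      finally show ?thesis .
    qed
    then have bound: "2 * real k * sqrt \<kappa> * (sqrt ck * (real d / real n) powr (1/4))
          + 32 * exp R * (1 + exp R) * \<kappa> * (real k ^ 5 * ck powr (1 / (2 * real k - 1)) * (1 / real n) powr (1 / (4 * real k - 2)))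
        \<le> (C * real k) powr (real k / 2) * sqrt ck * (real d / real n) powr (1/4)
                + C * real k ^ 5 * ck powr (1 / (2 * real k - 1)) * (1 / real n) powr (1 / (4 * real k - 2))"
      using ck unfolding C_def[symmetric] mult.assoc[symmetric]
      by (intro add_mono mult_right_mono) auto
    have "0 < k" using k by simp
    from two_stage_estimator[OF assms this n ck \<kappa> est, of d]
    show "\<exists>Ghat :: (nat \<Rightarrow> nat \<Rightarrow> real) \<Rightarrow> (nat \<Rightarrow> real) measure.
        (\<forall>X\<in>space (samples (2*n) (Rd d)). prob_space (Ghat X) \<and> sets (Ghat X) = sets (Rd d)) \<and>
        (\<forall>w a. valid_params d k R w a \<longrightarrow>
           (\<lambda>X. W1 d (Ghat X) (mixG d k w a)) \<in> borel_measurable (samples (2*n) (Rd d)) \<and>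
           (\<integral>\<^sup>+ X. W1 d (Ghat X) (mixG d k w a) \<partial>samples (2*n) (PGamma d k w a))
           \<le> ennreal ((C * real k) powr (real k / 2) * sqrt ck * (real d / real n) powr (1/4)
                + C * real k ^ 5 * ck powr (1 / (2 * real k - 1)) * (1 / real n) powr (1 / (4 * real k - 2))))"
      using order_trans[OF _ ennreal_leI[OF bound]] by meson
  qed
qed

end
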